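(* Let $A$ be a $C^*$-algebra with stable $IR$, and let $p$ and $q$ be projections in $A$ which generate the same closed two-sided ideal of $A$ and which have the same image in $K_0(A)$. Then $p\sim q$.
   Context: For a $C^*$-algebra $A$, $\widetilde{A}$ denotes $A$ with an identity adjoined if $A$ is non-unital, and $\widetilde{A}=A$ if $A$ is unital. For a unital $C^*$-algebra $B$, $GL(B)$ is the set of invertible elements of $B$, and $R(B)$ is the set of all $b\in B$ for which there does not exist a closed two-sided ideal $K$ of $B$ such that $\pi(b)$ is one-sided invertible but not invertible, where $\pi:B\to B/K$ is the quotient map. A unital $C^*$-algebra $B$ has $IR$ if $R(B)$ is contained in the norm closure of $GL(B)$. A non-unital $C^*$-algebra $A$ has $IR$ if $\widetilde{A}$ does. A $C^*$-algebra $A$ has stable $IR$ if $A\otimes\mathbb{M}_n$ has $IR$ for all $n$, where $\mathbb{M}_n$ is the algebra of complex $n\times n$ matrices. $p\sim q$ denotes Murray--von Neumann equivalence: there is $u\in A$ with $u^*u=p$ and $uu^*=q$. *)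

theory Defs
  imports Complex_Main "HOL-Algebra.QuotRing" "Jordan_Normal_Form.Matrix"
begin

section \<open>C*-algebras\<close>

text \<open>
  A C*-algebra is a structure on a carrier set, extending the ring records of HOL-Algebra, so that
  unitizations, matrix algebras and quotients are again structures of this kind. An identity is
  not required; the field \<open>one\<close> is meaningful only if the algebra has an identity
  (axiom \<open>one_is_identity\<close> below).
\<close>

record 'a cstar = "'a ring" +
  cscale :: "complex \<Rightarrow> 'a \<Rightarrow> 'a"
  star :: "'a \<Rightarrow> 'a"
  cnorm :: "'a \<Rightarrow> real"

definition unital :: "('a, 'b) ring_scheme \<Rightarrow> bool" where
  "unital A \<longleftrightarrow> (\<exists>e\<in>carrier A. \<forall>x\<in>carrier A. e \<otimes>\<^bsub>A\<^esub> x = x \<and> x \<otimes>\<^bsub>A\<^esub> e = x)"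

locale cstar_algebra = abelian_group A for A :: "('a, 'b) cstar_scheme" (structure) +
  assumes mult_closed: "\<lbrakk>x \<in> carrier A; y \<in> carrier A\<rbrakk> \<Longrightarrow> x \<otimes> y \<in> carrier A"
    and mult_assoc: "\<lbrakk>x \<in> carrier A; y \<in> carrier A; z \<in> carrier A\<rbrakk>
      \<Longrightarrow> (x \<otimes> y) \<otimes> z = x \<otimes> (y \<otimes> z)"
    and l_distrib: "\<lbrakk>x \<in> carrier A; y \<in> carrier A; z \<in> carrier A\<rbrakk>
      \<Longrightarrow> (x \<oplus> y) \<otimes> z = x \<otimes> z \<oplus> y \<otimes> z"
    and r_distrib: "\<lbrakk>x \<in> carrier A; y \<in> carrier A; z \<in> carrier A\<rbrakk>
      \<Longrightarrow> x \<otimes> (y \<oplus> z) = x \<otimes> y \<oplus> x \<otimes> z"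
    and one_is_identity: "unital A
      \<Longrightarrow> \<one> \<in> carrier A \<and> (\<forall>x\<in>carrier A. \<one> \<otimes> x = x \<and> x \<otimes> \<one> = x)"
    and scale_closed: "x \<in> carrier A \<Longrightarrow> cscale A c x \<in> carrier A"
    and scale_add_right: "\<lbrakk>x \<in> carrier A; y \<in> carrier A\<rbrakk>
      \<Longrightarrow> cscale A c (x \<oplus> y) = cscale A c x \<oplus> cscale A c y"
    and scale_add_left: "x \<in> carrier A \<Longrightarrow> cscale A (c + d) x = cscale A c x \<oplus> cscale A d x"
    and scale_scale: "x \<in> carrier A \<Longrightarrow> cscale A c (cscale A d x) = cscale A (c * d) x"
    and scale_one: "x \<in> carrier A \<Longrightarrow> cscale A 1 x = x"
    and scale_mult_left: "\<lbrakk>x \<in> carrier A; y \<in> carrier A\<rbrakk>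
      \<Longrightarrow> cscale A c x \<otimes> y = cscale A c (x \<otimes> y)"
    and scale_mult_right: "\<lbrakk>x \<in> carrier A; y \<in> carrier A\<rbrakk>
      \<Longrightarrow> x \<otimes> cscale A c y = cscale A c (x \<otimes> y)"
    and star_closed: "x \<in> carrier A \<Longrightarrow> star A x \<in> carrier A"
    and star_star: "x \<in> carrier A \<Longrightarrow> star A (star A x) = x"
    and star_add: "\<lbrakk>x \<in> carrier A; y \<in> carrier A\<rbrakk> \<Longrightarrow> star A (x \<oplus> y) = star A x \<oplus> star A y"
    and star_scale: "x \<in> carrier A \<Longrightarrow> star A (cscale A c x) = cscale A (cnj c) (star A x)"
    and star_mult: "\<lbrakk>x \<in> carrier A; y \<in> carrier A\<rbrakk> \<Longrightarrow> star A (x \<otimes> y) = star A y \<otimes> star A x"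
    and norm_nonneg: "x \<in> carrier A \<Longrightarrow> 0 \<le> cnorm A x"
    and norm_eq_0: "x \<in> carrier A \<Longrightarrow> cnorm A x = 0 \<longleftrightarrow> x = \<zero>"
    and norm_triangle: "\<lbrakk>x \<in> carrier A; y \<in> carrier A\<rbrakk> \<Longrightarrow> cnorm A (x \<oplus> y) \<le> cnorm A x + cnorm A y"
    and norm_scale: "x \<in> carrier A \<Longrightarrow> cnorm A (cscale A c x) = cmod c * cnorm A x"
    and norm_mult: "\<lbrakk>x \<in> carrier A; y \<in> carrier A\<rbrakk> \<Longrightarrow> cnorm A (x \<otimes> y) \<le> cnorm A x * cnorm A y"
    and cstar_identity: "x \<in> carrier A \<Longrightarrow> cnorm A (star A x \<otimes> x) = (cnorm A x)\<^sup>2"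
    and complete: "\<lbrakk>\<And>n. X n \<in> carrier A;
        \<And>e. e > 0 \<Longrightarrow> \<exists>N. \<forall>m\<ge>N. \<forall>n\<ge>N. cnorm A (X m \<ominus> X n) < e\<rbrakk>
      \<Longrightarrow> \<exists>x\<in>carrier A. (\<lambda>n::nat. cnorm A (X n \<ominus> x)) \<longlonglongrightarrow> 0"

definition projections :: "('a, 'b) cstar_scheme \<Rightarrow> 'a set" where
  "projections A = {p \<in> carrier A. star A p = p \<and> p \<otimes>\<^bsub>A\<^esub> p = p}"

definition mvn_equiv :: "('a, 'b) cstar_scheme \<Rightarrow> 'a \<Rightarrow> 'a \<Rightarrow> bool" where
  "mvn_equiv A p q \<longleftrightarrow> (\<exists>u\<in>carrier A. star A u \<otimes>\<^bsub>A\<^esub> u = p \<and> u \<otimes>\<^bsub>A\<^esub> star A u = q)"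

definition norm_closure :: "('a, 'b) cstar_scheme \<Rightarrow> 'a set \<Rightarrow> 'a set" where
  "norm_closure A S = {x \<in> carrier A. \<forall>e>0. \<exists>y\<in>S. cnorm A (x \<ominus>\<^bsub>A\<^esub> y) < e}"

text \<open>The locale \<open>ideal\<close> of HOL-Algebra is not used since it is restricted to rings with identity.\<close>

definition closed_ideal :: "'a set \<Rightarrow> ('a, 'b) cstar_scheme \<Rightarrow> bool" where
  "closed_ideal K A \<longleftrightarrow> additive_subgroup K A
     \<and> (\<forall>k\<in>K. \<forall>c. cscale A c k \<in> K)
     \<and> (\<forall>k\<in>K. \<forall>x\<in>carrier A. x \<otimes>\<^bsub>A\<^esub> k \<in> K \<and> k \<otimes>\<^bsub>A\<^esub> x \<in> K)
     \<and> norm_closure A K \<subseteq> K"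

definition gen_closed_ideal :: "('a, 'b) cstar_scheme \<Rightarrow> 'a set \<Rightarrow> 'a set" where
  "gen_closed_ideal A S = \<Inter>{K. closed_ideal K A \<and> S \<subseteq> K}"

section \<open>Unitization\<close>

text \<open>
  The element \<open>(a, c)\<close> stands for \<open>a + c 1\<close>. The norm is the operator norm of left multiplication
  on \<open>A\<close>, which for non-unital \<open>A\<close> is the unique C*-norm on these pairs.
\<close>

definition unitization :: "('a, 'b) cstar_scheme \<Rightarrow> ('a \<times> complex) cstar" where
  "unitization A = \<lparr>
     carrier = carrier A \<times> UNIV,
     monoid.mult = (\<lambda>(a, c) (b, d).
       (a \<otimes>\<^bsub>A\<^esub> b \<oplus>\<^bsub>A\<^esub> cscale A d a \<oplus>\<^bsub>A\<^esub> cscale A c b, c * d)),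
     one = (\<zero>\<^bsub>A\<^esub>, 1),
     zero = (\<zero>\<^bsub>A\<^esub>, 0),
     add = (\<lambda>(a, c) (b, d). (a \<oplus>\<^bsub>A\<^esub> b, c + d)),
     cscale = (\<lambda>z (a, c). (cscale A z a, z * c)),
     star = (\<lambda>(a, c). (star A a, cnj c)),
     cnorm = (\<lambda>(a, c).
       Sup {cnorm A (a \<otimes>\<^bsub>A\<^esub> x \<oplus>\<^bsub>A\<^esub> cscale A c x) | x. x \<in> carrier A \<and> cnorm A x \<le> 1})\<rparr>"

text \<open>
  For unital \<open>A\<close> the algebra \<open>tilde A\<close> is \<open>A\<close> itself, written as the set of pairs \<open>(a, 0)\<close> so that
  both cases have the same element type; the identity is then \<open>(1, 0)\<close>.
\<close>

definition tilde :: "('a, 'b) cstar_scheme \<Rightarrow> ('a \<times> complex) cstar" where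
  "tilde A = (if unital A
     then (unitization A)\<lparr>carrier := carrier A \<times> {0}, one := (\<one>\<^bsub>A\<^esub>, 0),
            cnorm := (\<lambda>(a, c). cnorm A a)\<rparr>
     else unitization A)"

section \<open>Matrices over a C*-algebra\<close>

definition mats :: "('a, 'b) cstar_scheme \<Rightarrow> nat \<Rightarrow> nat \<Rightarrow> 'a mat set" where
  "mats A m n = {M \<in> carrier_mat m n. \<forall>i<m. \<forall>j<n. M $$ (i, j) \<in> carrier A}"

definition mmult :: "('a, 'b) cstar_scheme \<Rightarrow> 'a mat \<Rightarrow> 'a mat \<Rightarrow> 'a mat" where
  "mmult A M N = mat (dim_row M) (dim_col N)
     (\<lambda>(i, j). \<Oplus>\<^bsub>A\<^esub>k\<in>{0..<dim_col M}. M $$ (i, k) \<otimes>\<^bsub>A\<^esub> N $$ (k, j))"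

definition mstar :: "('a, 'b) cstar_scheme \<Rightarrow> 'a mat \<Rightarrow> 'a mat" where
  "mstar A M = mat (dim_col M) (dim_row M) (\<lambda>(i, j). star A (M $$ (j, i)))"

definition mzero :: "('a, 'b) cstar_scheme \<Rightarrow> nat \<Rightarrow> nat \<Rightarrow> 'a mat" where
  "mzero A m n = mat m n (\<lambda>_. \<zero>\<^bsub>A\<^esub>)"

definition dsum :: "('a, 'b) cstar_scheme \<Rightarrow> 'a mat \<Rightarrow> 'a mat \<Rightarrow> 'a mat" where
  "dsum A P Q = four_block_mat P (mzero A (dim_row P) (dim_col Q))
                               (mzero A (dim_row Q) (dim_col P)) Q"

text \<open>
  The norm of a column \<open>X\<close> in the Hilbert \<open>A\<close>-module \<open>A\<^sup>n\<close> is the square root of the norm of the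
  inner product of \<open>X\<close> with itself. The C*-norm of a matrix over \<open>A\<close> is the operator norm
  of the matrix acting on this module.
\<close>

definition column_norm :: "('a, 'b) cstar_scheme \<Rightarrow> 'a mat \<Rightarrow> real" where
  "column_norm A X = sqrt (cnorm A (mmult A (mstar A X) X $$ (0, 0)))"

text \<open>The C*-algebra of \<open>n \<times> n\<close> matrices over \<open>A\<close>, that is \<open>A \<otimes> M\<^sub>n\<close>.\<close>

definition matrix_alg :: "('a, 'b) cstar_scheme \<Rightarrow> nat \<Rightarrow> 'a mat cstar" where
  "matrix_alg A n = \<lparr>
     carrier = mats A n n,
     monoid.mult = mmult A,
     one = mat n n (\<lambda>(i, j). if i = j then \<one>\<^bsub>A\<^esub> else \<zero>\<^bsub>A\<^esub>),
     zero = mzero A n n,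
     add = (\<lambda>M N. mat n n (\<lambda>(i, j). M $$ (i, j) \<oplus>\<^bsub>A\<^esub> N $$ (i, j))),
     cscale = (\<lambda>c M. mat n n (\<lambda>(i, j). cscale A c (M $$ (i, j)))),
     star = mstar A,
     cnorm = (\<lambda>M. Sup {column_norm A (mmult A M X) | X. X \<in> mats A n 1 \<and> column_norm A X \<le> 1})\<rparr>"

section \<open>The property IR\<close>

text \<open>For unital \<open>B\<close>, \<open>GL(B)\<close> is \<open>Units B\<close>, and \<open>K +> b\<close> is the image of \<open>b\<close> in \<open>B Quot K\<close>.\<close>

definition one_sided_invertible :: "('a, 'b) ring_scheme \<Rightarrow> 'a \<Rightarrow> bool" where
  "one_sided_invertible R x \<longleftrightarrow> x \<in> carrier R \<and>
     (\<exists>y\<in>carrier R. y \<otimes>\<^bsub>R\<^esub> x = \<one>\<^bsub>R\<^esub> \<or> x \<otimes>\<^bsub>R\<^esub> y = \<one>\<^bsub>R\<^esub>)"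

definition IR_set :: "('a, 'b) cstar_scheme \<Rightarrow> 'a set" where
  "IR_set B = {b \<in> carrier B. \<not> (\<exists>K. closed_ideal K B
     \<and> one_sided_invertible (B Quot K) (K +>\<^bsub>B\<^esub> b) \<and> K +>\<^bsub>B\<^esub> b \<notin> Units (B Quot K))}"

definition has_IR :: "('a, 'b) cstar_scheme \<Rightarrow> bool" where
  "has_IR A \<longleftrightarrow> IR_set (tilde A) \<subseteq> norm_closure (tilde A) (Units (tilde A))"

definition stable_IR :: "('a, 'b) cstar_scheme \<Rightarrow> bool" where
  "stable_IR A \<longleftrightarrow> (\<forall>n\<ge>1. has_IR (matrix_alg A n))"

section \<open>The group \<open>K\<^sub>0\<close>\<close>

text \<open>
  Projections in matrix algebras of all sizes over a unital \<open>B\<close>, with Murray--von Neumann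
  equivalence implemented by rectangular matrices, so that sizes need not agree.
\<close>

definition mat_projections :: "('a, 'b) cstar_scheme \<Rightarrow> 'a mat set" where
  "mat_projections B = (\<Union>n\<in>{1..}. {P \<in> mats B n n. mstar B P = P \<and> mmult B P P = P})"

definition mat_mvn_equiv :: "('a, 'b) cstar_scheme \<Rightarrow> 'a mat \<Rightarrow> 'a mat \<Rightarrow> bool" where
  "mat_mvn_equiv B P Q \<longleftrightarrow> (\<exists>U\<in>mats B (dim_row Q) (dim_row P).
     mmult B (mstar B U) U = P \<and> mmult B U (mstar B U) = Q)"

text \<open>
  The Grothendieck construction: \<open>(P, Q)\<close> represents the formal difference \<open>[P] - [Q]\<close>.
\<close>

definition K0_rel :: "('a, 'b) cstar_scheme \<Rightarrow> (('a mat \<times> 'a mat) \<times> ('a mat \<times> 'a mat)) set" where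
  "K0_rel B = {((P, Q), (P', Q')).
     P \<in> mat_projections B \<and> Q \<in> mat_projections B \<and>
     P' \<in> mat_projections B \<and> Q' \<in> mat_projections B \<and>
     (\<exists>R\<in>mat_projections B.
        mat_mvn_equiv B (dsum B (dsum B P Q') R) (dsum B (dsum B P' Q) R))}"

definition K0_diff :: "('a, 'b) cstar_scheme \<Rightarrow> 'a mat \<Rightarrow> 'a mat \<Rightarrow> ('a mat \<times> 'a mat) set" where
  "K0_diff B P Q = K0_rel B `` {(P, Q)}"

definition K0_unital :: "('a, 'b) cstar_scheme \<Rightarrow> ('a mat \<times> 'a mat) set monoid" where
  "K0_unital B = \<lparr>
     carrier = (mat_projections B \<times> mat_projections B) // K0_rel B,
     monoid.mult = (\<lambda>X Y. \<Union>(P, Q)\<in>X. \<Union>(P', Q')\<in>Y. K0_diff B (dsum B P P') (dsum B Q Q')),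
     one = K0_diff B (mzero B 1 1) (mzero B 1 1)\<rparr>"

definition K0_map :: "('c, 'd) cstar_scheme \<Rightarrow> ('a \<Rightarrow> 'c)
    \<Rightarrow> ('a mat \<times> 'a mat) set \<Rightarrow> ('c mat \<times> 'c mat) set" where
  "K0_map C f X = (\<Union>(P, Q)\<in>X. K0_diff C (map_mat f P) (map_mat f Q))"

definition complex_cstar :: "complex cstar" where
  "complex_cstar = \<lparr>carrier = UNIV, monoid.mult = (*), one = 1, zero = 0, add = (+),
     cscale = (*), star = cnj, cnorm = cmod\<rparr>"

text \<open>
  For non-unital \<open>A\<close>, \<open>K\<^sub>0(A)\<close> is the kernel of the map from \<open>K\<^sub>0\<close> of the unitization to \<open>K\<^sub>0\<close> of
  the complex numbers induced by the scalar part. The class of a projection of \<open>A\<close> is the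
  class \<open>[p] - [0]\<close> of the corresponding \<open>1 \<times> 1\<close> matrix over \<open>tilde A\<close>.
\<close>

definition K0 :: "('a, 'b) cstar_scheme \<Rightarrow> (('a \<times> complex) mat \<times> ('a \<times> complex) mat) set monoid" where
  "K0 A = (if unital A then K0_unital (tilde A)
     else (K0_unital (tilde A))
       \<lparr>carrier := kernel (K0_unital (tilde A)) (K0_unital complex_cstar) (K0_map complex_cstar snd)\<rparr>)"

definition K0_class :: "('a, 'b) cstar_scheme \<Rightarrow> 'a
    \<Rightarrow> (('a \<times> complex) mat \<times> ('a \<times> complex) mat) set" where
  "K0_class A p = K0_diff (tilde A) (mat 1 1 (\<lambda>_. (p, 0))) (mzero (tilde A) 1 1)"

end

theory Submission
  imports Defs
begin

text \<open>
  Let \<open>C\<close> be the unitization of \<open>A\<close>. Equality in \<open>K\<^sub>0\<close> gives \<open>p \<oplus> R \<sim> q \<oplus> R\<close> for a projection \<open>R\<close> over \<open>C\<close>.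
  Filling up with complements yields a matrix \<open>x\<close> over \<open>C\<close> with \<open>x\<^sup>* x = 1 - p\<close> and \<open>x x\<^sup>* = 1 - q\<close>, and a
  scalar unitary moves \<open>x\<close> into the unitization of a matrix algebra over \<open>A\<close>. If \<open>x\<close> is one-sided invertible
  modulo a closed ideal, then that ideal contains \<open>p\<close> or \<open>q\<close>, hence both, so \<open>x\<close> is invertible modulo it. By
  stable \<open>IR\<close>, \<open>x\<close> is a limit of invertible elements \<open>y\<close>, and for \<open>y\<close> close to \<open>x\<close> a Schur complement of \<open>y\<close>
  is an isomorphism from \<open>p\<close> to \<open>q\<close>, whose polar part implements \<open>p \<sim> q\<close>.
\<close>

section \<open>Unital C*-algebras as a type class\<close>

text \<open>Square roots, positivity and polar parts are proved for a type class, while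
  \<open>A\<close> is only a carrier set in a record and no type can depend on it. Hence one type
  \<open>amb\<close> is built that contains every C*-algebra on the given element type as an ideal;
  matrices over \<open>A\<close>, over its unitization and over the scalars all become finitely
  supported matrices over \<open>amb\<close>. The scalar unitary is forced by the shape of the
  hypothesis: \<open>IR\<close> is assumed for the unitization of the matrices over
  \<open>A\<close>, whose scalar parts are multiples of the identity matrix, while for non-unital
  \<open>A\<close> a matrix coming from \<open>K0\<close> has an arbitrary matrix as scalar part.
  The supremum norms on matrix algebras and their unitizations enter only through entrywise
  estimates: elements close in norm have close entries, and the corner embedding of \<open>A\<close>
  is bounded. The hypothesis on ideals speaks of \<open>A\<close>, the definition of
  \<open>IR\<close> of ideals in the matrix unitizations. The upper left corner of such an ideal
  links the two.\<close>

class cstar1 = real_normed_algebra_1 + banach +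
  fixes adj :: "'a \<Rightarrow> 'a" and cc :: "complex \<Rightarrow> 'a"
  assumes adj_adj [simp]: "adj (adj x) = x"
    and adj_add: "adj (x + y) = adj x + adj y"
    and adj_mult: "adj (x * y) = adj y * adj x"
    and norm_le_adj_mult: "(norm x)\<^sup>2 \<le> norm (adj x * x)"
    and cc_add: "cc (a + b) = cc a + cc b"
    and cc_mult: "cc (a * b) = cc a * cc b"
    and cc_scaleR_1: "cc (complex_of_real r) = r *\<^sub>R 1"
    and cc_commute: "cc a * x = x * cc a"
    and adj_cc: "adj (cc a) = cc (cnj a)"

text \<open>Complex scalars occur only as the central elements \<open>cc c\<close>, next to the real
  vector space structure; this identifies the two on the reals.\<close>

lemma cc_of_real: "cc (of_real r) = (of_real r :: 'a::cstar1)"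
  by (metis cc_scaleR_1 of_real_def)

lemma cc_0 [simp]: "cc 0 = (0::'a::cstar1)" and cc_1 [simp]: "cc 1 = (1::'a::cstar1)"
  using cc_of_real[of 0] cc_of_real[of 1] by auto

lemma adj_of_real [simp]: "adj (of_real r) = (of_real r :: 'a::cstar1)"
  using adj_cc[of "of_real r", where 'a = 'a] by (simp add: cc_of_real)

lemma adj_0 [simp]: "adj 0 = (0::'a::cstar1)" and adj_1 [simp]: "adj 1 = (1::'a::cstar1)"
  using adj_of_real[of 0] adj_of_real[of 1] by auto

lemma adj_minus [simp]: "adj (- x) = - adj (x::'a::cstar1)"
  using adj_add[of x "- x"] by (simp add: minus_unique)

lemma adj_diff: "adj (x - y) = adj x - adj (y::'a::cstar1)"
  using adj_add[of x "- y"] by (simp add: minus_unique)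

lemma adj_scaleR [simp]: "adj (r *\<^sub>R x) = r *\<^sub>R adj (x::'a::cstar1)"
proof -
  have "adj (of_real r * x) = of_real r * adj x"
    using adj_mult[of "of_real r" x] cc_commute[of "of_real r" "adj x"] by (simp add: cc_of_real)
  thus ?thesis by (simp add: scaleR_conv_of_real)
qed

lemma norm_adj [simp]: "norm (adj x) = norm (x::'a::cstar1)"
proof -
  have le: "norm y \<le> norm (adj y)" for y :: 'a
  proof (cases "norm y = 0")
    case False
    have "norm y * norm y \<le> norm (adj y) * norm y"
      using norm_le_adj_mult[of y] norm_mult_ineq[of "adj y" y] by (simp add: power2_eq_square)
    thus ?thesis using False by simp
  qed auto
  from le[of x] le[of "adj x"] show ?thesis by simp
qed

lemma norm_adj_mult: "norm (adj x * x) = (norm (x::'a::cstar1))\<^sup>2"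
  using norm_le_adj_mult[of x] norm_mult_ineq[of "adj x" x] by (simp add: power2_eq_square)

lemma adj_mult_eq_0: "adj x * x = 0 \<Longrightarrow> x = (0::'a::cstar1)"
  using norm_adj_mult[of x] by simp

lemma tendsto_adj: "(f \<longlongrightarrow> (l::'a::cstar1)) F \<Longrightarrow> ((\<lambda>x. adj (f x)) \<longlongrightarrow> adj l) F"
  by (rule bounded_linear.tendsto[OF bounded_linear_intro[where K = 1]]) (auto simp: adj_add)

section \<open>Square roots by a majorized iteration\<close>

primrec sqrt_iter :: "'a::real_normed_algebra_1 \<Rightarrow> nat \<Rightarrow> 'a" where
  "sqrt_iter e 0 = 0"
| "sqrt_iter e (Suc n) = (1/2) *\<^sub>R (e + sqrt_iter e n * sqrt_iter e n)"

lemma sqrt_iter_1: "0 \<le> sqrt_iter (1::real) n" "sqrt_iter (1::real) n \<le> 1"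
  "sqrt_iter (1::real) n \<le> sqrt_iter 1 (Suc n)"
proof (induction n)
  case (Suc n)
  have *: "x * x \<le> 1" if "0 \<le> x" "x \<le> 1" for x :: real
    using that by (simp add: mult_le_one)
  { case 1 show ?case using Suc by simp }
  { case 2 show ?case using Suc *[of "sqrt_iter (1::real) n"] by simp }
  { case 3
    have "sqrt_iter (1::real) n * sqrt_iter 1 n \<le> sqrt_iter 1 (Suc n) * sqrt_iter 1 (Suc n)"
      using Suc by (intro mult_mono) auto
    thus ?case by simp }
qed simp_all

text \<open>The recursion has nonnegative coefficients, so its real instance at 1, an increasing
  sequence bounded by 1, dominates the norms step by step. This takes the place of estimates on the
  binomial series.\<close>

lemma norm_sqrt_iter:
  assumes "norm e \<le> 1" shows "norm (sqrt_iter e n) \<le> sqrt_iter (1::real) n"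
proof (induction n)
  case (Suc n)
  have "norm (e + sqrt_iter e n * sqrt_iter e n) \<le> 1 + sqrt_iter (1::real) n * sqrt_iter 1 n"
    by (intro order.trans[OF norm_triangle_ineq] add_mono assms
          order.trans[OF norm_mult_ineq] mult_mono Suc) (auto simp: sqrt_iter_1)
  thus ?case by simp
qed simp

text \<open>Writing \<open>a * a - b * b\<close> as \<open>a * (a - b) + (a - b) * b\<close> needs
  no commutation. The same identity holds with equality for the real majorant, so the increments are
  dominated by those of a convergent real sequence.\<close>

lemma norm_sqrt_iter_diff:
  assumes "norm e \<le> 1"
  shows "norm (sqrt_iter e (Suc n) - sqrt_iter e n) \<le> sqrt_iter (1::real) (Suc n) - sqrt_iter 1 n"
proof (induction n)
  case (Suc n)
  let ?s = "sqrt_iter e" and ?r = "sqrt_iter (1::real)"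
  have eq: "?s (Suc (Suc n)) - ?s (Suc n) =
      (1/2) *\<^sub>R (?s (Suc n) * (?s (Suc n) - ?s n) + (?s (Suc n) - ?s n) * ?s n)"
    by (simp only: sqrt_iter.simps(2)[of e "Suc n"]) (simp add: algebra_simps)
  have "norm (?s (Suc n) * (?s (Suc n) - ?s n) + (?s (Suc n) - ?s n) * ?s n)
      \<le> ?r (Suc n) * (?r (Suc n) - ?r n) + (?r (Suc n) - ?r n) * ?r n"
    by (intro order.trans[OF norm_triangle_ineq] add_mono order.trans[OF norm_mult_ineq]
        mult_mono Suc norm_sqrt_iter assms norm_ge_zero sqrt_iter_1) (use sqrt_iter_1(3)[of n] in auto)
  hence "norm (?s (Suc (Suc n)) - ?s (Suc n))
      \<le> (1/2) * (?r (Suc n) * (?r (Suc n) - ?r n) + (?r (Suc n) - ?r n) * ?r n)"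
    by (simp only: eq norm_scaleR) simp
  also have "\<dots> = ?r (Suc (Suc n)) - ?r (Suc n)"
    by (simp only: sqrt_iter.simps(2)[of 1 "Suc n"]) (simp add: algebra_simps)
  finally show ?case .
qed (use assms in simp)

text \<open>A fixed point of the recursion satisfies \<open>2 *\<^sub>R s = e + s * s\<close>, that
  is, \<open>1 - s\<close> squares to \<open>1 - e\<close>. The bound on \<open>s\<close> makes
  \<open>1 - s\<close> positive later on. The commutation clause stands in for functional calculus:
  \<open>s\<close> is a limit of polynomials in \<open>e\<close>.\<close>

lemma sqrt_one_minus:
  fixes e :: "'a::cstar1"
  assumes e: "norm e \<le> 1" "adj e = e"
  obtains s where "(1 - s) * (1 - s) = 1 - e" "norm s \<le> 1" "adj s = s"
    "\<And>z. z * e = e * z \<Longrightarrow> z * s = s * z"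
proof -
  let ?s = "sqrt_iter e" and ?r = "sqrt_iter (1::real)"
  have "monoseq ?r" using sqrt_iter_1(3) by (auto simp: monoseq_Suc)
  moreover have "Bseq ?r" using sqrt_iter_1 by (intro BseqI[of 1]) auto
  ultimately have "convergent ?r" by (rule Bseq_monoseq_convergent[rotated])
  then obtain l where "?r \<longlonglongrightarrow> l" by (auto simp: convergent_def)
  hence "summable (\<lambda>n. ?r (Suc n) - ?r n)" by (rule telescope_summable)
  hence "summable (\<lambda>n. ?s (Suc n) - ?s n)"
    by (rule summable_comparison_test'[where N = 0]) (rule norm_sqrt_iter_diff[OF e(1)])
  hence "(\<lambda>n. \<Sum>k<n. ?s (Suc k) - ?s k) \<longlonglongrightarrow> (\<Sum>n. ?s (Suc n) - ?s n)"
    by (rule summable_LIMSEQ)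
  moreover have "(\<Sum>k<n. ?s (Suc k) - ?s k) = ?s n" for n
    using sum_lessThan_telescope[of ?s n] by simp
  ultimately obtain s where s: "?s \<longlonglongrightarrow> s" by auto
  have s': "(\<lambda>n. ?s (Suc n)) \<longlonglongrightarrow> s" using s by (rule LIMSEQ_Suc)
  have "(\<lambda>n. ?s (Suc n)) \<longlonglongrightarrow> (1/2) *\<^sub>R (e + s * s)"
    by (auto intro!: tendsto_intros s)
  with s' have "s = (1/2) *\<^sub>R (e + s * s)" by (rule LIMSEQ_unique)
  hence "2 *\<^sub>R s = e + s * s" by (metis scaleR_half_double scaleR_2 scaleR_add_right)
  hence 1: "(1 - s) * (1 - s) = 1 - e" by (simp add: algebra_simps scaleR_2)
  have "norm (?s n) \<le> 1" for n
    using norm_sqrt_iter[OF e(1), of n] sqrt_iter_1(2)[of n] by simp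
  hence 2: "norm s \<le> 1" using s by (intro LIMSEQ_le_const2[OF tendsto_norm]) auto
  have "adj (?s n) = ?s n" for n by (induction n) (simp_all add: adj_add adj_mult e)
  hence 3: "adj s = s" using tendsto_adj[OF s] s by (simp add: LIMSEQ_unique)
  have 4: "z * s = s * z" if z: "z * e = e * z" for z
  proof -
    have "z * ?s n = ?s n * z" for n
    proof (induction n)
      case (Suc n)
      have "z * (?s n * ?s n) = ?s n * ?s n * z" using Suc by (metis mult.assoc)
      thus ?case using z by (simp add: algebra_simps)
    qed simp
    moreover have "(\<lambda>n. z * ?s n) \<longlonglongrightarrow> z * s" "(\<lambda>n. ?s n * z) \<longlonglongrightarrow> s * z"
      by (intro tendsto_intros s)+
    ultimately show ?thesis by (simp add: LIMSEQ_unique)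
  qed
  show thesis by (rule that[OF 1 2 3 4])
qed

section \<open>Positive elements without spectra\<close>

definition pos :: "'a::cstar1 \<Rightarrow> bool" where
  "pos h \<longleftrightarrow> adj h = h \<and> (\<exists>l\<ge>0. norm (of_real l - h) \<le> l)"

lemma pos_adj: "pos h \<Longrightarrow> adj h = h" by (simp add: pos_def)

lemma pos_of_real: "r \<ge> 0 \<Longrightarrow> pos (of_real r)"
  unfolding pos_def by (auto intro!: exI[of _ r])

text \<open>The condition in \<open>pos\<close> is the spectral one in disguise: a selfadjoint
  \<open>h\<close> within distance \<open>l\<close> of \<open>l\<close> has its spectrum between 0
  and \<open>2 * l\<close>. In this form sums cost only the triangle inequality.\<close>

lemma pos_add: assumes "pos a" "pos b" shows "pos (a + b)"
proof -
  from assms obtain k l where *: "k \<ge> 0" "l \<ge> 0" "norm (of_real k - a) \<le> k" "norm (of_real l - b) \<le> l"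
    by (auto simp: pos_def)
  have "of_real (k + l) - (a + b) = (of_real k - a) + (of_real l - b)" by simp
  hence "norm (of_real (k + l) - (a + b)) \<le> k + l"
    using norm_triangle_le[OF add_mono[OF *(3,4)]] by (simp only:)
  with * assms show ?thesis unfolding pos_def adj_add by (metis add_nonneg_nonneg)
qed

lemma pos_scaleR: assumes "pos a" "r \<ge> 0" shows "pos (r *\<^sub>R a)"
proof -
  from assms obtain k where *: "k \<ge> 0" "norm (of_real k - a) \<le> k" by (auto simp: pos_def)
  have "of_real (r * k) - r *\<^sub>R a = r *\<^sub>R (of_real k - a)"
    by (simp add: scaleR_conv_of_real right_diff_distrib)
  hence "norm (of_real (r * k) - r *\<^sub>R a) \<le> r * k" using * assms by (simp add: mult_left_mono)
  with * assms show ?thesis unfolding pos_def by (auto intro!: exI[of _ "r * k"])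
qed

lemma pos_diff_norm: assumes "adj a = a" "norm a \<le> r" shows "pos (of_real r - a)"
proof -
  have "r \<ge> 0" using assms norm_ge_zero[of a] by linarith
  thus ?thesis using assms unfolding pos_def by (auto simp: adj_diff intro!: exI[of _ r])
qed

text \<open>Dividing by the witness \<open>k\<close> turns positivity of \<open>h\<close> into
  \<open>norm e \<le> 1\<close> for \<open>e = 1 - h / k\<close>, and the root is
  \<open>sqrt k\<close> times the root of \<open>1 - e\<close>. If \<open>k = 0\<close>, the
  inequality forces \<open>h = 0\<close>.\<close>

lemma pos_sqrt:
  assumes "pos h"
  obtains c where "adj c = c" "c * c = h" "pos c" "\<And>z. z * h = h * z \<Longrightarrow> z * c = c * z"
proof -
  from assms obtain k where k: "k \<ge> 0" "norm (of_real k - h) \<le> k" "adj h = h" by (auto simp: pos_def)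
  show thesis
  proof (cases "k = 0")
    case True
    with k have "h = 0" by simp
    thus thesis using that[of 0] pos_of_real[of 0] by simp
  next
    case False
    define e where "e = 1 - (1/k) *\<^sub>R h"
    have "e = (1/k) *\<^sub>R (of_real k - h)" using False
      by (simp add: e_def scaleR_conv_of_real right_diff_distrib flip: of_real_mult)
    hence "norm e \<le> 1" using k False by (simp add: divide_simps)
    moreover have "adj e = e" using k by (simp add: e_def adj_diff)
    ultimately obtain s where s: "(1 - s) * (1 - s) = 1 - e" "norm s \<le> 1" "adj s = s"
      "\<And>z. z * e = e * z \<Longrightarrow> z * s = s * z" using sqrt_one_minus by blast
    define c where "c = sqrt k *\<^sub>R (1 - s)"
    have "c * c = (sqrt k * sqrt k) *\<^sub>R ((1 - s) * (1 - s))" by (simp add: c_def)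
    also have "\<dots> = h" using s(1) k False by (simp add: e_def)
    finally have "c * c = h" .
    moreover have "pos (1 - s)" using pos_diff_norm[OF s(3,2)] by simp
    hence "pos c" unfolding c_def using k by (intro pos_scaleR) auto
    moreover have "z * c = c * z" if "z * h = h * z" for z
      using s(4)[of z] that by (simp add: c_def e_def algebra_simps)
    ultimately show thesis using that[of c] pos_adj by blast
  qed
qed

definition ii :: "'a::cstar1" where "ii = cc \<i>"

lemma ii_mult: "ii * ii = - (1::'a::cstar1)"
  using cc_mult[of \<i> \<i>, where 'a = 'a] cc_of_real[of "-1", where 'a = 'a] by (simp add: ii_def)
lemma adj_ii: "adj ii = - (ii::'a::cstar1)"
  using adj_cc[of \<i>, where 'a = 'a] cc_add[of \<i> "-\<i>", where 'a = 'a] by (simp add: ii_def minus_unique)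
lemma ii_commute: "ii * x = x * ii" by (simp add: ii_def cc_commute)
lemma ii_cancel: "ii * (ii * x) = - (x::'a::cstar1)"
  using ii_mult[where 'a = 'a] by (metis mult.assoc mult_minus1)

lemma ii_left_commute: "x * (ii * y) = ii * (x * y)"
  by (metis ii_commute mult.assoc)

lemma norm_le_of_adj_mult:
  assumes "norm (adj x * x) \<le> r\<^sup>2" "r \<ge> 0" shows "norm x \<le> r"
  using assms by (simp add: norm_adj_mult power2_le_iff_abs_le)

lemma commuting_ii:
  fixes a c :: "'a::cstar1"
  assumes "adj a = a" "adj c = c" "a * c = c * a"
  shows "adj (a + ii * c) = a - ii * c"
    "(a - ii * c) * (a + ii * c) = a * a + c * c"
    "(a + ii * c) * (a + ii * c) + (a - ii * c) * (a - ii * c) = 2 *\<^sub>R (a * a - c * c)"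
proof -
  show "adj (a + ii * c) = a - ii * c"
    using assms ii_commute[of c] by (simp add: adj_add adj_mult adj_ii)
  note 1 = ii_left_commute[of a] ii_left_commute[of c]
  show "(a - ii * c) * (a + ii * c) = a * a + c * c"
    "(a + ii * c) * (a + ii * c) + (a - ii * c) * (a - ii * c) = 2 *\<^sub>R (a * a - c * c)"
    using assms(3) by (simp_all add: algebra_simps 1 ii_cancel scaleR_2)
qed

text \<open>For positive \<open>r\<close>, \<open>a + ii * c\<close> is \<open>sqrt r\<close> times
  a unitary, with adjoint \<open>a - ii * c\<close>. Both have norm at most \<open>sqrt r\<close>,
  and their squares add up to \<open>2 *\<^sub>R (a * a - c * c)\<close>.\<close>

lemma norm_pm_sq_le:
  fixes a c :: "'a::cstar1"
  assumes "adj a = a" "adj c = c" "a * c = c * a" "a * a + c * c = of_real r" "r \<ge> 0"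
  shows "norm (a * a - c * c) \<le> r"
proof -
  note * = commuting_ii[OF assms(1-3)]
  have n: "norm (a + ii * c) \<le> sqrt r"
    by (rule norm_le_of_adj_mult) (simp_all only: *(1,2) assms(4) norm_of_real real_sqrt_pow2 assms(5)
      real_sqrt_ge_zero abs_of_nonneg order.refl)
  have n': "norm (a - ii * c) \<le> sqrt r" using n norm_adj[of "a + ii * c"] by (simp only: *(1))
  have "norm (2 *\<^sub>R (a * a - c * c)) \<le> sqrt r * sqrt r + sqrt r * sqrt r"
    unfolding *(3)[symmetric]
    by (intro order.trans[OF norm_triangle_ineq] add_mono order.trans[OF norm_mult_ineq] mult_mono n n')
      (simp_all add: assms(5))
  thus ?thesis using assms(5) by simp
qed

text \<open>For a contraction \<open>a\<close> let \<open>b\<close> be the root of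
  \<open>1 - a * a\<close>. The preceding estimate with \<open>r = 1\<close> bounds
  \<open>a * a - b * b\<close>, which is \<open>2 *\<^sub>R (a * a) - 1\<close>, so
  \<open>a * a\<close> lies within 1/2 of 1/2. Other elements are rescaled to contractions.\<close>

lemma pos_square:
  assumes "adj a = a" shows "pos (a * a)"
proof -
  have *: "pos (a * a)" if a: "adj a = a" "norm a \<le> 1" for a :: 'a
  proof -
    have "norm (a * a) \<le> 1" using a norm_mult_ineq[of a a] by (meson mult_le_one norm_ge_zero order.trans)
    moreover have sa: "adj (a * a) = a * a" using a by (simp add: adj_mult)
    ultimately have "pos (of_real 1 - a * a)" by (rule pos_diff_norm[rotated])
    then obtain b where b: "adj b = b" "b * b = of_real 1 - a * a"
      "\<And>z. z * (of_real 1 - a * a) = (of_real 1 - a * a) * z \<Longrightarrow> z * b = b * z"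
      by (rule pos_sqrt) blast
    have "a * b = b * a" by (rule b(3)) (simp add: algebra_simps)
    hence "norm (a * a - b * b) \<le> 1" using a b(1,2) by (intro norm_pm_sq_le) auto
    hence "norm (2 *\<^sub>R (a * a) - 1) \<le> 1" using b(2) by (simp add: scaleR_2 algebra_simps)
    moreover have "of_real (1/2) - a * a = (-1/2) *\<^sub>R (2 *\<^sub>R (a * a) - 1)"
      by (simp only: scaleR_diff_right) (simp add: of_real_def)
    hence "norm (of_real (1/2) - a * a) = 1/2 * norm (2 *\<^sub>R (a * a) - 1)" by simp
    ultimately show ?thesis using sa unfolding pos_def by (auto intro!: exI[of _ "1/2"])
  qed
  show ?thesis
  proof (cases "a = 0")
    case True thus ?thesis using pos_of_real[of 0] by simp
  next
    case False
    have "pos (((1/norm a) *\<^sub>R a) * ((1/norm a) *\<^sub>R a))" by (rule *) (use False assms in auto)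
    hence "pos ((norm a * norm a) *\<^sub>R (((1/norm a) *\<^sub>R a) * ((1/norm a) *\<^sub>R a)))"
      by (rule pos_scaleR) simp
    thus ?thesis using False by simp
  qed
qed

text \<open>The roots \<open>a\<close> of \<open>r + h\<close> and \<open>c\<close> of
  \<open>r - h\<close> commute, their squares have sum \<open>2 * r\<close> and difference
  \<open>2 *\<^sub>R h\<close>, and the estimate for such pairs applies. This turns order bounds
  into norm bounds.\<close>

lemma norm_le_of_pos:
  assumes "adj h = h" "pos (of_real r + h)" "pos (of_real r - h)" "r \<ge> 0" shows "norm h \<le> r"
proof -
  obtain a where a: "adj a = a" "a * a = of_real r + h"
      "\<And>z. z * (of_real r + h) = (of_real r + h) * z \<Longrightarrow> z * a = a * z"
    using assms(2) by (rule pos_sqrt) blast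
  obtain c where c: "adj c = c" "c * c = of_real r - h"
      "\<And>z. z * (of_real r - h) = (of_real r - h) * z \<Longrightarrow> z * c = c * z"
    using assms(3) by (rule pos_sqrt) blast
  have rc: "of_real r * z = z * of_real r" for z :: 'a
    using cc_commute[of "of_real r" z] by (simp add: cc_of_real)
  have "h * a = a * h" by (rule a(3)) (simp add: algebra_simps rc)
  hence "a * c = c * a" by (intro c(3)) (simp add: algebra_simps rc)
  hence "norm (a * a - c * c) \<le> 2 * r" using a(1,2) c(1,2) assms mult_2[of "of_real r :: 'a"]
    by (intro norm_pm_sq_le) auto
  moreover have "a * a - c * c = 2 *\<^sub>R h" by (simp only: a(2) c(2) scaleR_2) simp
  ultimately show ?thesis by simp
qed

lemma norm_mono:
  assumes "pos a" "pos b" shows "norm a \<le> norm (a + b)"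
proof (rule norm_le_of_pos)
  have "pos (of_real (norm (a + b)) - (a + b))"
    using assms by (intro pos_diff_norm) (auto simp: adj_add pos_adj)
  from pos_add[OF this assms(2)] show "pos (of_real (norm (a + b)) - a)" by (simp add: algebra_simps)
qed (use assms in \<open>auto intro!: pos_add pos_of_real simp: pos_adj\<close>)

text \<open>Kelley and Vaught's argument: with \<open>h = x\<^sup>* x\<close>, \<open>m = \<bar>h\<bar>\<close> and \<open>n = m - h\<close>, the element
  \<open>y = x n\<close> satisfies \<open>y\<^sup>* y \<le> 0\<close>, which forces \<open>y = 0\<close>.\<close>

lemma adj_mult_neg:
  fixes y :: "'a::cstar1"
  assumes g: "pos (- (adj y * y))" shows "y = 0"
proof -
  define g where "g = - (adj y * y)"
  define f where "f = y * adj y"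
  define \<mu> where "\<mu> = (norm y)\<^sup>2"
  \<comment> \<open>\<open>a\<close> and \<open>b\<close> are the real and imaginary parts of
    \<open>y\<close>. They express \<open>adj y * y + y * adj y\<close> through squares, which makes
    \<open>y * adj y\<close> a sum of positive elements.\<close>
  define a where "a = (1/2) *\<^sub>R (y + adj y)"
  define b where "b = (1/2) *\<^sub>R (ii * (adj y - y))"
  have sa: "adj a = a" "adj b = b"
    using ii_commute[of y] ii_commute[of "adj y"]
    by (simp_all add: a_def b_def adj_add adj_mult adj_diff adj_ii add.commute algebra_simps)
  note 1 = ii_left_commute[of y] ii_left_commute[of "adj y"]
  have "adj y * y + y * adj y = 2 *\<^sub>R (a * a) + 2 *\<^sub>R (b * b)"
    unfolding a_def b_def by (simp add: algebra_simps 1 ii_cancel) (simp flip: scaleR_add_left)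
  hence "f = (2 *\<^sub>R (a * a) + 2 *\<^sub>R (b * b)) + g" by (simp add: f_def g_def algebra_simps)
  moreover have "pos ((2 *\<^sub>R (a * a) + 2 *\<^sub>R (b * b)) + g)"
    using g by (intro pos_add pos_scaleR pos_square sa) (auto simp: g_def)
  ultimately have f: "pos f" by simp
  have nf: "norm f = \<mu>" using norm_adj_mult[of "adj y"] by (simp add: f_def \<mu>_def)
  have ng: "norm g = \<mu>" by (simp add: g_def \<mu>_def norm_adj_mult)
  have g: "pos g" using g by (simp add: g_def)
  \<comment> \<open>\<open>f\<close> lies between 0 and \<open>\<mu>\<close>, hence within
    \<open>\<mu>/2\<close> of \<open>\<mu>/2\<close>. Compression by \<open>y\<close> turns the
    difference into \<open>- ((\<mu>/2) *\<^sub>R g + g * g)\<close>, of norm at most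
    \<open>\<mu> * \<mu> / 2\<close>; by monotonicity this norm is at least that of
    \<open>g * g\<close>, which is \<open>\<mu> * \<mu>\<close>. So
    \<open>\<mu> = 0\<close>.\<close>
  have "norm (of_real (\<mu>/2) - f) \<le> \<mu>/2"
  proof (rule norm_le_of_pos)
    have "pos (of_real \<mu> - f)" using f nf by (intro pos_diff_norm) (auto simp: pos_adj)
    moreover have "of_real (\<mu>/2) + of_real (\<mu>/2) = (of_real \<mu> :: 'a)"
      by (simp only: of_real_add[symmetric]) simp
    ultimately show "pos (of_real (\<mu>/2) + (of_real (\<mu>/2) - f))" by (metis add_diff_eq)
  qed (use f in \<open>auto simp: adj_diff pos_adj \<mu>_def simp flip: of_real_divide\<close>)
  hence "norm (adj y * (of_real (\<mu>/2) - f) * y) \<le> norm y * (\<mu>/2) * norm y"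
    by (intro order.trans[OF norm_mult_ineq] mult_mono) (auto simp: \<mu>_def)
  moreover have "adj y * (of_real (\<mu>/2) - f) * y = - ((\<mu>/2) *\<^sub>R g + g * g)"
  proof -
    have "adj y * of_real (\<mu>/2) * y = (\<mu>/2) *\<^sub>R (adj y * y)"
      by (metis mult_scaleR_left mult_scaleR_right mult.right_neutral of_real_def)
    moreover have "adj y * f * y = g * g" by (simp add: f_def g_def mult.assoc)
    ultimately show ?thesis by (simp add: g_def algebra_simps)
  qed
  ultimately have "norm ((\<mu>/2) *\<^sub>R g + g * g) \<le> \<mu> * \<mu> / 2"
    by (simp add: \<mu>_def power2_eq_square mult_ac del: minus_add_distrib)
  moreover have "norm (g * g) \<le> norm (g * g + (\<mu>/2) *\<^sub>R g)"
    by (intro norm_mono pos_square pos_scaleR g pos_adj) (simp add: \<mu>_def)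
  moreover have "norm (g * g) = \<mu> * \<mu>" using norm_adj_mult[of g] g ng by (simp add: pos_adj power2_eq_square)
  ultimately have "\<mu> * \<mu> \<le> \<mu> * \<mu> / 2" by (simp add: add.commute)
  hence "\<mu> * \<mu> \<le> 0" by simp
  thus ?thesis by (simp add: \<mu>_def mult_le_0_iff flip: power_mult_distrib)
qed

lemma pos_adj_mult:
  fixes x :: "'a::cstar1"
  shows "pos (adj x * x)"
proof -
  define h where "h = adj x * x"
  have h: "adj h = h" by (simp add: h_def adj_mult)
  obtain m where m: "adj m = m" "m * m = h * h" "pos m"
    "\<And>z. z * (h * h) = (h * h) * z \<Longrightarrow> z * m = m * z"
    using pos_square[OF h] by (rule pos_sqrt) blast
  have hm: "h * m = m * h" by (rule m(4)) (simp add: mult.assoc)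
  define n where "n = m - h"
  have n: "adj n = n" by (simp add: n_def adj_diff m(1) h)
  obtain r where r: "adj r = r" "r * r = m" "\<And>z. z * m = m * z \<Longrightarrow> z * r = r * z"
    using m(3) by (rule pos_sqrt) blast
  have nm: "n * m = m * n" by (simp add: n_def algebra_simps hm)
  have nr: "n * r = r * n" by (rule r(3)) (rule nm)
  have hn: "h * n = - (m * n)" by (simp add: n_def algebra_simps m(2) hm)
  have "adj (x * n) * (x * n) = n * (h * n)" by (simp add: adj_mult n h_def mult.assoc)
  also have "\<dots> = - (m * (n * n))" using nm by (simp add: hn flip: mult.assoc)
  \<comment> \<open>\<open>n\<close> commutes with \<open>m\<close> and hence with its root
    \<open>r\<close>, so \<open>r * n\<close> is selfadjoint and the product is a square.\<close>
  also have "m * (n * n) = (r * n) * (r * n)" unfolding r(2)[symmetric] using nr by (metis mult.assoc)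
  finally have "- (adj (x * n) * (x * n)) = (r * n) * (r * n)" by simp
  moreover have "pos ((r * n) * (r * n))" by (rule pos_square) (simp add: adj_mult n r(1) nr)
  ultimately have "x * n = 0" by (intro adj_mult_neg) simp
  hence "h * n = 0" by (simp add: h_def mult.assoc)
  with hn have "m * n = 0" by simp
  with \<open>h * n = 0\<close> have "n * n = 0" by (simp add: n_def algebra_simps)
  hence "n = 0" using adj_mult_eq_0[of n] n by simp
  thus ?thesis using m(3) by (simp add: n_def h_def)
qed

lemma pos_sum: "(\<And>i. i \<in> I \<Longrightarrow> pos (f i)) \<Longrightarrow> pos (\<Sum>i\<in>I. f i)"
  using pos_of_real[of 0] by (induction I rule: infinite_finite_induct) (auto intro!: pos_add)

text \<open>Positivity of every \<open>adj (x j) * x j\<close> keeps one term below the whole sum.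
  This is what bounds a matrix entry by the norm of its column.\<close>

lemma norm_le_sum_adj_mult:
  fixes x :: "'i \<Rightarrow> 'a::cstar1"
  assumes "finite I" "i \<in> I"
  shows "(norm (x i))\<^sup>2 \<le> norm (\<Sum>j\<in>I. adj (x j) * x j)"
proof -
  have "norm (adj (x i) * x i) \<le> norm (adj (x i) * x i + (\<Sum>j\<in>I - {i}. adj (x j) * x j))"
    by (intro norm_mono pos_sum pos_adj_mult)
  thus ?thesis using assms by (simp add: sum.remove[of I i] norm_adj_mult)
qed

text \<open>Polar decomposition of \<open>t\<close>. Under \<open>p\<close>, the element
  \<open>adj t * t\<close> has the inverse \<open>s * adj s\<close>; adding \<open>1 - p\<close> to
  both gives mutually inverse elements \<open>h\<close> and \<open>k\<close> of the whole algebra,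
  and \<open>t\<close> times the inverse root of \<open>h\<close> is the partial isometry. The form
  \<open>t * w\<close> keeps it in every ideal that contains \<open>t\<close>, even if
  \<open>w\<close> lies outside.\<close>

lemma mvn_of_algebraic:
  fixes p q s t :: "'a::cstar1"
  assumes p: "adj p = p" "p * p = p" and q: "adj q = q"
    and st: "s * t = p" "t * s = q" and s: "p * s = s" "s * q = s" and t: "q * t = t" "t * p = t"
  obtains w where "adj (t * w) * (t * w) = p" "(t * w) * adj (t * w) = q"
proof -
  define h where "h = adj t * t + (1 - p)"
  define k where "k = s * adj s + (1 - p)"
  have as: "adj s * p = adj s" "q * adj s = adj s"
    using arg_cong[OF s(1), of adj] arg_cong[OF s(2), of adj] p q by (simp_all add: adj_mult)
  have at: "adj t * q = adj t" "p * adj t = adj t"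
    using arg_cong[OF t(1), of adj] arg_cong[OF t(2), of adj] p q by (simp_all add: adj_mult)
  have ast: "adj t * adj s = p" "adj s * adj t = q"
    using arg_cong[OF st(1), of adj] arg_cong[OF st(2), of adj] p q by (simp_all add: adj_mult)
  have "pos h"
    unfolding h_def using pos_square[of "1 - p"] p
    by (intro pos_add pos_adj_mult) (simp add: adj_diff algebra_simps)
  then obtain c where c: "adj c = c" "c * c = h" "\<And>z. z * h = h * z \<Longrightarrow> z * c = c * z"
    by (rule pos_sqrt) blast
  have tsst: "adj t * (t * (s * adj s)) = p" "s * (adj s * (adj t * t)) = p"
    "t * (s * (adj s * adj t)) = q"
    by (simp_all add: st ast as at s t flip: mult.assoc)
  have p0: "p * (s * z) = s * z" "p * (adj t * z) = adj t * z" "t * (p * z) = t * z"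
     "adj s * (p * z) = adj s * z" for z
    by (simp_all add: s at as t flip: mult.assoc)
  have hk: "h * k = 1"
    by (simp add: h_def k_def algebra_simps p s t as at p0 tsst)
  have kh: "k * h = 1"
    by (simp add: h_def k_def algebra_simps p s t as at p0 tsst)
  \<comment> \<open>The root of \<open>h\<close> times the inverse of \<open>h\<close> is the
    inverse square root of \<open>h\<close>.\<close>
  define d where "d = c * k"
  have ck: "c * k = k * c"
  proof -
    have "h * c = c * h" by (simp add: mult.assoc flip: c(2))
    hence "(k * h) * (c * k) = (k * c) * (h * k)" by (simp only: mult.assoc) (simp only: mult.assoc[symmetric])
    thus ?thesis using hk kh by simp
  qed
  have dd: "d * d = k"
  proof -
    have "d * d = k * (c * c) * k" unfolding d_def by (simp only: ck mult.assoc)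
    thus ?thesis by (simp add: c(2) kh)
  qed
  have ad: "adj d = d"
  proof -
    have "adj k = k" by (simp add: k_def adj_add adj_diff adj_mult p)
    thus ?thesis by (simp add: d_def adj_mult c(1) ck)
  qed
  have comm: "d * (adj t * t) = (adj t * t) * d"
  proof -
    have "(adj t * t) * h = h * (adj t * t)" by (simp add: h_def algebra_simps at t p0)
    hence 1: "(adj t * t) * c = c * (adj t * t)" by (rule c(3))
    have "(adj t * t) * k = k * (adj t * t)" by (simp add: k_def algebra_simps at t p0 tsst)
    hence "c * (k * (adj t * t)) = c * ((adj t * t) * k)" by simp
    with 1 show ?thesis unfolding d_def by (simp only: mult.assoc[symmetric])
  qed
  have "adj (t * d) * (t * d) = d * (adj t * t) * d" by (simp add: adj_mult ad mult.assoc)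
  also have "\<dots> = (adj t * t) * (d * d)" by (simp add: comm mult.assoc)
  also have "\<dots> = p" by (simp add: dd k_def algebra_simps tsst t)
  finally have 1: "adj (t * d) * (t * d) = p" .
  have "(t * d) * adj (t * d) = t * (d * d) * adj t" by (simp add: adj_mult ad mult.assoc)
  also have "\<dots> = q" by (simp add: dd k_def algebra_simps tsst t p0 at)
  finally show thesis by (rule that[OF 1])
qed

section \<open>The ambient algebra\<close>

context cstar_algebra
begin

lemmas carrier_simps [simp] = mult_closed scale_closed star_closed

lemma scale_0 [simp]: assumes "x \<in> carrier A" shows "cscale A 0 x = \<zero>"
proof -
  have "cscale A 0 x \<oplus> cscale A 0 x = cscale A 0 x \<oplus> \<zero>"
    using scale_add_left[of x 0 0] assms by simp
  thus ?thesis using assms by (metis add.l_cancel_one scale_closed zero_closed)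
qed

lemma scale_zero [simp]: "cscale A c \<zero> = \<zero>"
  using scale_scale[of \<zero> c 0] by simp

lemma scale_minus_1 [simp]: assumes "x \<in> carrier A" shows "cscale A (- 1) x = \<ominus> x"
proof -
  have "cscale A (- 1) x \<oplus> x = \<zero>"
    using scale_add_left[of x "-1" 1] assms by (simp add: scale_one)
  thus ?thesis using assms by (metis minus_equality scale_closed)
qed

lemma zero_mult [simp]: "x \<in> carrier A \<Longrightarrow> \<zero> \<otimes> x = \<zero>"
  using scale_mult_left[of \<zero> x 0] by simp

lemma mult_zero [simp]: "x \<in> carrier A \<Longrightarrow> x \<otimes> \<zero> = \<zero>"
  using scale_mult_right[of x \<zero> 0] by simp

lemma star_zero [simp]: "star A \<zero> = \<zero>"
  using star_scale[of \<zero> 0] by simp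

lemma norm_zero [simp]: "cnorm A \<zero> = 0"
  by (simp add: norm_eq_0)

lemma norm_minus [simp]: "x \<in> carrier A \<Longrightarrow> cnorm A (\<ominus> x) = cnorm A x"
  using norm_scale[of x "-1"] by simp

lemma norm_star [simp]: assumes "x \<in> carrier A" shows "cnorm A (star A x) = cnorm A x"
proof -
  have le: "cnorm A y \<le> cnorm A (star A y)" if "y \<in> carrier A" for y
  proof (cases "cnorm A y = 0")
    case False
    have "cnorm A y * cnorm A y \<le> cnorm A (star A y) * cnorm A y"
      using cstar_identity[of y] norm_mult[of "star A y" y] that by (simp add: power2_eq_square)
    thus ?thesis using False norm_nonneg[OF that] by simp
  qed (use that norm_nonneg in simp)
  from le[of x] le[of "star A x"] assms show ?thesis by (simp add: star_star)
qed

text \<open>The action of \<open>a + c 1\<close> by left multiplication, written without an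
  identity. The norms of unitizations are operator norms of these maps.\<close>

definition act :: "'a \<Rightarrow> complex \<Rightarrow> 'a \<Rightarrow> 'a" where
  "act a c x = a \<otimes> x \<oplus> cscale A c x"

lemma act_closed [simp]: "a \<in> carrier A \<Longrightarrow> x \<in> carrier A \<Longrightarrow> act a c x \<in> carrier A"
  by (simp add: act_def)

lemma act_add:
  assumes "a \<in> carrier A" "b \<in> carrier A" "x \<in> carrier A"
  shows "act (a \<oplus> b) (c + d) x = act a c x \<oplus> act b d x"
  using assms by (simp add: act_def l_distrib scale_add_left a_ac)

lemma act_scale:
  assumes "a \<in> carrier A" "x \<in> carrier A"
  shows "act (cscale A r a) (r * c) x = cscale A r (act a c x)"
  using assms by (simp add: act_def scale_mult_left scale_scale scale_add_right)

lemma act_scale_right: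
  assumes "a \<in> carrier A" "x \<in> carrier A"
  shows "act a c (cscale A r x) = cscale A r (act a c x)"
  using assms by (simp add: act_def scale_mult_right scale_scale scale_add_right mult.commute)

lemma act_mult:
  assumes "a \<in> carrier A" "b \<in> carrier A" "x \<in> carrier A"
  shows "act (a \<otimes> b \<oplus> cscale A d a \<oplus> cscale A c b) (c * d) x = act a c (act b d x)"
  using assms by (simp add: act_def l_distrib r_distrib scale_add_right scale_mult_left
      scale_mult_right scale_scale mult_assoc a_ac)

lemma act_star:
  assumes "a \<in> carrier A" "x \<in> carrier A" "y \<in> carrier A"
  shows "star A (act a c x) \<otimes> y = star A x \<otimes> act (star A a) (cnj c) y"
  using assms by (simp add: act_def star_add star_mult star_scale l_distrib r_distrib
      scale_mult_left scale_mult_right mult_assoc)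

lemma norm_act_le:
  assumes "a \<in> carrier A" "x \<in> carrier A"
  shows "cnorm A (act a c x) \<le> (cnorm A a + cmod c) * cnorm A x"
proof -
  have "cnorm A (act a c x) \<le> cnorm A (a \<otimes> x) + cnorm A (cscale A c x)"
    unfolding act_def using assms by (intro norm_triangle) auto
  also have "\<dots> \<le> cnorm A a * cnorm A x + cmod c * cnorm A x"
    using assms norm_mult by (simp add: norm_scale)
  finally show ?thesis by (simp add: algebra_simps)
qed

text \<open>By the C*-identity, left multiplication by \<open>a\<close> attains its norm at
  \<open>star A a\<close>; the left regular representation is isometric.\<close>

lemma norm_le_of_mult:
  assumes "a \<in> carrier A" "\<And>x. x \<in> carrier A \<Longrightarrow> cnorm A (a \<otimes> x) \<le> M * cnorm A x" "M \<ge> 0"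
  shows "cnorm A a \<le> M"
proof (cases "cnorm A a = 0")
  case False
  have "cnorm A a * cnorm A a = cnorm A (a \<otimes> star A a)"
    using cstar_identity[of "star A a"] assms(1) by (simp add: star_star power2_eq_square)
  also have "\<dots> \<le> M * cnorm A a" using assms(2)[of "star A a"] assms(1) by simp
  finally show ?thesis using False norm_nonneg[OF assms(1)] by simp
qed (use assms in simp)

lemma norm_le_of_act:
  assumes a: "a \<in> carrier A" and M: "\<And>x. x \<in> carrier A \<Longrightarrow> cnorm A (act a c x) \<le> M * cnorm A x"
    and "M \<ge> 0"
  shows "cnorm A a \<le> M + cmod c"
proof (rule norm_le_of_mult[OF a])
  fix x assume x: "x \<in> carrier A"
  have "a \<otimes> x = act a c x \<oplus> cscale A (- c) x"
    using a x scale_add_left[of x c "- c"] by (simp add: act_def a_assoc)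
  hence "cnorm A (a \<otimes> x) \<le> cnorm A (act a c x) + cmod c * cnorm A x"
    using norm_triangle[of "act a c x" "cscale A (- c) x"] a x by (simp add: norm_scale)
  thus "cnorm A (a \<otimes> x) \<le> (M + cmod c) * cnorm A x" using M[OF x] by (simp add: algebra_simps)
qed (use \<open>M \<ge> 0\<close> in simp)

lemma norm_minus_commute: "x \<in> carrier A \<Longrightarrow> y \<in> carrier A \<Longrightarrow> cnorm A (x \<ominus> y) = cnorm A (y \<ominus> x)"
  using norm_minus[of "x \<ominus> y"] by (simp add: minus_eq minus_add a_comm)

end

section \<open>The bounded product of all C*-algebras on a type\<close>

definition triv :: "('a, 'b) cstar_scheme \<Rightarrow> ('a, 'b) cstar_scheme" where
  "triv A = A\<lparr>carrier := {undefined}, monoid.mult := (\<lambda>_ _. undefined), one := undefined,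
     zero := undefined, add := (\<lambda>_ _. undefined), cscale := (\<lambda>_ _. undefined),
     star := (\<lambda>_. undefined), cnorm := (\<lambda>_. 0)\<rparr>"

lemma cstar_algebra_triv: "cstar_algebra (triv A)"
  by unfold_locales (auto simp: triv_def Units_def)

text \<open>Records that violate the axioms are replaced by a one-point algebra. Families can then
  be indexed by all records, and the ambient type is defined without reference to a particular
  algebra.\<close>

definition str :: "('a, 'b) cstar_scheme \<Rightarrow> ('a, 'b) cstar_scheme" where
  "str A = (if cstar_algebra A then A else triv A)"

lemma cstar_algebra_str [intro, simp]: "cstar_algebra (str A)"
  by (simp add: str_def cstar_algebra_triv)

abbreviation scar :: "('a, 'b) cstar_scheme \<Rightarrow> 'a set" where "scar A \<equiv> carrier (str A)"
abbreviation snorm :: "('a, 'b) cstar_scheme \<Rightarrow> 'a \<Rightarrow> real" where "snorm A \<equiv> cnorm (str A)"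

lemma zero_str: "\<zero>\<^bsub>str A\<^esub> \<in> scar A" "snorm A \<zero>\<^bsub>str A\<^esub> \<le> 0"
proof -
  interpret cstar_algebra "str A" by simp
  show "\<zero>\<^bsub>str A\<^esub> \<in> scar A" "snorm A \<zero>\<^bsub>str A\<^esub> \<le> 0" by auto
qed

definition bounded_family :: "(('a, 'b) cstar_scheme \<Rightarrow> 'a) \<Rightarrow> bool" where
  "bounded_family f \<longleftrightarrow> (\<forall>A. f A \<in> scar A) \<and> (\<exists>K. \<forall>A. snorm A (f A) \<le> K)"

lemma bounded_family_zero: "bounded_family (\<lambda>A. \<zero>\<^bsub>str A\<^esub>)"
  using zero_str by (auto simp: bounded_family_def)

lemma bounded_family_star:
  assumes "bounded_family f" shows "bounded_family (\<lambda>A. star (str A) (f A))"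
proof -
  obtain K where K: "\<And>A. f A \<in> scar A" "\<And>A. snorm A (f A) \<le> K"
    using assms by (auto simp: bounded_family_def)
  have "star (str A) (f A) \<in> scar A \<and> snorm A (star (str A) (f A)) \<le> K" for A
  proof -
    interpret cstar_algebra "str A" by simp
    show ?thesis using K[of A] by simp
  qed
  thus ?thesis unfolding bounded_family_def by blast
qed

lemma bounded_family_scale:
  assumes "bounded_family f" shows "bounded_family (\<lambda>A. cscale (str A) r (f A))"
proof -
  obtain K where K: "\<And>A. f A \<in> scar A" "\<And>A. snorm A (f A) \<le> K"
    using assms by (auto simp: bounded_family_def)
  have "cscale (str A) r (f A) \<in> scar A \<and> snorm A (cscale (str A) r (f A)) \<le> cmod r * K" for A
  proof -
    interpret cstar_algebra "str A" by simp
    show ?thesis using K[of A] by (auto simp: norm_scale intro: mult_left_mono)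
  qed
  thus ?thesis unfolding bounded_family_def by blast
qed

lemma bounded_family_add_mult:
  assumes "bounded_family f" "bounded_family g"
  shows "bounded_family (\<lambda>A. f A \<oplus>\<^bsub>str A\<^esub> g A)" "bounded_family (\<lambda>A. f A \<otimes>\<^bsub>str A\<^esub> g A)"
proof -
  obtain K L where K: "\<And>A. f A \<in> scar A" "\<And>A. snorm A (f A) \<le> K"
    and L: "\<And>A. g A \<in> scar A" "\<And>A. snorm A (g A) \<le> L"
    using assms by (auto simp: bounded_family_def)
  have "(f A \<oplus>\<^bsub>str A\<^esub> g A \<in> scar A \<and> snorm A (f A \<oplus>\<^bsub>str A\<^esub> g A) \<le> K + L) \<and>
      (f A \<otimes>\<^bsub>str A\<^esub> g A \<in> scar A \<and> snorm A (f A \<otimes>\<^bsub>str A\<^esub> g A) \<le> K * L)" for A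
  proof -
    interpret cstar_algebra "str A" by simp
    have "0 \<le> snorm A (f A)" "0 \<le> snorm A (g A)" using K(1) L(1) by (simp_all add: norm_nonneg)
    hence "snorm A (f A) * snorm A (g A) \<le> K * L"
      using K(2)[of A] L(2)[of A] by (intro mult_mono) auto
    thus ?thesis using norm_triangle[OF K(1) L(1)] norm_mult[OF K(1) L(1)] K[of A] L[of A] by auto
  qed
  thus "bounded_family (\<lambda>A. f A \<oplus>\<^bsub>str A\<^esub> g A)" "bounded_family (\<lambda>A. f A \<otimes>\<^bsub>str A\<^esub> g A)"
    unfolding bounded_family_def by blast+
qed

text \<open>The ambient algebra: the unitization of the bounded product of all C*-algebras on the type
  \<open>'a\<close>. As a type of class \<open>cstar1\<close> it contains every C*-algebra on \<open>'a\<close> as an ideal.\<close>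

typedef ('a, 'b) amb = "{z :: (('a, 'b) cstar_scheme \<Rightarrow> 'a) \<times> complex. bounded_family (fst z)}"
  using bounded_family_zero by auto

setup_lifting type_definition_amb

lift_definition fam :: "('a, 'b) amb \<Rightarrow> ('a, 'b) cstar_scheme \<Rightarrow> 'a" is fst .
lift_definition spt :: "('a, 'b) amb \<Rightarrow> complex" is snd .

lemma fam_closed [simp]: "fam z A \<in> scar A"
  and fam_bounded: "\<exists>K. \<forall>B. snorm B (fam z B) \<le> K"
  using Rep_amb[of z] by (auto simp: fam.rep_eq bounded_family_def)

lemma amb_eqI: "(\<And>A. fam z A = fam w A) \<Longrightarrow> spt z = spt w \<Longrightarrow> z = w"
  by transfer (auto simp: prod_eq_iff)

lift_definition cscl :: "complex \<Rightarrow> ('a, 'b) amb \<Rightarrow> ('a, 'b) amb"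
  is "\<lambda>r z. (\<lambda>A. cscale (str A) r (fst z A), r * snd z)"
  by (simp add: bounded_family_scale)

lemma fam_cscl [simp]: "fam (cscl r z) A = cscale (str A) r (fam z A)" by transfer auto
lemma spt_cscl [simp]: "spt (cscl r z) = r * spt z" by transfer auto

lemma cscl_cscl: "cscl r (cscl s z) = cscl (r * s) z"
proof (rule amb_eqI)
  fix A :: "('a, 'b) cstar_scheme"
  interpret cstar_algebra "str A" by simp
  show "fam (cscl r (cscl s z)) A = fam (cscl (r * s) z) A" by (simp add: scale_scale)
qed simp

lemma cscl_1 [simp]: "cscl 1 z = z"
proof (rule amb_eqI)
  fix A :: "('a, 'b) cstar_scheme"
  interpret cstar_algebra "str A" by simp
  show "fam (cscl 1 z) A = fam z A" by (simp add: scale_one)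
qed simp

instantiation amb :: (type, type) ring_1
begin

lift_definition zero_amb :: "('a, 'b) amb" is "(\<lambda>A. \<zero>\<^bsub>str A\<^esub>, 0)"
  by (simp add: bounded_family_zero)

lift_definition one_amb :: "('a, 'b) amb" is "(\<lambda>A. \<zero>\<^bsub>str A\<^esub>, 1)"
  by (simp add: bounded_family_zero)

lift_definition plus_amb :: "('a, 'b) amb \<Rightarrow> ('a, 'b) amb \<Rightarrow> ('a, 'b) amb"
  is "\<lambda>z w. (\<lambda>A. fst z A \<oplus>\<^bsub>str A\<^esub> fst w A, snd z + snd w)"
  by (simp add: bounded_family_add_mult)

lift_definition times_amb :: "('a, 'b) amb \<Rightarrow> ('a, 'b) amb \<Rightarrow> ('a, 'b) amb"
  is "\<lambda>z w. (\<lambda>A. fst z A \<otimes>\<^bsub>str A\<^esub> fst w A \<oplus>\<^bsub>str A\<^esub> cscale (str A) (snd w) (fst z A)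
         \<oplus>\<^bsub>str A\<^esub> cscale (str A) (snd z) (fst w A), snd z * snd w)"
  by (simp add: bounded_family_add_mult bounded_family_scale)

definition uminus_amb :: "('a, 'b) amb \<Rightarrow> ('a, 'b) amb" where "uminus_amb z = cscl (- 1) z"
definition minus_amb :: "('a, 'b) amb \<Rightarrow> ('a, 'b) amb \<Rightarrow> ('a, 'b) amb" where "minus_amb z w = z + - w"

lemma fam_simps [simp]:
  "fam 0 A = \<zero>\<^bsub>str A\<^esub>" "fam 1 A = \<zero>\<^bsub>str A\<^esub>" "fam (z + w) A = fam z A \<oplus>\<^bsub>str A\<^esub> fam w A"
  "fam (z * w) A = fam z A \<otimes>\<^bsub>str A\<^esub> fam w A \<oplus>\<^bsub>str A\<^esub> cscale (str A) (spt w) (fam z A)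
     \<oplus>\<^bsub>str A\<^esub> cscale (str A) (spt z) (fam w A)"
  "spt 0 = 0" "spt 1 = 1" "spt (z + w) = spt z + spt w" "spt (z * w) = spt z * spt w"
  by (transfer; auto)+

lemma fam_minus [simp]: "fam (- z) A = \<ominus>\<^bsub>str A\<^esub> fam z A" "spt (- z) = - spt z"
    "fam (z - w) A = fam z A \<ominus>\<^bsub>str A\<^esub> fam w A" "spt (z - w) = spt z - spt w"
proof -
  interpret cstar_algebra "str A" by simp
  show "fam (- z) A = \<ominus>\<^bsub>str A\<^esub> fam z A" "spt (- z) = - spt z"
    "fam (z - w) A = fam z A \<ominus>\<^bsub>str A\<^esub> fam w A" "spt (z - w) = spt z - spt w"
    by (simp_all add: uminus_amb_def minus_amb_def minus_eq)
qed

instance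
proof
  fix a b c :: "('a, 'b) amb"
  { fix A :: "('a, 'b) cstar_scheme"
    interpret cstar_algebra "str A" by simp
    have "fam (a * b * c) A = fam (a * (b * c)) A" "fam (1 * a) A = fam a A" "fam (a * 1) A = fam a A"
      "fam (a + b + c) A = fam (a + (b + c)) A" "fam (a + b) A = fam (b + a) A" "fam (0 + a) A = fam a A"
      "fam (- a + a) A = fam 0 A"
      "fam ((a + b) * c) A = fam (a * c + b * c) A" "fam (a * (b + c)) A = fam (a * b + a * c) A"
      by (simp_all add: l_distrib r_distrib scale_add_right scale_add_left scale_mult_left
        scale_mult_right scale_scale mult_assoc a_ac scale_one l_neg r_neg mult_ac) }
  note * = this
  show "a * b * c = a * (b * c)" "1 * a = a" "a * 1 = a" "a + b + c = a + (b + c)"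
    "a + b = b + a" "0 + a = a" "- a + a = 0" "(a + b) * c = a * c + b * c"
    "a * (b + c) = a * b + a * c"
    by (intro amb_eqI *; simp add: algebra_simps)+
  show "a - b = a + - b" by (simp add: minus_amb_def)
  show "(0::('a, 'b) amb) \<noteq> 1" by (metis fam_simps(5,6) zero_neq_one)
qed

end

section \<open>Norm, completeness and involution of the ambient algebra\<close>

definition amb_values :: "('a, 'b) amb \<Rightarrow> real set" where
  "amb_values z = {snorm A (cstar_algebra.act (str A) (fam z A) (spt z) x) | A x.
     x \<in> scar A \<and> snorm A x \<le> 1}"

instantiation amb :: (type, type) real_normed_algebra_1
begin

definition scaleR_amb :: "real \<Rightarrow> ('a, 'b) amb \<Rightarrow> ('a, 'b) amb" where "scaleR_amb r z = cscl (of_real r) z"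
text \<open>The scalar part is put into the supremum explicitly. If all fibres are unital, a nonzero
  pair whose family cancels the scalar in every fibre acts as 0 everywhere; the additional term
  keeps the norm definite and gives \<open>norm 1 = 1\<close> whatever the fibres are.\<close>

definition norm_amb :: "('a, 'b) amb \<Rightarrow> real" where "norm_amb z = Sup (insert (cmod (spt z)) (amb_values z))"
definition dist_amb :: "('a, 'b) amb \<Rightarrow> ('a, 'b) amb \<Rightarrow> real" where "dist_amb z w = norm (z - w)"
definition sgn_amb :: "('a, 'b) amb \<Rightarrow> ('a, 'b) amb" where "sgn_amb z = scaleR (inverse (norm z)) z"
definition uniformity_amb :: "(('a, 'b) amb \<times> ('a, 'b) amb) filter" where
  "uniformity_amb = (INF e\<in>{0 <..}. principal {(x, y). dist x y < e})"
definition open_amb :: "('a, 'b) amb set \<Rightarrow> bool" where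
  "open_amb U \<longleftrightarrow> (\<forall>x\<in>U. eventually (\<lambda>(x', y). x' = x \<longrightarrow> y \<in> U) uniformity)"

lemma norm_amb_le:
  assumes "cmod (spt z) \<le> M"
    and "\<And>A x. x \<in> scar A \<Longrightarrow> snorm A x \<le> 1 \<Longrightarrow>
      snorm A (cstar_algebra.act (str A) (fam z A) (spt z) x) \<le> M"
  shows "norm z \<le> M"
  unfolding norm_amb_def using assms by (intro cSup_least) (auto simp: amb_values_def)

lemma bdd_amb: "bdd_above (insert (cmod (spt z)) (amb_values z))"
proof -
  obtain K where K: "\<And>A. snorm A (fam z A) \<le> K" using fam_bounded by blast
  have "r \<le> K + cmod (spt z)" if "r \<in> amb_values z" for r
  proof -
    from that obtain A x where x: "x \<in> scar A" "snorm A x \<le> 1"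
        "r = snorm A (cstar_algebra.act (str A) (fam z A) (spt z) x)"
      by (auto simp: amb_values_def)
    interpret cstar_algebra "str A" by simp
    have "r \<le> (snorm A (fam z A) + cmod (spt z)) * snorm A x"
      using x by (auto intro: norm_act_le)
    also have "\<dots> \<le> (snorm A (fam z A) + cmod (spt z)) * 1"
      using x by (intro mult_left_mono) (auto simp: norm_nonneg)
    also have "\<dots> \<le> K + cmod (spt z)" using K by simp
    finally show ?thesis .
  qed
  hence "r \<le> \<bar>K\<bar> + cmod (spt z)" if "r \<in> insert (cmod (spt z)) (amb_values z)" for r
    using that by fastforce
  thus ?thesis by (rule bdd_aboveI)
qed

lemma spt_le_norm: "cmod (spt z) \<le> norm z"
  unfolding norm_amb_def by (rule cSup_upper[OF _ bdd_amb]) auto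

lemma act_le_norm:
  assumes "x \<in> scar A"
  shows "snorm A (cstar_algebra.act (str A) (fam z A) (spt z) x) \<le> norm z * snorm A x"
proof -
  interpret cstar_algebra "str A" by simp
  show ?thesis
  proof (cases "snorm A x = 0")
    case True
    thus ?thesis using norm_act_le[of "fam z A" x "spt z"] assms norm_nonneg by simp
  next
    case False
    hence n: "snorm A x > 0" using norm_nonneg[OF assms] by simp
    define y where "y = cscale (str A) (of_real (inverse (snorm A x))) x"
    have y: "y \<in> scar A" "snorm A y = 1"
      using assms n by (auto simp: y_def norm_scale norm_inverse)
    have "snorm A (act (fam z A) (spt z) y) \<le> norm z"
      unfolding norm_amb_def by (rule cSup_upper[OF _ bdd_amb]) (use y in \<open>force simp: amb_values_def\<close>)
    also have "snorm A (act (fam z A) (spt z) y) =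
        inverse (snorm A x) * snorm A (act (fam z A) (spt z) x)"
      using assms n by (simp add: y_def act_scale_right norm_scale norm_inverse)
    finally show ?thesis using n by (simp add: field_simps)
  qed
qed

lemma norm_amb_nonneg: "0 \<le> norm (z :: ('a, 'b) amb)"
  using spt_le_norm[of z] norm_ge_zero[of "spt z"] by linarith

text \<open>In a fibre, the family part is the action of \<open>z\<close> minus its scalar, and each
  of the two is bounded by \<open>norm z\<close>; hence the factor 2. Norm Cauchy sequences are
  therefore Cauchy in all fibres, uniformly.\<close>

lemma fam_le_norm: "snorm A (fam z A) \<le> 2 * norm z"
proof -
  interpret cstar_algebra "str A" by simp
  have "snorm A (fam z A) \<le> norm z + cmod (spt z)"
    by (rule norm_le_of_act[where c = "spt z"]) (auto intro: act_le_norm norm_amb_nonneg)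
  thus ?thesis using spt_le_norm[of z] by simp
qed

instance
proof
  fix a b :: "('a, 'b) amb" and r s :: real and U :: "('a, 'b) amb set"
  { fix A :: "('a, 'b) cstar_scheme"
    interpret cstar_algebra "str A" by simp
    have "fam (r *\<^sub>R (a + b)) A = fam (r *\<^sub>R a + r *\<^sub>R b) A"
      "fam ((r + s) *\<^sub>R a) A = fam (r *\<^sub>R a + s *\<^sub>R a) A"
      "fam (r *\<^sub>R s *\<^sub>R a) A = fam ((r * s) *\<^sub>R a) A" "fam (1 *\<^sub>R a) A = fam a A"
      "fam (r *\<^sub>R a * b) A = fam (r *\<^sub>R (a * b)) A" "fam (a * r *\<^sub>R b) A = fam (r *\<^sub>R (a * b)) A"
      by (simp_all add: scaleR_amb_def scale_add_right scale_add_left scale_mult_left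
        scale_mult_right scale_scale scale_one mult_ac) }
  note * = this
  show "r *\<^sub>R (a + b) = r *\<^sub>R a + r *\<^sub>R b" "(r + s) *\<^sub>R a = r *\<^sub>R a + s *\<^sub>R a"
    "r *\<^sub>R s *\<^sub>R a = (r * s) *\<^sub>R a" "1 *\<^sub>R a = a" "r *\<^sub>R a * b = r *\<^sub>R (a * b)"
    "a * r *\<^sub>R b = r *\<^sub>R (a * b)"
    by (intro amb_eqI *; simp add: algebra_simps scaleR_amb_def)+
  show "dist a b = norm (a - b)" by (simp add: dist_amb_def)
  show "sgn a = scaleR (inverse (norm a)) a" by (simp add: sgn_amb_def)
  show "(uniformity :: (('a, 'b) amb \<times> ('a, 'b) amb) filter) = (INF e\<in>{0 <..}. principal {(x, y). dist x y < e})"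
    by (simp add: uniformity_amb_def)
  show "open U \<longleftrightarrow> (\<forall>x\<in>U. eventually (\<lambda>(x', y). x' = x \<longrightarrow> y \<in> U) uniformity)"
    by (simp add: open_amb_def)
  show "norm a = 0 \<longleftrightarrow> a = 0"
  proof
    assume n: "norm a = 0"
    show "a = 0"
    proof (rule amb_eqI)
      fix A :: "('a, 'b) cstar_scheme"
      interpret cstar_algebra "str A" by simp
      have "snorm A (fam a A) \<le> 0" using fam_le_norm[of A a] n by simp
      thus "fam a A = fam 0 A" using norm_nonneg[of "fam a A"] norm_eq_0[of "fam a A"] by simp
    qed (use spt_le_norm[of a] n in simp)
  next
    assume a: "a = 0"
    have "norm a \<le> 0"
    proof (rule norm_amb_le)
      fix A :: "('a, 'b) cstar_scheme" and x assume x: "x \<in> scar A"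
      interpret cstar_algebra "str A" by simp
      show "snorm A (act (fam a A) (spt a) x) \<le> 0" using x by (simp add: a act_def)
    qed (simp add: a)
    thus "norm a = 0" using norm_amb_nonneg[of a] by simp
  qed
  show "norm (a + b) \<le> norm a + norm b"
  proof (rule norm_amb_le)
    fix A :: "('a, 'b) cstar_scheme" and x assume x: "x \<in> scar A" "snorm A x \<le> 1"
    interpret cstar_algebra "str A" by simp
    have "snorm A (act (fam (a + b) A) (spt (a + b)) x) \<le>
        snorm A (act (fam a A) (spt a) x) + snorm A (act (fam b A) (spt b) x)"
      using x by (simp add: act_add norm_triangle)
    also have "\<dots> \<le> norm a * snorm A x + norm b * snorm A x"
      by (intro add_mono act_le_norm x)
    also have "\<dots> \<le> norm a * 1 + norm b * 1"
      by (intro add_mono mult_left_mono x norm_amb_nonneg)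
    finally show "snorm A (act (fam (a + b) A) (spt (a + b)) x) \<le> norm a + norm b" by simp
  qed (use norm_triangle_ineq[of "spt a" "spt b"] spt_le_norm[of a] spt_le_norm[of b] in simp)
  show "norm (a * b) \<le> norm a * norm b"
  proof (rule norm_amb_le)
    fix A :: "('a, 'b) cstar_scheme" and x assume x: "x \<in> scar A" "snorm A x \<le> 1"
    interpret cstar_algebra "str A" by simp
    have "act (fam (a * b) A) (spt (a * b)) x = act (fam a A) (spt a) (act (fam b A) (spt b) x)"
      using x by (simp add: act_mult)
    hence "snorm A (act (fam (a * b) A) (spt (a * b)) x) \<le>
        norm a * snorm A (act (fam b A) (spt b) x)"
      using x by (simp add: act_le_norm)
    also have "\<dots> \<le> norm a * (norm b * snorm A x)"
      by (intro mult_left_mono act_le_norm x norm_amb_nonneg)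
    also have "\<dots> \<le> norm a * (norm b * 1)"
      by (intro mult_left_mono x norm_amb_nonneg)
    finally show "snorm A (act (fam (a * b) A) (spt (a * b)) x) \<le> norm a * norm b" by simp
  qed (use spt_le_norm[of a] spt_le_norm[of b] in \<open>simp add: Real_Vector_Spaces.norm_mult mult_mono norm_amb_nonneg\<close>)
  have le: "norm (r *\<^sub>R a) \<le> \<bar>r\<bar> * norm a" for r and a :: "('a, 'b) amb"
  proof (rule norm_amb_le)
    fix A :: "('a, 'b) cstar_scheme" and x assume x: "x \<in> scar A" "snorm A x \<le> 1"
    interpret cstar_algebra "str A" by simp
    have "snorm A (act (fam (r *\<^sub>R a) A) (spt (r *\<^sub>R a)) x) = \<bar>r\<bar> * snorm A (act (fam a A) (spt a) x)"
      using x by (simp add: scaleR_amb_def act_scale norm_scale)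
    also have "\<dots> \<le> \<bar>r\<bar> * (norm a * snorm A x)"
      by (intro mult_left_mono act_le_norm x) auto
    also have "\<dots> \<le> \<bar>r\<bar> * (norm a * 1)"
      by (intro mult_left_mono x norm_amb_nonneg) auto
    finally show "snorm A (act (fam (r *\<^sub>R a) A) (spt (r *\<^sub>R a)) x) \<le> \<bar>r\<bar> * norm a" by simp
  qed (use spt_le_norm[of a] in \<open>simp add: scaleR_amb_def Real_Vector_Spaces.norm_mult mult_left_mono\<close>)
  show "norm (r *\<^sub>R a) = \<bar>r\<bar> * norm a"
  proof (cases "r = 0")
    case True thus ?thesis using le[of 0 a] norm_amb_nonneg[of "0 *\<^sub>R a"] by simp
  next
    case False
    have "inverse r *\<^sub>R (r *\<^sub>R a) = a"
      using False by (simp add: scaleR_amb_def cscl_cscl flip: of_real_mult)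
    hence "norm a \<le> \<bar>inverse r\<bar> * norm (r *\<^sub>R a)" using le[of "inverse r" "r *\<^sub>R a"] by simp
    with le[of r a] show ?thesis using False by (simp add: field_simps abs_inverse)
  qed
  show "norm (1 :: ('a, 'b) amb) = 1"
  proof (rule antisym)
    show "norm (1 :: ('a, 'b) amb) \<le> 1"
    proof (rule norm_amb_le)
      fix A :: "('a, 'b) cstar_scheme" and x assume x: "x \<in> scar A" "snorm A x \<le> 1"
      interpret cstar_algebra "str A" by simp
      show "snorm A (act (fam 1 A) (spt (1 :: ('a, 'b) amb)) x) \<le> 1" using x by (simp add: act_def scale_one)
    qed simp
  qed (use spt_le_norm[of 1] in simp)
qed

end

lemma norm_le_fam:
  fixes z :: "('a, 'b) amb"
  assumes "\<And>A. snorm A (fam z A) \<le> M" shows "norm z \<le> M + cmod (spt z)"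
proof (rule norm_amb_le)
  fix A :: "('a, 'b) cstar_scheme" and x assume x: "x \<in> scar A" "snorm A x \<le> 1"
  interpret cstar_algebra "str A" by simp
  have "snorm A (act (fam z A) (spt z) x) \<le> (snorm A (fam z A) + cmod (spt z)) * snorm A x"
    using x by (intro norm_act_le) auto
  also have "\<dots> \<le> (snorm A (fam z A) + cmod (spt z)) * 1"
    using x by (intro mult_left_mono) (auto simp: norm_nonneg)
  finally show "snorm A (act (fam z A) (spt z) x) \<le> M + cmod (spt z)" using assms[of A] by simp
next
  define A0 :: "('a, 'b) cstar_scheme" where "A0 = undefined"
  interpret cstar_algebra "str A0" by simp
  have "0 \<le> M" using assms[of A0] norm_nonneg[of "fam z A0"] by simp
  thus "cmod (spt z) \<le> M + cmod (spt z)" by simp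
qed

instance amb :: (type, type) banach
proof
  fix X :: "nat \<Rightarrow> ('a, 'b) amb" assume X: "Cauchy X"
  have XC: "\<exists>N. \<forall>m\<ge>N. \<forall>n\<ge>N. norm (X m - X n) < e" if "e > 0" for e
    using X that by (auto simp: Cauchy_def dist_norm)
  have "Cauchy (\<lambda>n. spt (X n))"
    unfolding Cauchy_def dist_norm using XC spt_le_norm by (metis fam_minus(4) order.strict_trans1)
  then obtain c where c: "(\<lambda>n. spt (X n)) \<longlonglongrightarrow> c" using Cauchy_convergent_iff convergent_def by blast
  have "\<exists>x\<in>scar A. (\<lambda>n. snorm A (fam (X n) A \<ominus>\<^bsub>str A\<^esub> x)) \<longlonglongrightarrow> 0" for A
  proof -
    interpret cstar_algebra "str A" by simp
    show ?thesis
    proof (rule complete)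
      fix e :: real assume "e > 0"
      then obtain N where "\<forall>m\<ge>N. \<forall>n\<ge>N. norm (X m - X n) < e / 2" using XC[of "e/2"] by auto
      thus "\<exists>N. \<forall>m\<ge>N. \<forall>n\<ge>N. snorm A (fam (X m) A \<ominus>\<^bsub>str A\<^esub> fam (X n) A) < e"
        using fam_le_norm[of A "X _ - X _"] by (intro exI[of _ N]) (simp, smt (verit) field_sum_of_halves)
    qed simp
  qed
  then obtain f where f: "\<And>A. f A \<in> scar A"
    "\<And>A. (\<lambda>n. snorm A (fam (X n) A \<ominus>\<^bsub>str A\<^esub> f A)) \<longlonglongrightarrow> 0" by metis
  \<comment> \<open>The Cauchy estimate passes to the limit with constants independent of the fibre.
    This uniformity makes \<open>f\<close> a bounded family and gives convergence in norm.\<close>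
  have close: "snorm A (fam (X n) A \<ominus>\<^bsub>str A\<^esub> f A) \<le> 2 * e"
    if "\<And>m. m \<ge> n \<Longrightarrow> norm (X m - X n) < e" for A n e
  proof -
    interpret cstar_algebra "str A" by simp
    have "(\<lambda>m. 2 * e + snorm A (fam (X m) A \<ominus>\<^bsub>str A\<^esub> f A)) \<longlonglongrightarrow> 2 * e + 0"
      by (intro tendsto_intros f)
    moreover have "snorm A (fam (X n) A \<ominus>\<^bsub>str A\<^esub> f A) \<le> 2 * e + snorm A (fam (X m) A \<ominus>\<^bsub>str A\<^esub> f A)"
      if m: "m \<ge> n" for m
    proof -
      have "fam (X n) A \<ominus>\<^bsub>str A\<^esub> f A = (fam (X n) A \<ominus>\<^bsub>str A\<^esub> fam (X m) A) \<oplus>\<^bsub>str A\<^esub> (fam (X m) A \<ominus>\<^bsub>str A\<^esub> f A)"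
        using f by (simp add: minus_eq a_assoc l_neg r_neg1)
      hence "snorm A (fam (X n) A \<ominus>\<^bsub>str A\<^esub> f A) \<le>
          snorm A (fam (X n) A \<ominus>\<^bsub>str A\<^esub> fam (X m) A) + snorm A (fam (X m) A \<ominus>\<^bsub>str A\<^esub> f A)"
        using f norm_triangle by simp
      moreover have "snorm A (fam (X n) A \<ominus>\<^bsub>str A\<^esub> fam (X m) A) \<le> 2 * norm (X m - X n)"
        using fam_le_norm[of A "X m - X n"] norm_minus_commute[of "fam (X m) A" "fam (X n) A"] by simp
      ultimately show ?thesis using \<open>\<And>m. m \<ge> n \<Longrightarrow> norm (X m - X n) < e\<close>[OF m] by linarith
    qed
    ultimately show ?thesis by (intro LIMSEQ_le_const[where X = "\<lambda>m. 2 * e + snorm A (fam (X m) A \<ominus>\<^bsub>str A\<^esub> f A)"]) auto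
  qed
  obtain N where N: "\<And>m. m \<ge> N \<Longrightarrow> norm (X m - X N) < 1" using XC[of 1] by auto
  have bd: "snorm A (f A) \<le> 2 * norm (X N) + 2" for A
  proof -
    interpret cstar_algebra "str A" by simp
    have "f A = fam (X N) A \<oplus>\<^bsub>str A\<^esub> \<ominus>\<^bsub>str A\<^esub> (fam (X N) A \<ominus>\<^bsub>str A\<^esub> f A)"
      using f by (simp add: minus_eq minus_add a_assoc[symmetric] r_neg)
    hence "snorm A (f A) \<le> snorm A (fam (X N) A) + snorm A (fam (X N) A \<ominus>\<^bsub>str A\<^esub> f A)"
      using norm_triangle[of "fam (X N) A" "\<ominus>\<^bsub>str A\<^esub> (fam (X N) A \<ominus>\<^bsub>str A\<^esub> f A)"] f by simp
    thus ?thesis using fam_le_norm[of A "X N"] close[OF N, of A] by simp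
  qed
  define L where "L = Abs_amb (f, c)"
  have L: "fam L A = f A" "spt L = c" for A
  proof -
    have "(f, c) \<in> {z. bounded_family (fst z)}"
      using f(1) bd by (auto simp: bounded_family_def)
    thus "fam L A = f A" "spt L = c" by (simp_all add: fam.rep_eq spt.rep_eq L_def Abs_amb_inverse)
  qed
  have "X \<longlonglongrightarrow> L"
  proof (rule LIMSEQ_I)
    fix e :: real assume e: "e > 0"
    obtain N where N: "\<And>m n. m \<ge> N \<Longrightarrow> n \<ge> N \<Longrightarrow> norm (X m - X n) < e / 4" using XC[of "e/4"] e by auto
    obtain N' where N': "\<And>n. n \<ge> N' \<Longrightarrow> cmod (spt (X n) - c) < e / 4"
      using LIMSEQ_D[OF c, of "e/4"] e by auto
    have "norm (X n - L) < e" if "n \<ge> max N N'" for n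
    proof -
      have "norm (X n - L) \<le> 2 * (e / 4) + cmod (spt (X n - L))"
      proof (rule norm_le_fam)
        fix A show "snorm A (fam (X n - L) A) \<le> 2 * (e / 4)"
          using close[of n "e / 4" A] N[of _ n] that by (simp add: L)
      qed
      thus ?thesis using N'[of n] that e by (simp add: L)
    qed
    thus "\<exists>n0. \<forall>n\<ge>n0. norm (X n - L) < e" by blast
  qed
  thus "convergent X" by (auto simp: convergent_def)
qed

instantiation amb :: (type, type) cstar1
begin

lift_definition adj_amb :: "('a, 'b) amb \<Rightarrow> ('a, 'b) amb"
  is "\<lambda>z. (\<lambda>A. star (str A) (fst z A), cnj (snd z))"
  by (simp add: bounded_family_star)

definition cc_amb :: "complex \<Rightarrow> ('a, 'b) amb" where "cc_amb c = cscl c 1"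

lemma fam_adj [simp]: "fam (adj z) A = star (str A) (fam z A)" "spt (adj z) = cnj (spt z)"
  by (transfer; auto)+

lemma fam_cc [simp]: "fam (cc c) A = \<zero>\<^bsub>str A\<^esub>" "spt (cc c :: ('a, 'b) amb) = c"
proof -
  interpret cstar_algebra "str A" by simp
  show "fam (cc c) A = \<zero>\<^bsub>str A\<^esub>" "spt (cc c :: ('a, 'b) amb) = c" by (simp_all add: cc_amb_def)
qed

instance
proof
  fix x y :: "('a, 'b) amb" and a b :: complex and r :: real
  { fix A :: "('a, 'b) cstar_scheme"
    interpret cstar_algebra "str A" by simp
    have "fam (adj (adj x)) A = fam x A" "fam (adj (x + y)) A = fam (adj x + adj y) A"
      "fam (adj (x * y)) A = fam (adj y * adj x) A" "fam (cc (a + b)) A = fam (cc a + cc b) A"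
      "fam (cc (a * b)) A = fam (cc a * cc b) A" "fam (cc (of_real r)) A = fam (r *\<^sub>R 1) A"
      "fam (cc a * x) A = fam (x * cc a) A" "fam (adj (cc a)) A = fam (cc (cnj a)) A"
      by (simp_all add: star_star star_add star_mult star_scale a_ac scaleR_amb_def) }
  note * = this
  show adj: "adj (adj x) = x" for x :: "('a, 'b) amb"
  proof (rule amb_eqI)
    fix A :: "('a, 'b) cstar_scheme"
    interpret cstar_algebra "str A" by simp
    show "fam (adj (adj x)) A = fam x A" by (simp add: star_star)
  qed simp
  show "adj (x + y) = adj x + adj y" "adj (x * y) = adj y * adj x" "cc (a + b) = (cc a + cc b :: ('a, 'b) amb)"
    "cc (a * b) = (cc a * cc b :: ('a, 'b) amb)" "cc (complex_of_real r) = (r *\<^sub>R 1 :: ('a, 'b) amb)"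
    "cc a * x = x * cc a" "adj (cc a) = (cc (cnj a) :: ('a, 'b) amb)"
    by (intro amb_eqI *; simp add: scaleR_amb_def)+
  show "(norm x)\<^sup>2 \<le> norm (adj x * x)"
  proof -
    \<comment> \<open>As for operators on a Hilbert module: in a fibre, the square of the norm of
      \<open>x\<close> applied to \<open>y\<close> is the norm of \<open>star y\<close> times
      \<open>adj x * x\<close> applied to \<open>y\<close>. The scalar term of the norm obeys the
      same bound.\<close>
    have "norm x \<le> sqrt (norm (adj x * x))"
    proof (rule norm_amb_le)
      fix A :: "('a, 'b) cstar_scheme" and y assume y: "y \<in> scar A" "snorm A y \<le> 1"
      interpret cstar_algebra "str A" by simp
      let ?z = "act (fam x A) (spt x) y"
      have "act (fam (adj x * x) A) (spt (adj x * x)) y = act (fam (adj x) A) (spt (adj x)) ?z"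
        using y by (simp add: act_mult)
      hence "star (str A) ?z \<otimes>\<^bsub>str A\<^esub> ?z = star (str A) y \<otimes>\<^bsub>str A\<^esub> act (fam (adj x * x) A) (spt (adj x * x)) y"
        using y by (simp add: act_star)
      hence "(snorm A ?z)\<^sup>2 \<le> snorm A y * snorm A (act (fam (adj x * x) A) (spt (adj x * x)) y)"
        using y norm_mult[of "star (str A) y" "act (fam (adj x * x) A) (spt (adj x * x)) y"]
        by (simp flip: cstar_identity)
      also have "\<dots> \<le> 1 * (norm (adj x * x) * 1)"
        using y act_le_norm[OF y(1), of "adj x * x"]
        by (intro mult_mono order.trans[OF act_le_norm[OF y(1)]]) (auto simp: norm_nonneg)
      finally show "snorm A ?z \<le> sqrt (norm (adj x * x))"
        by (simp add: real_le_rsqrt)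
    next
      have "(cmod (spt x))\<^sup>2 = cmod (spt (adj x * x))" by (simp add: Real_Vector_Spaces.norm_mult power2_eq_square)
      also have "\<dots> \<le> norm (adj x * x)" by (rule spt_le_norm)
      finally show "cmod (spt x) \<le> sqrt (norm (adj x * x))" by (simp add: real_le_rsqrt)
    qed
    hence "(norm x)\<^sup>2 \<le> (sqrt (norm (adj x * x)))\<^sup>2" by (rule power_mono) simp
    thus ?thesis by simp
  qed
qed

end

section \<open>C*-algebras as ideals of the ambient algebra\<close>

lift_definition emb :: "('a, 'b) cstar_scheme \<Rightarrow> 'a \<Rightarrow> ('a, 'b) amb"
  is "\<lambda>A a. (\<lambda>B. if B = A \<and> a \<in> scar A then a else \<zero>\<^bsub>str B\<^esub>, 0)"
proof -
  fix A :: "('a, 'b) cstar_scheme" and a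
  let ?f = "\<lambda>B. if B = A \<and> a \<in> scar A then a else \<zero>\<^bsub>str B\<^esub>"
  have "?f B \<in> scar B" "snorm B (?f B) \<le> \<bar>snorm A a\<bar>" for B
  proof -
    interpret cstar_algebra "str B" by simp
    show "?f B \<in> scar B" "snorm B (?f B) \<le> \<bar>snorm A a\<bar>" by auto
  qed
  thus "bounded_family (fst (?f, 0 :: complex))"
    unfolding bounded_family_def fst_conv by blast
qed

context cstar_algebra
begin

lemma str_A [simp]: "str A = A"
  using cstar_algebra_axioms by (simp add: str_def)

lemma fam_emb: "a \<in> carrier A \<Longrightarrow> fam (emb A a) B = (if B = A then a else \<zero>\<^bsub>str B\<^esub>)"
  by (simp add: fam.rep_eq emb.rep_eq)

lemma spt_emb [simp]: "spt (emb A a) = 0"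
  by (simp add: spt.rep_eq emb.rep_eq)

lemma fam_emb_A [simp]: "a \<in> carrier A \<Longrightarrow> fam (emb A a) A = a"
  by (simp add: fam_emb)

lemma fam_emb_other [simp]: "a \<in> carrier A \<Longrightarrow> B \<noteq> A \<Longrightarrow> fam (emb A a) B = \<zero>\<^bsub>str B\<^esub>"
  by (simp add: fam_emb)

lemma fam_closed_A [simp]: "fam z A \<in> carrier A"
  using fam_closed[of z A] by simp

lemma emb_eqI:
  assumes "a \<in> carrier A" "fam z A = a" "spt z = 0" "\<And>B. B \<noteq> A \<Longrightarrow> fam z B = \<zero>\<^bsub>str B\<^esub>"
  shows "z = emb A a"
proof (rule amb_eqI)
  fix B show "fam z B = fam (emb A a) B" using assms by (cases "B = A") simp_all
qed (use assms in simp)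

text \<open>Outside the fibre \<open>A\<close> the embedded element is 0, so \<open>z\<close> acts
  through its component at \<open>A\<close> and its scalar part only. The image of \<open>A\<close>
  is thus an ideal of the ambient algebra.\<close>

lemma emb_mult_left: assumes "a \<in> carrier A"
  shows "emb A a * z = emb A (a \<otimes> fam z A \<oplus> cscale A (spt z) a)"
proof (rule emb_eqI)
  fix B assume B: "B \<noteq> A"
  interpret B: cstar_algebra "str B" by simp
  show "fam (emb A a * z) B = \<zero>\<^bsub>str B\<^esub>" using assms B by simp
qed (use assms in simp_all)

lemma emb_mult_right: assumes "a \<in> carrier A"
  shows "z * emb A a = emb A (fam z A \<otimes> a \<oplus> cscale A (spt z) a)"
proof (rule emb_eqI)
  fix B assume B: "B \<noteq> A"
  interpret B: cstar_algebra "str B" by simp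
  show "fam (z * emb A a) B = \<zero>\<^bsub>str B\<^esub>" using assms B by simp
qed (use assms in simp_all)

lemma emb_mult: "a \<in> carrier A \<Longrightarrow> b \<in> carrier A \<Longrightarrow> emb A (a \<otimes> b) = emb A a * emb A b"
  by (simp add: emb_mult_left)

lemma emb_add: assumes "a \<in> carrier A" "b \<in> carrier A" shows "emb A (a \<oplus> b) = emb A a + emb A b"
proof (rule emb_eqI[symmetric])
  fix B assume B: "B \<noteq> A"
  interpret B: cstar_algebra "str B" by simp
  show "fam (emb A a + emb A b) B = \<zero>\<^bsub>str B\<^esub>" using assms B by simp
qed (use assms in simp_all)

lemma emb_star: assumes "a \<in> carrier A" shows "emb A (star A a) = adj (emb A a)"
proof (rule emb_eqI[symmetric])
  fix B assume B: "B \<noteq> A"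
  interpret B: cstar_algebra "str B" by simp
  show "fam (adj (emb A a)) B = \<zero>\<^bsub>str B\<^esub>" using assms B by simp
qed (use assms in simp_all)

lemma emb_zero [simp]: "emb A \<zero> = 0"
  by (rule emb_eqI[symmetric]) simp_all

lemma emb_scale: assumes "a \<in> carrier A" shows "emb A (cscale A c a) = cc c * emb A a"
  using emb_mult_right[OF assms, of "cc c"] assms by simp

lemma emb_inj: "a \<in> carrier A \<Longrightarrow> b \<in> carrier A \<Longrightarrow> emb A a = emb A b \<Longrightarrow> a = b"
  by (metis fam_emb_A)

text \<open>In every fibre other than \<open>A\<close> the element acts as the scalar
  \<open>c\<close>; this is why a bound on \<open>cmod c\<close> is assumed next to the one in
  \<open>A\<close>. For non-unital \<open>A\<close> the former will be derived from the
  latter.\<close>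

lemma norm_emb_add_cc_le:
  assumes a: "a \<in> carrier A" and "cmod c \<le> M"
    and "\<And>x. x \<in> carrier A \<Longrightarrow> cnorm A x \<le> 1 \<Longrightarrow> cnorm A (act a c x) \<le> M"
  shows "norm (emb A a + cc c) \<le> M"
proof (rule norm_amb_le)
  fix B :: "('a, 'b) cstar_scheme" and x assume x: "x \<in> scar B" "snorm B x \<le> 1"
  interpret B: cstar_algebra "str B" by simp
  show "snorm B (B.act (fam (emb A a + cc c) B) (spt (emb A a + cc c)) x) \<le> M"
  proof (cases "B = A")
    case True
    thus ?thesis using assms x by simp
  next
    case False
    hence "snorm B (B.act (fam (emb A a + cc c) B) (spt (emb A a + cc c)) x) = cmod c * snorm B x"
      using a x by (simp add: B.act_def B.norm_scale)
    also have "\<dots> \<le> cmod c * 1" using x by (intro mult_left_mono) auto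
    finally show ?thesis using assms(2) by simp
  qed
qed (use assms in simp)

lemma norm_emb: assumes a: "a \<in> carrier A" shows "norm (emb A a) = cnorm A a"
proof (rule antisym)
  have "cnorm A (act a 0 x) \<le> cnorm A a" if "x \<in> carrier A" "cnorm A x \<le> 1" for x
    using order.trans[OF norm_act_le[of a x 0] mult_left_mono[OF that(2), of "cnorm A a + cmod 0"]] a that
    by (simp add: norm_nonneg)
  thus "norm (emb A a) \<le> cnorm A a" using norm_emb_add_cc_le[of a 0 "cnorm A a"] a by (simp add: norm_nonneg)
  have "cnorm A a \<le> norm (emb A a) + cmod 0"
    using act_le_norm[of _ A "emb A a"] a by (intro norm_le_of_act) auto
  thus "cnorm A a \<le> norm (emb A a)" by simp
qed

end

section \<open>Finite matrices\<close>

text \<open>Matrices of all sizes share one type, and sizes become the predicate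
  \<open>fsize\<close>. The type has no identity; the diagonal matrices \<open>diag n a\<close> take
  over that role on matrices of size \<open>n\<close>.\<close>

typedef (overloaded) 'a fmat = "{M :: nat \<Rightarrow> nat \<Rightarrow> 'a::zero. \<exists>n. \<forall>i j. i \<ge> n \<or> j \<ge> n \<longrightarrow> M i j = 0}"
  morphisms ent Abs_fmat
  by (rule exI[of _ "\<lambda>_ _. 0"]) auto

setup_lifting type_definition_fmat

lemma fmat_eqI: "(\<And>i j. ent M i j = ent N i j) \<Longrightarrow> M = N"
  by transfer auto

definition fsize :: "nat \<Rightarrow> 'a::zero fmat \<Rightarrow> bool" where
  "fsize n M \<longleftrightarrow> (\<forall>i j. i \<ge> n \<or> j \<ge> n \<longrightarrow> ent M i j = 0)"

lemma fsize_ex: "\<exists>n. fsize n M" unfolding fsize_def by transfer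

lemma fsize_mono: "fsize n M \<Longrightarrow> n \<le> m \<Longrightarrow> fsize m M"
  by (auto simp: fsize_def)

lemma fsizeD: "fsize n M \<Longrightarrow> i \<ge> n \<or> j \<ge> n \<Longrightarrow> ent M i j = 0"
  by (auto simp: fsize_def)

instantiation fmat :: (ring) ring
begin

lift_definition zero_fmat :: "'a fmat" is "\<lambda>_ _. 0" by auto
lift_definition plus_fmat :: "'a fmat \<Rightarrow> 'a fmat \<Rightarrow> 'a fmat" is "\<lambda>M N i j. M i j + N i j"
proof -
  fix M N :: "nat \<Rightarrow> nat \<Rightarrow> 'a"
  assume "\<exists>n. \<forall>i j. i \<ge> n \<or> j \<ge> n \<longrightarrow> M i j = 0" "\<exists>n. \<forall>i j. i \<ge> n \<or> j \<ge> n \<longrightarrow> N i j = 0"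
  then obtain m n where "\<forall>i j. i \<ge> m \<or> j \<ge> m \<longrightarrow> M i j = 0" "\<forall>i j. i \<ge> n \<or> j \<ge> n \<longrightarrow> N i j = 0" by auto
  thus "\<exists>n. \<forall>i j. i \<ge> n \<or> j \<ge> n \<longrightarrow> M i j + N i j = 0" by (intro exI[of _ "max m n"]) auto
qed
lift_definition uminus_fmat :: "'a fmat \<Rightarrow> 'a fmat" is "\<lambda>M i j. - M i j" by auto
definition minus_fmat :: "'a fmat \<Rightarrow> 'a fmat \<Rightarrow> 'a fmat" where "minus_fmat M N = M + - N"
text \<open>Summing over the nonzero entries of a row keeps the product independent of a size;
  \<open>ent_mult\<close> replaces this by any index range that bounds one of the factors.\<close>

lift_definition times_fmat :: "'a fmat \<Rightarrow> 'a fmat \<Rightarrow> 'a fmat"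
  is "\<lambda>M N i j. \<Sum>k | M i k \<noteq> 0. M i k * N k j"
proof -
  fix M N :: "nat \<Rightarrow> nat \<Rightarrow> 'a"
  assume "\<exists>n. \<forall>i j. i \<ge> n \<or> j \<ge> n \<longrightarrow> M i j = 0" "\<exists>n. \<forall>i j. i \<ge> n \<or> j \<ge> n \<longrightarrow> N i j = 0"
  then obtain m n where "\<forall>i j. i \<ge> m \<or> j \<ge> m \<longrightarrow> M i j = 0" "\<forall>i j. i \<ge> n \<or> j \<ge> n \<longrightarrow> N i j = 0" by auto
  thus "\<exists>n. \<forall>i j. i \<ge> n \<or> j \<ge> n \<longrightarrow> (\<Sum>k | M i k \<noteq> 0. M i k * N k j) = 0"
    by (intro exI[of _ "max m n"]) (auto intro!: sum.neutral)
qed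

lemma ent_simps [simp]: "ent 0 i j = 0" "ent (M + N) i j = ent M i j + ent N i j"
    "ent (- M) i j = - ent M i j" "ent (M - N) i j = ent M i j - ent N i j"
  unfolding minus_fmat_def by (transfer; simp)+

lemma ent_mult:
  assumes "fsize n M \<or> fsize n N"
  shows "ent (M * N) i j = (\<Sum>k<n. ent M i k * ent N k j)"
proof -
  obtain m where m: "fsize m M" using fsize_ex by blast
  hence *: "k < m" if "ent M i k \<noteq> 0" for i k
    using that by (meson fsizeD not_le)
  have "ent (M * N) i j = (\<Sum>k | ent M i k \<noteq> 0. ent M i k * ent N k j)" by transfer simp
  also have "\<dots> = (\<Sum>k<max m n. ent M i k * ent N k j)"
    using * by (intro sum.mono_neutral_left) (auto simp: less_max_iff_disj)
  also have "\<dots> = (\<Sum>k<n. ent M i k * ent N k j)"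
    using assms by (intro sum.mono_neutral_right) (auto simp: fsize_def not_less)
  finally show ?thesis .
qed

instance
proof
  fix a b c :: "'a fmat"
  obtain k l m where "fsize k a" "fsize l b" "fsize m c" using fsize_ex by metis
  then obtain n where n: "fsize n a" "fsize n b" "fsize n c"
    using fsize_mono[of _ _ "max k (max l m)"] by (meson max.cobounded1 max.cobounded2 max.coboundedI2)
  show "a * b * c = a * (b * c)"
  proof (rule fmat_eqI)
    fix i j
    have "ent (a * b * c) i j = (\<Sum>k<n. (\<Sum>l<n. ent a i l * ent b l k) * ent c k j)"
      using n by (simp add: ent_mult[of n])
    also have "\<dots> = (\<Sum>l<n. \<Sum>k<n. ent a i l * ent b l k * ent c k j)"
      unfolding sum_distrib_right by (rule sum.swap)
    also have "\<dots> = ent (a * (b * c)) i j"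
      using n by (simp add: ent_mult[of n] sum_distrib_left mult.assoc)
    finally show "ent (a * b * c) i j = ent (a * (b * c)) i j" .
  qed
  show "(a + b) * c = a * c + b * c" "a * (b + c) = a * b + a * c"
    using n by (auto intro!: fmat_eqI simp: ent_mult[of n] algebra_simps sum.distrib)
qed (auto intro!: fmat_eqI simp: minus_fmat_def)

end

lemma fsize_simps [simp]: "fsize n 0" "fsize n M \<Longrightarrow> fsize n N \<Longrightarrow> fsize n (M + N)"
  "fsize n M \<Longrightarrow> fsize n N \<Longrightarrow> fsize n (M - N)" "fsize n M \<Longrightarrow> fsize n (- M)"
  by (auto simp: fsize_def)

lemma fsize_mult [simp]: "fsize n M \<Longrightarrow> fsize n N \<Longrightarrow> fsize n (M * N)"
  unfolding fsize_def by (auto simp: ent_mult[of n] fsize_def)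

lemma ex_fmat:
  assumes "\<And>i j. i \<ge> n \<or> j \<ge> n \<Longrightarrow> f i j = (0::'a::ring)"
  obtains M where "ent M = f" "fsize n M"
proof -
  have "ent (Abs_fmat f) = f" by (rule Abs_fmat_inverse) (use assms in blast)
  thus thesis using assms by (intro that) (auto simp: fsize_def)
qed

lift_definition fadj :: "'a::cstar1 fmat \<Rightarrow> 'a fmat" is "\<lambda>M i j. adj (M j i)"
proof -
  fix M :: "nat \<Rightarrow> nat \<Rightarrow> 'a"
  assume "\<exists>n. \<forall>i j. i \<ge> n \<or> j \<ge> n \<longrightarrow> M i j = 0"
  then obtain n where "\<forall>i j. i \<ge> n \<or> j \<ge> n \<longrightarrow> M i j = 0" ..
  thus "\<exists>n. \<forall>i j. i \<ge> n \<or> j \<ge> n \<longrightarrow> adj (M j i) = 0" by (intro exI[of _ n]) auto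
qed

lemma ent_fadj [simp]: "ent (fadj M) i j = adj (ent M j i)" by transfer simp

lemma fsize_fadj [simp]: "fsize n M \<Longrightarrow> fsize n (fadj M)" by (auto simp: fsize_def)

lemma adj_sum: "adj (\<Sum>i\<in>I. f i) = (\<Sum>i\<in>I. adj (f i :: 'a::cstar1))"
  by (induction I rule: infinite_finite_induct) (auto simp: adj_add)

lemma fadj_simps [simp]: "fadj (fadj M) = M" "fadj (M + N) = fadj M + fadj N" "fadj (M - N) = fadj M - fadj N"
  "fadj (M * N) = fadj N * fadj M" "fadj (- M) = - fadj M" "fadj 0 = 0"
proof -
  show "fadj (M * N) = fadj N * fadj M"
  proof -
    obtain n where n: "fsize n M" using fsize_ex by blast
    show ?thesis by (rule fmat_eqI) (use n in \<open>simp add: ent_mult[of n] adj_sum adj_mult\<close>)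
  qed
qed (auto intro!: fmat_eqI simp: adj_add adj_diff)

text \<open>The type \<open>fmat\<close> has no identity; the statement says that \<open>1 + k\<close> is the inverse of \<open>1 + g\<close>.\<close>

lemma neumann:
  fixes g :: "'a::{real_normed_algebra_1, banach} fmat"
  assumes g: "fsize n g" and d: "\<And>i j. norm (ent g i j) \<le> d" "real n * d \<le> 1/2"
  obtains k where "fsize n k" "g + k + g * k = 0" "g + k + k * g = 0"
proof -
  \<comment> \<open>\<open>p m\<close> is the power of \<open>- g\<close> with exponent
    \<open>m + 1\<close>. The exponents start at 1 in the absence of an identity, and the sum of
    these powers is \<open>k\<close>.\<close>
  define p where "p m = ((\<lambda>x. x * (- g)) ^^ m) (- g)" for m
  have p0: "p 0 = - g" and pS: "p (Suc m) = p m * (- g)" for m by (simp_all add: p_def)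
  have pS': "p (Suc m) = (- g) * p m" for m
  proof (induction m)
    case (Suc m)
    have "p (Suc (Suc m)) = (- g) * p m * (- g)" using pS[of "Suc m"] Suc by simp
    thus ?case by (simp add: pS mult.assoc)
  qed (simp add: pS p0)
  have pn: "fsize n (p m)" for m using g by (induction m) (simp_all add: p0 pS)
  have d0: "d \<ge> 0" using d(1)[of 0 0] norm_ge_zero[of "ent g 0 0"] by linarith
  have np: "norm (ent (p m) i j) \<le> d * (1/2) ^ m" for m i j
  proof (induction m arbitrary: i j)
    case (Suc m)
    have "norm (ent (p (Suc m)) i j) \<le> (\<Sum>k<n. norm (ent (p m) i k * ent (- g) k j))"
      unfolding pS ent_mult[OF disjI1[OF pn]] by (rule norm_sum)
    also have "\<dots> \<le> (\<Sum>k<n. (d * (1/2) ^ m) * d)"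
      by (intro sum_mono order.trans[OF norm_mult_ineq] mult_mono Suc) (use d d0 in auto)
    also have "\<dots> = (d * (1/2) ^ m) * (real n * d)" by simp
    also have "\<dots> \<le> (d * (1/2) ^ m) * (1/2)" using d d0 by (intro mult_left_mono) auto
    finally show ?case by simp
  qed (use d in \<open>simp add: p0\<close>)
  have sm: "summable (\<lambda>m. ent (p m) i j)" for i j
    by (rule summable_comparison_test'[where N = 0 and g = "\<lambda>m. d * (1/2) ^ m"])
      (auto intro: summable_mult summable_geometric np)
  obtain k where k: "ent k = (\<lambda>i j. \<Sum>m. ent (p m) i j)" "fsize n k"
  proof (rule ex_fmat)
    fix i j assume "i \<ge> n \<or> j \<ge> n"
    hence "ent (p m) i j = 0" for m using pn fsizeD by blast
    thus "(\<Sum>m. ent (p m) i j) = 0" by simp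
  qed
  have split: "ent k i j = - ent g i j + (\<Sum>m. ent (p (Suc m)) i j)" for i j
    using suminf_split_head[OF sm[of i j]] by (simp add: k p0)
  have 1: "(- g) * k = k + g"
  proof (rule fmat_eqI)
    fix i j
    have "ent ((- g) * k) i j = (\<Sum>l<n. ent (- g) i l * (\<Sum>m. ent (p m) l j))"
      unfolding ent_mult[OF disjI2[OF k(2)]] k(1) ..
    also have "\<dots> = (\<Sum>l<n. \<Sum>m. ent (- g) i l * ent (p m) l j)"
      by (intro sum.cong refl suminf_mult[symmetric] sm)
    also have "\<dots> = (\<Sum>m. \<Sum>l<n. ent (- g) i l * ent (p m) l j)"
      by (intro suminf_sum[symmetric] summable_mult sm)
    also have "\<dots> = (\<Sum>m. ent (p (Suc m)) i j)"
      unfolding pS' ent_mult[OF disjI2[OF pn]] ..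
    also have "\<dots> = ent (k + g) i j" using split[of i j] by simp
    finally show "ent ((- g) * k) i j = ent (k + g) i j" .
  qed
  have 2: "k * (- g) = k + g"
  proof (rule fmat_eqI)
    fix i j
    have "ent (k * (- g)) i j = (\<Sum>l<n. (\<Sum>m. ent (p m) i l) * ent (- g) l j)"
      unfolding ent_mult[OF disjI1[OF k(2)]] k(1) ..
    also have "\<dots> = (\<Sum>l<n. \<Sum>m. ent (p m) i l * ent (- g) l j)"
      by (intro sum.cong refl suminf_mult2 sm)
    also have "\<dots> = (\<Sum>m. \<Sum>l<n. ent (p m) i l * ent (- g) l j)"
      by (intro suminf_sum[symmetric] summable_mult2 sm)
    also have "\<dots> = (\<Sum>m. ent (p (Suc m)) i j)"
      unfolding pS ent_mult[OF disjI1[OF pn]] ..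
    also have "\<dots> = ent (k + g) i j" using split[of i j] by simp
    finally show "ent (k * (- g)) i j = ent (k + g) i j" .
  qed
  show thesis
  proof (rule that[OF k(2)])
    have "g + k + g * k = (k + g) - (- g) * k" "g + k + k * g = (k + g) - k * (- g)" by simp_all
    thus "g + k + g * k = 0" "g + k + k * g = 0" unfolding 1 2 by simp_all
  qed
qed

lemma ent_mult_norm_le:
  fixes M N :: "'a::real_normed_algebra_1 fmat"
  assumes "fsize n M" "\<And>i j. norm (ent M i j) \<le> a" "\<And>i j. norm (ent N i j) \<le> b" "a \<ge> 0"
  shows "norm (ent (M * N) i j) \<le> real n * (a * b)"
proof -
  have "norm (ent (M * N) i j) \<le> (\<Sum>k<n. norm (ent M i k * ent N k j))"
    using assms(1) by (simp add: ent_mult[of n] norm_sum)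
  also have "\<dots> \<le> (\<Sum>k<n. a * b)"
    using assms by (intro sum_mono order.trans[OF norm_mult_ineq] mult_mono) auto
  finally show ?thesis by simp
qed

lemma bounded_entries:
  fixes M :: "'a::real_normed_algebra_1 fmat"
  obtains a where "\<And>i j. norm (ent M i j) \<le> a" "a \<ge> 0"
proof -
  obtain n where n: "fsize n M" using fsize_ex by blast
  have "norm (ent M i j) \<le> (\<Sum>i<n. \<Sum>j<n. norm (ent M i j))" for i j
  proof (cases "i < n \<and> j < n")
    case True
    have "norm (ent M i j) \<le> (\<Sum>j<n. norm (ent M i j))"
      using True by (intro member_le_sum) auto
    also have "\<dots> \<le> (\<Sum>i<n. \<Sum>j<n. norm (ent M i j))"
      using True by (intro member_le_sum[where f = "\<lambda>i. \<Sum>j<n. norm (ent M i j)"]) (auto intro: sum_nonneg)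
    finally show ?thesis .
  next
    case False
    thus ?thesis using fsizeD[OF n, of i j] by (auto intro!: sum_nonneg simp: not_less)
  qed
  thus thesis by (rule that) (auto intro!: sum_nonneg)
qed

text \<open>A partial isometry \<open>x\<close> with defects \<open>P\<close>, \<open>Q\<close> and quasi-inverse \<open>w\<close> which is approximated by an
  invertible \<open>y\<close>: the Schur complement of the corner \<open>(e - Q) y (e - P)\<close> in \<open>y\<close> is an isomorphism
  from \<open>P\<close> to \<open>Q\<close>.\<close>

lemma schur_complement_equivalence:
  fixes e x w y z P Q k :: "'r::ring"
  defines "g \<equiv> w * (y - x)"
  assumes e: "e * x = x" "x * e = x" "e * w = w" "w * e = w" "y * e = y" "e * z = z"
      "e * P = P" "P * e = P" "e * Q = Q" "Q * e = Q"
    and wx: "w * x = e - P" "x * w = e - Q" "x * P = 0" "Q * x = 0" "P * w = 0" "w * Q = 0"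
    and yz: "y * z = e" "z * y = e" and PP: "P * P = P" and QQ: "Q * Q = Q"
    and k: "g + k + g * k = 0" "g + k + k * g = 0"
  obtains s t where "s * t = P" "t * s = Q" "P * s = s" "s * Q = s" "Q * t = t" "t * P = t"
proof -
  have kg: "k = - g - g * k" "k = - g - k * g"
    using k by (simp_all add: eq_neg_iff_add_eq_0 algebra_simps)
  have "P * g = 0" by (simp add: g_def wx flip: mult.assoc)
  hence Pk: "P * k = 0" by (subst kg(1)) (simp add: right_diff_distrib flip: mult.assoc)
  have eg: "e * g = g" "g * e = g" by (simp_all add: g_def e mult.assoc[symmetric]) (simp add: mult.assoc e algebra_simps)
  have ek: "e * k = k" "k * e = k"
  proof -
    have "e * k = - g - g * k" by (subst kg(1)) (simp add: right_diff_distrib eg flip: mult.assoc)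
    thus "e * k = k" using kg(1) by simp
    have "k * e = - g - k * g" by (subst kg(2)) (simp add: left_diff_distrib eg mult.assoc)
    thus "k * e = k" using kg(2) by simp
  qed
  have wy: "w * y = e - P + g" by (simp add: g_def right_diff_distrib wx)
  \<comment> \<open>\<open>P + k * P\<close> is \<open>P\<close> multiplied by the inverse
    \<open>e + k\<close> of \<open>e + g\<close>, and \<open>w * y\<close>, which is
    \<open>e - P + g\<close>, annihilates it. So \<open>w * t = 0\<close>, which puts
    \<open>t\<close> under \<open>Q\<close>. Its inverse \<open>s\<close> is the corner of
    \<open>z\<close>: the inverse of a Schur complement is a block of the inverse matrix.\<close>
  define t where "t = y * (P + k * P)"
  define s where "s = P * z * Q"
  have gkP: "g * P + (k * P + g * (k * P)) = 0"
  proof -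
    have "g * P + (k * P + g * (k * P)) = (g + k + g * k) * P" by (simp add: algebra_simps)
    thus ?thesis using k by simp
  qed
  have "w * t = (e - P + g) * (P + k * P)" by (simp add: t_def wy flip: mult.assoc)
  also have "\<dots> = g * P + (k * P + g * (k * P))"
    by (simp add: algebra_simps e PP) (simp add: Pk ek flip: mult.assoc)
  finally have "w * t = 0" using gkP by simp
  hence "x * w * t = 0" by (simp add: mult.assoc)
  moreover have et: "e * t = t"
    by (simp add: t_def flip: mult.assoc) (metis mult.assoc yz e(5))
  ultimately have Qt: "Q * t = t" by (simp add: wx algebra_simps)
  have zt: "z * t = P + k * P" by (simp add: t_def yz e ek algebra_simps flip: mult.assoc)
  have st: "s * t = P" by (simp add: s_def Qt zt mult.assoc) (simp add: algebra_simps PP Pk flip: mult.assoc)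
  \<comment> \<open>\<open>v\<close> measures the failure of
    \<open>z * Q = (P + k * P) * (z * Q)\<close>. It is annihilated by the invertible
    \<open>e + g\<close> and therefore vanishes; multiplying the resulting equation by
    \<open>y\<close> gives \<open>t * s = Q\<close>.\<close>
  define v where "v = z * Q - (P + k * P) * (z * Q)"
  have v: "v = (e - P - k * P) * (z * Q)"
    by (simp add: v_def left_diff_distrib distrib_right e flip: mult.assoc)
  have "(e + g) * v = (e + g) * (e - P - k * P) * (z * Q)" by (simp only: v mult.assoc)
  also have "(e + g) * (e - P - k * P) = e - P + g - (g * P + (k * P + g * (k * P)))"
  proof -
    have "e * e = e" using yz e by (metis mult.assoc)
    thus ?thesis by (simp add: algebra_simps e eg ek) (simp add: ek flip: mult.assoc)
  qed
  also have "\<dots> = w * y" by (simp add: gkP wy)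
  also have "w * y * (z * Q) = w * e * Q" by (simp add: yz flip: mult.assoc) (simp add: mult.assoc yz)
  also have "\<dots> = 0" by (simp add: e wx)
  finally have "(e + k) * (e + g) * v = 0" by (simp add: mult.assoc)
  moreover have "(e + k) * (e + g) = e + (g + k + k * g)"
  proof -
    have "e * e = e" using yz e by (metis mult.assoc)
    thus ?thesis by (simp add: algebra_simps e eg ek)
  qed
  moreover have "e * v = v" by (simp add: v_def algebra_simps e ek flip: mult.assoc)
  ultimately have "v = 0" using k by simp
  hence "y * (z * Q) = y * ((P + k * P) * (z * Q))" by (simp add: v_def)
  hence "Q = t * (z * Q)" by (simp add: t_def yz e mult.assoc flip: mult.assoc[of y z])
  moreover have tP: "t * P = t" by (simp add: t_def algebra_simps PP)
  hence "t * s = t * (z * Q)" by (simp add: s_def flip: mult.assoc)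
  ultimately have ts: "t * s = Q" by simp
  show thesis
    by (rule that[OF st ts _ _ Qt tP]) (simp_all add: s_def mult.assoc QQ PP flip: mult.assoc[of P P])
qed

text \<open>In \<open>2 \<times> 2\<close> block form \<open>x\<close> is the matrix with rows \<open>(R, e - F)\<close> and \<open>(e - E, V\<^sup>*)\<close>; \<open>S\<close> moves the
  first block to the second one.\<close>

lemma block_partial_isometry:
  fixes e S V P Q R :: "'a::cstar1 fmat"
  defines "E \<equiv> P + R" and "F \<equiv> Q + R"
  defines "x \<equiv> R + (e - F) * fadj S + S * (e - E) + S * fadj V * fadj S"
  assumes S: "fadj S * S = e" "e * S = 0" "S * e = S" and e: "fadj e = e" "e * e = e"
    and u: "P * e = P" "Q * e = Q" "R * e = R" "V * e = V" "e * V = V"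
    and P: "fadj P = P" "P * P = P" and Q: "fadj Q = Q" "Q * Q = Q" and R: "fadj R = R" "R * R = R"
    and PR: "P * R = 0" "R * P = 0" "Q * R = 0" "R * Q = 0"
    and V: "fadj V * V = E" "V * fadj V = F" "V * E = V"
  shows "fadj x * x = e + S * fadj S - P" "x * fadj x = e + S * fadj S - Q" "x * P = 0" "Q * x = 0"
    "(e + S * fadj S) * x = x" "x * (e + S * fadj S) = x"
proof -
  have S': "fadj S * e = 0" "e * fadj S = fadj S"
    using arg_cong[OF S(2), of fadj] arg_cong[OF S(3), of fadj] e by simp_all
  have u': "e * P = P" "e * Q = Q" "e * R = R" "e * fadj V = fadj V" "fadj V * e = fadj V"
    using arg_cong[OF u(1), of fadj] arg_cong[OF u(2), of fadj] arg_cong[OF u(3), of fadj]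
      arg_cong[OF u(4), of fadj] arg_cong[OF u(5), of fadj] e P Q R by simp_all
  have z: "P * S = 0" "Q * S = 0" "R * S = 0" "V * S = 0" "fadj V * S = 0"
    using u u'(5) S(2) by (metis mult.assoc mult_zero_right)+
  have z': "fadj S * P = 0" "fadj S * Q = 0" "fadj S * R = 0" "fadj S * V = 0" "fadj S * fadj V = 0"
    using u' u(5) S'(1) by (metis mult.assoc mult_zero_left)+
  have V': "E * fadj V = fadj V" using arg_cong[OF V(3), of fadj] P R by (simp add: E_def)
  have FV: "F * V = V" using V by (metis mult.assoc)
  have FV': "fadj V * F = fadj V" using arg_cong[OF FV, of fadj] Q R by (simp add: F_def)
  have EE: "E * E = E" "F * F = F" "E * P = P" "P * E = P" "F * Q = Q" "Q * F = Q" "E * R = R" "R * E = R" "F * R = R" "R * F = R"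
    by (simp_all add: E_def F_def algebra_simps P Q R PR)
  have uE: "E * e = E" "e * E = E" "F * e = F" "e * F = F" "fadj E = E" "fadj F = F"
    and zE: "E * S = 0" "F * S = 0" "fadj S * E = 0" "fadj S * F = 0"
    by (simp_all add: E_def F_def algebra_simps P Q R u u' z z')
  have SS: "S * S = 0" using S(2,3) by (metis mult.assoc mult_zero_right)
  have SS': "fadj S * fadj S = 0" using arg_cong[OF SS, of fadj] by simp
  note rules = S S' SS SS' e u u' P Q R PR V z z' V' FV FV' EE uE zE
  \<comment> \<open>Products get nested to the right, so each relation is also used with an
    arbitrary factor behind it.\<close>
  note assoc = rules[THEN arg_cong[where f = "\<lambda>a. a * c" for c], unfolded mult.assoc mult_zero_left]
  have fx: "fadj x = R + S * (e - F) + (e - E) * fadj S + S * V * fadj S"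
    by (simp add: x_def rules mult.assoc)
  have "fadj x * x = R + S * fadj S + (e - E)"
    unfolding fx unfolding x_def by (simp add: algebra_simps rules assoc)
  thus "fadj x * x = e + S * fadj S - P" by (simp add: E_def)
  have "x * fadj x = R + S * fadj S + (e - F)"
    unfolding fx unfolding x_def by (simp add: algebra_simps rules assoc)
  thus "x * fadj x = e + S * fadj S - Q" by (simp add: F_def)
  show "x * P = 0" "Q * x = 0" "(e + S * fadj S) * x = x" "x * (e + S * fadj S) = x"
    unfolding x_def by (simp_all add: algebra_simps rules assoc)
qed

section \<open>Projections with the same class in \<open>K\<^sub>0\<close>\<close>

text \<open>The identity of \<open>R\<close> only has to act as an identity on the image: it may be
  sent to a proper corner projection of the target.\<close>

lemma ring_of_embedding:
  fixes R :: "('r, 'm) ring_scheme" and f :: "'r \<Rightarrow> 'u::ring"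
  assumes cl: "\<zero>\<^bsub>R\<^esub> \<in> carrier R" "\<one>\<^bsub>R\<^esub> \<in> carrier R"
      "\<And>x y. x \<in> carrier R \<Longrightarrow> y \<in> carrier R \<Longrightarrow> x \<oplus>\<^bsub>R\<^esub> y \<in> carrier R"
      "\<And>x y. x \<in> carrier R \<Longrightarrow> y \<in> carrier R \<Longrightarrow> x \<otimes>\<^bsub>R\<^esub> y \<in> carrier R"
    and neg: "\<And>x. x \<in> carrier R \<Longrightarrow> \<exists>y\<in>carrier R. f y = - f x"
    and inj: "inj_on f (carrier R)"
    and hom: "f \<zero>\<^bsub>R\<^esub> = 0" "\<And>x y. x \<in> carrier R \<Longrightarrow> y \<in> carrier R \<Longrightarrow> f (x \<oplus>\<^bsub>R\<^esub> y) = f x + f y"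
      "\<And>x y. x \<in> carrier R \<Longrightarrow> y \<in> carrier R \<Longrightarrow> f (x \<otimes>\<^bsub>R\<^esub> y) = f x * f y"
      "\<And>x. x \<in> carrier R \<Longrightarrow> f \<one>\<^bsub>R\<^esub> * f x = f x" "\<And>x. x \<in> carrier R \<Longrightarrow> f x * f \<one>\<^bsub>R\<^esub> = f x"
  shows "ring R"
proof (rule ringI)
  note eqI = inj_onD[OF inj]
  show "abelian_group R"
  proof (rule abelian_groupI)
    fix x assume x: "x \<in> carrier R"
    then obtain y where "y \<in> carrier R" "f y = - f x" using neg by blast
    hence "y \<oplus>\<^bsub>R\<^esub> x = \<zero>\<^bsub>R\<^esub>" using x by (intro eqI) (auto simp: cl hom)
    thus "\<exists>y\<in>carrier R. y \<oplus>\<^bsub>R\<^esub> x = \<zero>\<^bsub>R\<^esub>" using \<open>y \<in> carrier R\<close> by blast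
  qed (rule eqI; simp add: cl hom algebra_simps | simp add: cl)+
  show "Group.monoid R"
    by (rule monoidI) (rule eqI; simp add: cl hom mult.assoc | simp add: cl)+
qed (rule inj_onD[OF inj]; simp add: cl hom algebra_simps)+

lemma (in abelian_monoid) finsum_hom:
  fixes f :: "'a \<Rightarrow> 'u::comm_monoid_add"
  assumes "\<And>x y. x \<in> carrier G \<Longrightarrow> y \<in> carrier G \<Longrightarrow> f (x \<oplus> y) = f x + f y" "f \<zero> = 0"
    and "finite I" "h \<in> I \<rightarrow> carrier G"
  shows "f (finsum G h I) = (\<Sum>i\<in>I. f (h i))"
  using assms(3,4) by (induction I) (auto simp: assms(1,2) Pi_def)

locale star_hom = abelian_monoid C for C :: "('c, 'm) cstar_scheme" (structure) +
  fixes \<phi> :: "'c \<Rightarrow> 'u::cstar1"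
  assumes mult_closed [simp]: "x \<in> carrier C \<Longrightarrow> y \<in> carrier C \<Longrightarrow> x \<otimes> y \<in> carrier C"
    and star_closed [simp]: "x \<in> carrier C \<Longrightarrow> star C x \<in> carrier C"
    and hom_zero [simp]: "\<phi> \<zero> = 0"
    and hom_add: "x \<in> carrier C \<Longrightarrow> y \<in> carrier C \<Longrightarrow> \<phi> (x \<oplus> y) = \<phi> x + \<phi> y"
    and hom_mult: "x \<in> carrier C \<Longrightarrow> y \<in> carrier C \<Longrightarrow> \<phi> (x \<otimes> y) = \<phi> x * \<phi> y"
    and hom_star: "x \<in> carrier C \<Longrightarrow> \<phi> (star C x) = adj (\<phi> x)"

text \<open>The offset \<open>k\<close> moves a block along the diagonal. Direct sums become
  ordinary sums of such blocks, and rectangular matrices multiply within a single type.\<close>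

lift_definition place :: "('c \<Rightarrow> 'u::zero) \<Rightarrow> nat \<Rightarrow> 'c mat \<Rightarrow> 'u fmat"
  is "\<lambda>f k M i j. if k \<le> i \<and> i < k + dim_row M \<and> k \<le> j \<and> j < k + dim_col M
       then f (M $$ (i - k, j - k)) else 0"
  subgoal for f k M by (rule exI[of _ "k + dim_row M + dim_col M"]) auto
  done

lemma ent_place: "ent (place f k M) i j = (if k \<le> i \<and> i < k + dim_row M \<and> k \<le> j \<and> j < k + dim_col M
       then f (M $$ (i - k, j - k)) else 0)"
  by (simp add: place.rep_eq)

lemma fsize_place: "M \<in> mats C n n \<Longrightarrow> fsize (k + n) (place f k M)"
  by (auto simp: fsize_def ent_place mats_def)

lemma (in star_hom) place_mult:
  assumes M: "M \<in> mats C m n" and N: "N \<in> mats C n l"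
  shows "place \<phi> k (mmult C M N) = place \<phi> k M * place \<phi> k N"
proof (rule fmat_eqI)
  fix i j
  have d: "dim_row M = m" "dim_col M = n" "dim_row N = n" "dim_col N = l"
    using M N by (auto simp: mats_def)
  let ?K = "k + m + n"
  have fs: "fsize ?K (place \<phi> k M)" using d by (auto simp: fsize_def ent_place)
  have "ent (place \<phi> k M * place \<phi> k N) i j = (\<Sum>t<?K. ent (place \<phi> k M) i t * ent (place \<phi> k N) t j)"
    using fs by (simp add: ent_mult)
  also have "\<dots> = (\<Sum>t\<in>{k..<n + k}. ent (place \<phi> k M) i t * ent (place \<phi> k N) t j)"
    using d by (intro sum.mono_neutral_right) (auto simp: ent_place)
  also have "\<dots> = (\<Sum>t\<in>{0..<n}. ent (place \<phi> k M) i (t + k) * ent (place \<phi> k N) (t + k) j)"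
    using sum.shift_bounds_nat_ivl[of "\<lambda>t. ent (place \<phi> k M) i t * ent (place \<phi> k N) t j" 0 k n] by simp
  also have "\<dots> = ent (place \<phi> k (mmult C M N)) i j"
  proof (cases "k \<le> i \<and> i < k + m \<and> k \<le> j \<and> j < k + l")
    case True
    hence ij: "i - k < m" "j - k < l" by auto
    have in_carrier: "M $$ (i - k, t) \<in> carrier C" "N $$ (t, j - k) \<in> carrier C" if "t < n" for t
      using M N ij that by (auto simp: mats_def)
    have "\<phi> (mmult C M N $$ (i - k, j - k)) = (\<Sum>t\<in>{0..<n}. \<phi> (M $$ (i - k, t) \<otimes> N $$ (t, j - k)))"
      using ij in_carrier by (simp add: mmult_def d) (subst finsum_hom[where f = \<phi>], auto simp: hom_add)
    also have "\<dots> = (\<Sum>t\<in>{0..<n}. ent (place \<phi> k M) i (t + k) * ent (place \<phi> k N) (t + k) j)"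
      using True ij in_carrier by (intro sum.cong) (auto simp: ent_place d hom_mult)
    finally show ?thesis using True by (simp add: ent_place mmult_def d)
  next
    case False
    hence "ent (place \<phi> k M) i (t + k) * ent (place \<phi> k N) (t + k) j = 0" for t
      by (auto simp: ent_place d)
    moreover have "ent (place \<phi> k (mmult C M N)) i j = 0"
      using False by (auto simp: ent_place mmult_def d)
    ultimately show ?thesis by simp
  qed
  finally show "ent (place \<phi> k (mmult C M N)) i j = ent (place \<phi> k M * place \<phi> k N) i j" ..
qed

lemma (in star_hom) place_mstar:
  assumes M: "M \<in> mats C m n"
  shows "place \<phi> k (mstar C M) = fadj (place \<phi> k M)"
  by (rule fmat_eqI) (use M in \<open>auto simp: ent_place mstar_def mats_def hom_star\<close>)

lemma place_inj:
  assumes "inj_on f (carrier C)" "M \<in> mats C m n" "N \<in> mats C m n" "place f k M = place f k N"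
  shows "M = N"
proof (rule eq_matI)
  fix i j assume "i < dim_row N" "j < dim_col N"
  hence ij: "i < m" "j < n" using assms by (auto simp: mats_def)
  have "ent (place f k M) (i + k) (j + k) = ent (place f k N) (i + k) (j + k)" using assms(4) by simp
  hence "f (M $$ (i, j)) = f (N $$ (i, j))" using assms(2,3) ij by (auto simp: ent_place mats_def)
  thus "M $$ (i, j) = N $$ (i, j)" using assms ij by (auto simp: mats_def dest: inj_onD)
qed (use assms in \<open>auto simp: mats_def\<close>)

lemma (in star_hom) place_dsum:
  assumes "M \<in> mats C m m" "N \<in> mats C n n"
  shows "place \<phi> k (dsum C M N) = place \<phi> k M + place \<phi> (k + m) N"
  by (rule fmat_eqI) (use assms in \<open>auto simp: ent_place dsum_def mats_def mzero_def\<close>)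

lemma (in star_hom) dsum_mats:
  assumes "M \<in> mats C m m" "N \<in> mats C n n"
  shows "dsum C M N \<in> mats C (m + n) (m + n)"
  using assms by (auto simp: dsum_def mats_def mzero_def)

lemma (in star_hom) mstar_mats: "M \<in> mats C m n \<Longrightarrow> mstar C M \<in> mats C n m"
  by (auto simp: mats_def mstar_def)

lemma (in star_hom) mmult_mats: "M \<in> mats C m n \<Longrightarrow> N \<in> mats C n l \<Longrightarrow> mmult C M N \<in> mats C m l"
  by (auto simp: mats_def mmult_def intro!: finsum_closed)

lemma (in star_hom) place_mzero [simp]: "place \<phi> k (mzero C m n) = 0"
  by (rule fmat_eqI) (auto simp: ent_place mzero_def)

definition entries_in :: "'a set \<Rightarrow> 'a::zero fmat \<Rightarrow> bool" where
  "entries_in S M \<longleftrightarrow> (\<forall>i j. ent M i j \<in> S)"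

definition star_subring :: "'a::cstar1 set \<Rightarrow> bool" where
  "star_subring S \<longleftrightarrow> 0 \<in> S \<and> (\<forall>x\<in>S. - x \<in> S \<and> adj x \<in> S \<and> (\<forall>y\<in>S. x + y \<in> S \<and> x * y \<in> S))"

lemma star_subring_sum: "star_subring S \<Longrightarrow> (\<And>i. i \<in> I \<Longrightarrow> f i \<in> S) \<Longrightarrow> sum f I \<in> S"
  by (induction I rule: infinite_finite_induct) (auto simp: star_subring_def)

lemma entries_in_ops:
  assumes S: "star_subring S" and M: "entries_in S M" and N: "entries_in S N"
  shows "entries_in S (M + N)" "entries_in S (M - N)" "entries_in S (M * N)"
proof -
  obtain n where n: "fsize n M" using fsize_ex by blast
  have m: "ent M i j \<in> S" "ent N i j \<in> S" for i j using M N by (auto simp: entries_in_def)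
  show "entries_in S (M + N)"
    using S m by (auto simp: entries_in_def star_subring_def)
  have "x - y \<in> S" if "x \<in> S" "y \<in> S" for x y
    using that S unfolding star_subring_def by (metis add_uminus_conv_diff)
  thus "entries_in S (M - N)" using m by (auto simp: entries_in_def)
  show "entries_in S (M * N)"
    unfolding entries_in_def ent_mult[OF disjI1[OF n]]
    using S m by (intro allI star_subring_sum[OF S]) (auto simp: star_subring_def)
qed

lemma entries_in_fadj: "star_subring S \<Longrightarrow> entries_in S M \<Longrightarrow> entries_in S (fadj M)"
  by (auto simp: entries_in_def star_subring_def)

lift_definition single :: "'a::zero \<Rightarrow> 'a fmat" is "\<lambda>a i j. if i = 0 \<and> j = 0 then a else 0"
  by (rule exI[of _ 1]) auto

lift_definition diag :: "nat \<Rightarrow> 'a::zero \<Rightarrow> 'a fmat" is "\<lambda>n a i j. if i = j \<and> i < n then a else 0"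
  subgoal for n a by (rule exI[of _ n]) auto
  done

lemma ent_single [simp]: "ent (single a) i j = (if i = 0 \<and> j = 0 then a else 0)"
  by (simp add: single.rep_eq)

lemma ent_diag [simp]: "ent (diag n a) i j = (if i = j \<and> i < n then a else 0)"
  by (simp add: diag.rep_eq)

lemma fsize_single: "n \<ge> 1 \<Longrightarrow> fsize n (single a)" and fsize_diag: "n \<le> m \<Longrightarrow> fsize m (diag n a)"
  by (auto simp: fsize_def)

lemma diag_mult:
  assumes "fsize n M"
  shows "(\<And>i j. a * ent M i j = ent M i j) \<Longrightarrow> diag n a * M = M"
    "(\<And>i j. ent M i j * a = ent M i j) \<Longrightarrow> M * diag n a = M"
proof -
  have if_mult: "(if P then a else 0) * b = (if P then a * b else 0)" "b * (if P then a else 0) = (if P then b * a else 0)"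
    for P and b :: 'a by auto
  have if_and: "(if P \<and> Q then b else 0) = (if P then if Q then b else 0 else 0)" for P Q and b :: 'a
    by auto
  show "(\<And>i j. a * ent M i j = ent M i j) \<Longrightarrow> diag n a * M = M"
    "(\<And>i j. ent M i j * a = ent M i j) \<Longrightarrow> M * diag n a = M"
    using assms by (auto intro!: fmat_eqI simp: ent_mult[of n] if_mult if_and fsizeD sum.delta sum.delta')
qed

lemma single_mult: "single a * single b = single (a * b)"
  by (rule fmat_eqI) (simp add: ent_mult[of 1] fsize_single)

lemma fadj_single [simp]: "fadj (single a) = single (adj a)" and fadj_diag [simp]: "fadj (diag n a) = diag n (adj a)"
  by (auto intro!: fmat_eqI)

section \<open>The unitization inside the ambient algebra\<close>

lemma carrier_tilde: "carrier (tilde A) = carrier A \<times> (if unital A then {0} else UNIV)"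
  by (simp add: tilde_def unitization_def)

lemma tilde_simps [simp]:
  "(a, c) \<oplus>\<^bsub>tilde A\<^esub> (b, d) = (a \<oplus>\<^bsub>A\<^esub> b, c + d)"
  "(a, c) \<otimes>\<^bsub>tilde A\<^esub> (b, d) =
     (a \<otimes>\<^bsub>A\<^esub> b \<oplus>\<^bsub>A\<^esub> cscale A d a \<oplus>\<^bsub>A\<^esub> cscale A c b, c * d)"
  "star (tilde A) (a, c) = (star A a, cnj c)" "cscale (tilde A) r (a, c) = (cscale A r a, r * c)"
  "\<zero>\<^bsub>tilde A\<^esub> = (\<zero>\<^bsub>A\<^esub>, 0)"
  by (simp_all add: tilde_def unitization_def)

lemma one_tilde: "\<one>\<^bsub>tilde A\<^esub> = (if unital A then (\<one>\<^bsub>A\<^esub>, 0) else (\<zero>\<^bsub>A\<^esub>, 1))"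
  by (simp add: tilde_def unitization_def)

context cstar_algebra
begin

definition phi :: "'a \<times> complex \<Rightarrow> ('a, 'b) amb" where
  "phi = (\<lambda>(a, c). emb A a + cc c)"

lemma phi_inj: "inj_on phi (carrier A \<times> UNIV)"
proof (rule inj_onI, clarify)
  fix a b c d assume ab: "a \<in> carrier A" "b \<in> carrier A" and eq: "phi (a, c) = phi (b, d)"
  have "c = d" using arg_cong[OF eq, of spt] by (simp add: phi_def)
  moreover from this have "a = b" using eq ab emb_inj by (simp add: phi_def)
  ultimately show "a = b \<and> c = d" by simp
qed

lemma phi_0 [simp]: "phi (a, 0) = emb A a"
  by (simp add: phi_def)

lemma phi_add: "a \<in> carrier A \<Longrightarrow> b \<in> carrier A \<Longrightarrow> phi (a \<oplus> b, c + d) = phi (a, c) + phi (b, d)"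
  by (simp add: phi_def emb_add cc_add)

lemma phi_mult: "a \<in> carrier A \<Longrightarrow> b \<in> carrier A \<Longrightarrow>
  phi (a \<otimes> b \<oplus> cscale A d a \<oplus> cscale A c b, c * d) = phi (a, c) * phi (b, d)"
  using cc_commute[of d "emb A a"] by (simp add: phi_def emb_add emb_mult emb_scale cc_mult algebra_simps)

lemma phi_star: "a \<in> carrier A \<Longrightarrow> phi (star A a, cnj c) = adj (phi (a, c))"
  by (simp add: phi_def emb_star adj_add adj_cc)

text \<open>For unital \<open>A\<close> this is the embedded identity, a projection of the ambient
  algebra; for non-unital \<open>A\<close> it is 1. Formulas in terms of \<open>eA\<close> cover
  both cases.\<close>

abbreviation eA :: "('a, 'b) amb" where "eA \<equiv> phi \<one>\<^bsub>tilde A\<^esub>"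

lemma phi_one:
  assumes "z \<in> carrier (tilde A)"
  shows "eA * phi z = phi z" "phi z * eA = phi z"
  using assms one_is_identity by (auto simp: carrier_tilde one_tilde phi_def simp flip: emb_mult split: if_splits)

lemma one_tilde_closed: "\<one>\<^bsub>tilde A\<^esub> \<in> carrier (tilde A)"
  using one_is_identity by (simp add: carrier_tilde one_tilde)

lemma ring_tilde: "ring (tilde A)"
proof (rule ring_of_embedding[of _ phi])
  show "inj_on phi (carrier (tilde A))" by (rule inj_on_subset[OF phi_inj]) (auto simp: carrier_tilde)
  fix x assume x: "x \<in> carrier (tilde A)"
  obtain a c where [simp]: "x = (a, c)" by force
  have "phi (\<ominus> a, - c) = - phi (a, c)"
    using phi_add[of "\<ominus> a" a "- c" c] x by (simp add: carrier_tilde l_neg eq_neg_iff_add_eq_0)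
  thus "\<exists>y\<in>carrier (tilde A). phi y = - phi x"
    using x by (intro bexI[of _ "(\<ominus> a, - c)"]) (auto simp: carrier_tilde split: if_splits)
  show "eA * phi x = phi x" "phi x * eA = phi x" using phi_one x by auto
next
  show "phi \<zero>\<^bsub>tilde A\<^esub> = 0" by (simp add: phi_def)
qed (auto simp: carrier_tilde phi_add phi_mult emb_add emb_mult one_tilde one_is_identity split: if_splits)

lemma star_hom_tilde: "star_hom (tilde A) phi"
proof -
  interpret ring "tilde A" by (rule ring_tilde)
  show ?thesis
    by unfold_locales (auto simp: carrier_tilde phi_add phi_mult phi_star emb_add emb_mult emb_star split: if_splits)
qed

abbreviation CA :: "('a, 'b) amb set" where "CA \<equiv> phi ` carrier (tilde A)"

lemma star_subring_phi: "star_subring CA"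
proof -
  interpret ring "tilde A" by (rule ring_tilde)
  interpret h: star_hom "tilde A" phi by (rule star_hom_tilde)
  show ?thesis
    unfolding star_subring_def
  proof (intro conjI ballI)
    show "0 \<in> CA" by (metis h.hom_zero imageI zero_closed)
    fix x assume "x \<in> CA"
    then obtain a where a: "a \<in> carrier (tilde A)" "x = phi a" by auto
    have "phi a + phi (\<ominus>\<^bsub>tilde A\<^esub> a) = phi \<zero>\<^bsub>tilde A\<^esub>"
      using a(1) by (simp only: h.hom_add[symmetric] a_inv_closed r_neg)
    hence "- x = phi (\<ominus>\<^bsub>tilde A\<^esub> a)" unfolding a(2) h.hom_zero by (simp add: neg_eq_iff_add_eq_0)
    thus "- x \<in> CA" using a by simp
    show "adj x \<in> CA" using a by (simp flip: h.hom_star)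
    fix y assume "y \<in> CA"
    then obtain b where b: "b \<in> carrier (tilde A)" "y = phi b" by auto
    show "x + y \<in> CA" "x * y \<in> CA"
      using a b by (simp_all flip: h.hom_add h.hom_mult)
  qed
qed

abbreviation esingle :: "'a \<Rightarrow> ('a, 'b) amb fmat" where "esingle a \<equiv> single (emb A a)"

lemma K0_class_witness:
  assumes p: "p \<in> projections A" and q: "q \<in> projections A" and eq: "K0_class A p = K0_class A q"
  obtains n U R where "fsize n U" "fsize n R" "n \<ge> 1"
    "entries_in CA U" "entries_in CA R"
    "fadj R = R" "R * R = R" "esingle p * R = 0" "R * esingle p = 0"
    "esingle q * R = 0" "R * esingle q = 0"
    "fadj U * U = esingle p + R" "U * fadj U = esingle q + R"
proof -
  interpret ring "tilde A" by (rule ring_tilde)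
  interpret h: star_hom "tilde A" phi by (rule star_hom_tilde)
  let ?C = "tilde A"
  let ?c = "\<lambda>a. mat 1 1 (\<lambda>_. (a, 0)) :: ('a \<times> complex) mat" and ?z = "mzero ?C 1 1"
  have proj: "a \<in> carrier A" "star A a = a" "a \<otimes> a = a" if "a \<in> projections A" for a
    using that by (auto simp: projections_def)
  have inj: "inj_on phi (carrier ?C)" by (rule inj_on_subset[OF phi_inj]) (auto simp: carrier_tilde)
  have tc: "place phi 0 (?c a) = esingle a" for a
    by (rule fmat_eqI) (simp add: ent_place)
  have cm: "?c a \<in> mats ?C 1 1" if "a \<in> projections A" for a
    using proj[OF that] by (simp add: mats_def carrier_tilde)
  have zm: "?z \<in> mats ?C 1 1" by (simp add: mats_def mzero_def carrier_tilde)
  have sp: "esingle a * esingle a = esingle a"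
    "fadj (esingle a) = esingle a" if "a \<in> projections A" for a
    using proj[OF that] by (simp_all add: single_mult flip: emb_mult emb_star)
  have cp: "?c a \<in> mat_projections ?C" if a: "a \<in> projections A" for a
  proof -
    have "mstar ?C (?c a) = ?c a"
      by (rule place_inj[OF inj h.mstar_mats[OF cm[OF a]] cm[OF a], of 0])
        (simp only: h.place_mstar[OF cm[OF a]] tc sp[OF a])
    moreover have "mmult ?C (?c a) (?c a) = ?c a"
      by (rule place_inj[OF inj h.mmult_mats[OF cm[OF a] cm[OF a]] cm[OF a], of 0])
        (simp only: h.place_mult[OF cm[OF a] cm[OF a]] tc sp[OF a])
    ultimately show ?thesis using cm[OF a] by (auto simp: mat_projections_def)
  qed
  have zp: "?z \<in> mat_projections ?C"
  proof -
    have "mstar ?C ?z = ?z"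
      by (rule place_inj[OF inj h.mstar_mats[OF zm] zm, of 0])
        (simp only: h.place_mstar[OF zm] h.place_mzero fadj_simps)
    moreover have "mmult ?C ?z ?z = ?z"
      by (rule place_inj[OF inj h.mmult_mats[OF zm zm] zm, of 0])
        (simp only: h.place_mult[OF zm zm] h.place_mzero mult_zero_left)
    ultimately show ?thesis using zm by (auto simp: mat_projections_def)
  qed
  \<comment> \<open>Reflexivity puts the pair of \<open>q\<close> into its own class and so into the
    class of the pair of \<open>p\<close>. This is how equality of two relation images yields a
    relation between the pairs.\<close>
  have "((?c q, ?z), (?c q, ?z)) \<in> K0_rel ?C"
  proof -
    let ?D = "dsum ?C (dsum ?C (?c q) ?z) ?z"
    have D: "dsum ?C (?c q) ?z \<in> mats ?C 2 2" using h.dsum_mats[OF cm[OF q] zm] by (simp add: numeral_2_eq_2)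
    have D': "?D \<in> mats ?C 3 3" using h.dsum_mats[OF D zm] by simp
    have tD: "place phi 0 ?D = esingle q"
      using h.place_dsum[OF D zm, of 0] h.place_dsum[OF cm[OF q] zm, of 0] by (simp add: tc del: One_nat_def)
    note sm = h.mstar_mats[OF D'] and mm = h.mmult_mats
    have "mmult ?C (mstar ?C ?D) ?D = ?D"
      by (rule place_inj[OF inj mm[OF sm D'] D', of 0])
        (simp only: h.place_mult[OF sm D'] h.place_mstar[OF D'] tD sp[OF q])
    moreover have "mmult ?C ?D (mstar ?C ?D) = ?D"
      by (rule place_inj[OF inj mm[OF D' sm] D', of 0])
        (simp only: h.place_mult[OF D' sm] h.place_mstar[OF D'] tD sp[OF q])
    ultimately have "mat_mvn_equiv ?C ?D ?D"
      using D' unfolding mat_mvn_equiv_def by (intro bexI[of _ ?D]) (auto simp: mats_def)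
    thus ?thesis using cp[OF q] zp unfolding K0_rel_def by blast
  qed
  hence "(?c q, ?z) \<in> K0_rel ?C `` {(?c p, ?z)}"
    using eq unfolding K0_class_def K0_diff_def by blast
  then obtain R0 where R0: "R0 \<in> mat_projections ?C"
    "mat_mvn_equiv ?C (dsum ?C (dsum ?C (?c p) ?z) R0) (dsum ?C (dsum ?C (?c q) ?z) R0)"
    unfolding K0_rel_def by auto
  then obtain m where m: "R0 \<in> mats ?C m m" "mstar ?C R0 = R0" "mmult ?C R0 R0 = R0"
    by (auto simp: mat_projections_def)
  have D: "dsum ?C (?c a) ?z \<in> mats ?C 2 2" if "a \<in> projections A" for a
    using h.dsum_mats[OF cm[OF that] zm] by (simp add: numeral_2_eq_2)
  have dims: "dim_row (dsum ?C (dsum ?C (?c a) ?z) R0) = 2 + m" if "a \<in> projections A" for a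
    using h.dsum_mats[OF D[OF that] m(1)] by (auto simp: mats_def)
  obtain U0 where U0: "U0 \<in> mats ?C (2 + m) (2 + m)"
    "mmult ?C (mstar ?C U0) U0 = dsum ?C (dsum ?C (?c p) ?z) R0"
    "mmult ?C U0 (mstar ?C U0) = dsum ?C (dsum ?C (?c q) ?z) R0"
    using R0(2) unfolding mat_mvn_equiv_def dims[OF p] dims[OF q] by (elim bexE conjE) (rule that)
  have U0s: "mstar ?C U0 \<in> mats ?C (2 + m) (2 + m)" by (rule h.mstar_mats[OF U0(1)])
  define U where "U = place phi 0 U0"
  \<comment> \<open>The offset 2 skips index 0, occupied by \<open>p\<close> or \<open>q\<close>,
    and index 1, occupied by the zero block of the formal difference.\<close>
  define R where "R = place phi 2 R0"
  have tD: "place phi 0 (dsum ?C (dsum ?C (?c a) ?z) R0) = esingle a + R" if "a \<in> projections A" for a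
    using h.place_dsum[OF D[OF that] m(1), of 0] h.place_dsum[OF cm[OF that] zm, of 0] by (simp add: tc R_def numeral_2_eq_2 del: One_nat_def)
  have ei: "entries_in (phi ` carrier ?C) (place phi k M)" if "M \<in> mats ?C l l" for k l M
  proof -
    have "0 \<in> phi ` carrier ?C" using star_subring_phi by (simp add: star_subring_def)
    moreover have "phi (M $$ (i, j)) \<in> phi ` carrier ?C" if "i < l" "j < l" for i j
      using that \<open>M \<in> mats ?C l l\<close> by (intro imageI) (simp add: mats_def)
    ultimately show ?thesis using that by (auto simp: entries_in_def ent_place mats_def)
  qed
  have fR: "fsize (2 + m) R" unfolding R_def by (rule fsize_place[OF m(1)])
  have sR: "single a * R = 0" "R * single a = 0" for a
    by (auto intro!: fmat_eqI sum.neutral simp: ent_mult[OF disjI1[OF fR]] ent_mult[OF disjI2[OF fR]])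
      (auto simp: R_def ent_place)
  show thesis
  proof (rule that[of "2 + m" U R])
    show "fsize (2 + m) U" unfolding U_def using fsize_place[OF U0(1), of 0] by simp
    show "entries_in (phi ` carrier ?C) U" "entries_in (phi ` carrier ?C) R"
      unfolding U_def R_def by (rule ei[OF U0(1)], rule ei[OF m(1)])
    show "fadj R = R" unfolding R_def by (simp flip: h.place_mstar[OF m(1)] add: m)
    show "R * R = R" unfolding R_def by (simp flip: h.place_mult[OF m(1) m(1)] add: m)
    show "fadj U * U = esingle p + R"
      unfolding U_def using h.place_mult[OF U0s U0(1), of 0, unfolded U0(2) tD[OF p] h.place_mstar[OF U0(1)]] by simp
    show "U * fadj U = esingle q + R"
      unfolding U_def using h.place_mult[OF U0(1) U0s, of 0, unfolded U0(3) tD[OF q] h.place_mstar[OF U0(1)]] by simp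
    show "fsize (2 + m) R" by (rule fR)
    show "2 + m \<ge> 1" by simp
  qed (rule sR)+
qed

end

context cstar_algebra
begin

lemma K0_partial_isometry:
  assumes p: "p \<in> projections A" and q: "q \<in> projections A" and eq: "K0_class A p = K0_class A q"
  obtains n x where "n \<ge> 1" "fsize n x" "entries_in CA x"
    "fadj x * x = diag n (eA) - esingle p"
    "x * fadj x = diag n (eA) - esingle q"
    "x * esingle p = 0" "esingle q * x = 0"
    "diag n (eA) * x = x" "x * diag n (eA) = x"
proof -
  let ?S = "CA" and ?u = eA and ?P = "esingle p" and ?Q = "esingle q"
  obtain n U R where UR: "fsize n U" "fsize n R" "n \<ge> 1" "entries_in ?S U" "entries_in ?S R"
    "fadj R = R" "R * R = R" "?P * R = 0" "R * ?P = 0" "?Q * R = 0" "R * ?Q = 0"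
    "fadj U * U = ?P + R" "U * fadj U = ?Q + R"
    by (rule K0_class_witness[OF assms])
  have S: "star_subring ?S" by (rule star_subring_phi)
  have one: "?u * a = a" "a * ?u = a" if "a \<in> ?S" for a using that phi_one by auto
  have one_in: "?u \<in> ?S" using one_tilde_closed by blast
  have unit: "diag n ?u * M = M" "M * diag n ?u = M" if "fsize n M" "entries_in ?S M" for n M
    using that by (auto intro!: diag_mult simp: entries_in_def one)
  have one_adj: "adj ?u = ?u"
  proof -
    have a: "adj ?u \<in> ?S" using S one_in by (auto simp: star_subring_def)
    have "adj (?u * adj ?u) = ?u * adj ?u" by (simp add: adj_mult)
    thus ?thesis using one[OF a] by simp
  qed
  have sp: "esingle a * esingle a = esingle a"
    "fadj (esingle a) = esingle a" "entries_in ?S (esingle a)"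
    if "a \<in> projections A" for a
  proof -
    have a: "a \<in> carrier A" "star A a = a" "a \<otimes> a = a" using that by (auto simp: projections_def)
    show "esingle a * esingle a = esingle a" "fadj (esingle a) = esingle a"
      using a by (simp_all add: single_mult flip: emb_mult emb_star)
    have "phi (a, 0) \<in> ?S" using a by (intro imageI) (simp add: carrier_tilde)
    thus "entries_in ?S (esingle a)" using S by (auto simp: entries_in_def star_subring_def)
  qed
  define e where "e = diag n ?u"
  define E where "E = ?P + R"
  define F where "F = ?Q + R"
  \<comment> \<open>Cutting down by \<open>E\<close> makes \<open>V * E = V\<close> immediate. Since
    \<open>E\<close> and \<open>F\<close> are projections, the products of \<open>V\<close> with its
    adjoint are still \<open>E\<close> and \<open>F\<close>.\<close>
  define V where "V = U * E"
  have "?u * ?u = ?u" by (rule one[OF one_in])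
  \<comment> \<open>\<open>T\<close> shifts the first \<open>n\<close> coordinates onto the next
    \<open>n\<close>, so the completed matrix has size \<open>2 * n\<close>.\<close>
  obtain T where T: "ent T = (\<lambda>i j. if j < n \<and> i = j + n then ?u else 0)" "fsize (2 * n) T"
    by (rule ex_fmat[of "2 * n" "\<lambda>i j. if j < n \<and> i = j + n then ?u else 0"]) auto
  have fsP: "fsize n ?P" "fsize n ?Q" using UR(3) by (simp_all add: fsize_single)
  have ein: "entries_in ?S e" using S one_in by (auto simp: entries_in_def e_def star_subring_def)
  have Tin: "entries_in ?S T" using S one_in by (auto simp: entries_in_def T(1) star_subring_def)
  have fse: "fsize n e" by (simp add: e_def fsize_diag)
  have eT: "e * T = 0"
    by (rule fmat_eqI, unfold ent_mult[OF disjI1[OF fse]]) (auto simp: T(1) e_def intro!: sum.neutral)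
  have TT: "fadj T * T = e"
  proof (rule fmat_eqI)
    fix i j
    have "ent (fadj T * T) i j = (\<Sum>k<2 * n. if (i < n \<and> k = i + n) \<and> j < n \<and> k = j + n then ?u else 0)"
      unfolding ent_mult[OF disjI2[OF T(2)]] ent_fadj T(1)
      by (intro sum.cong refl) (auto simp: one_adj \<open>?u * ?u = ?u\<close>)
    also have "\<dots> = (\<Sum>k<2 * n. if k = i + n then (if i = j \<and> i < n then ?u else 0) else 0)"
      by (intro sum.cong refl) auto
    also have "\<dots> = ent e i j" by (auto simp: e_def)
    finally show "ent (fadj T * T) i j = ent e i j" .
  qed
  have TT': "T * fadj T + e = diag (2 * n) ?u"
  proof (rule fmat_eqI)
    fix i j
    have "ent (T * fadj T) i j = (\<Sum>k<2 * n. if (k < n \<and> i = k + n) \<and> k < n \<and> j = k + n then ?u else 0)"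
      unfolding ent_mult[OF disjI1[OF T(2)]] ent_fadj T(1)
      by (intro sum.cong refl) (auto simp: one_adj \<open>?u * ?u = ?u\<close>)
    also have "\<dots> = (\<Sum>k<2 * n. if k = i - n then (if i = j \<and> n \<le> i \<and> i < 2 * n then ?u else 0) else 0)"
      by (intro sum.cong refl) auto
    also have "\<dots> = (if i = j \<and> n \<le> i \<and> i < 2 * n then ?u else 0)" by (auto simp: sum.delta')
    finally show "ent (T * fadj T + e) i j = ent (diag (2 * n) ?u) i j" by (auto simp: e_def)
  qed
  have Te: "T * e = T"
    unfolding e_def
  proof (rule fmat_eqI)
    fix i j
    have "ent (T * diag n ?u) i j = (\<Sum>k<n. if k = j then ent T i j else 0)"
      unfolding ent_mult[OF disjI2[OF fse[unfolded e_def]]]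
      by (intro sum.cong refl) (auto simp: T(1) \<open>?u * ?u = ?u\<close>)
    also have "\<dots> = ent T i j" by (auto simp: T(1))
    finally show "ent (T * diag n ?u) i j = ent T i j" .
  qed
  have Ein: "entries_in ?S E" "fsize n E" unfolding E_def
    using sp(3)[OF p] UR by (auto intro: entries_in_ops[OF S] simp: fsP)
  have Vin: "entries_in ?S V" "fsize n V" unfolding V_def
    using UR Ein by (auto intro: entries_in_ops[OF S])
  have EE: "E * E = E" "fadj E = E" "F * F = F"
    by (simp_all add: E_def F_def algebra_simps UR sp(1)[OF p] sp(1)[OF q]
      sp(2)[OF p, unfolded fadj_single])
  have UE: "fadj U * U = E" "U * fadj U = F" using UR by (simp_all add: E_def F_def)
  have V: "fadj V * V = E" "V * fadj V = F" "V * E = V"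
  proof -
    have "fadj V * V = E * (fadj U * U) * E" by (simp add: V_def EE mult.assoc)
    thus "fadj V * V = E" by (simp add: UE EE)
    have "V * fadj V = U * (E * E) * fadj U" by (simp add: V_def EE(2) mult.assoc)
    also have "\<dots> = (U * fadj U) * (U * fadj U)" by (simp only: EE(1), simp only: UE(1)[symmetric] mult.assoc)
    finally show "V * fadj V = F" by (simp add: UE EE)
    show "V * E = V" by (simp add: V_def mult.assoc EE)
  qed
  define x where "x = R + (e - F) * fadj T + T * (e - E) + T * fadj V * fadj T"
  have u: "?P * e = ?P" "?Q * e = ?Q" "R * e = R" "V * e = V" "e * V = V"
    unfolding e_def by (rule unit; fact fsP sp(3)[OF p] sp(3)[OF q] UR(2,5) Vin)+
  have ee: "fadj e = e" "e * e = e"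
    using unit(1)[OF fse ein] by (simp_all add: e_def one_adj)
  note x = block_partial_isometry[OF TT eT Te ee u sp(2)[OF p] sp(1)[OF p] sp(2)[OF q] sp(1)[OF q]
      UR(6,7) UR(8,9,10,11) V[unfolded E_def F_def], folded E_def F_def, folded x_def]
  have e2: "e + T * fadj T = diag (2 * n) ?u" using TT' by (simp add: add.commute)
  have "fsize (2 * n) e" "fsize (2 * n) R" "fsize (2 * n) E" "fsize (2 * n) F" "fsize (2 * n) V"
    by (rule fsize_mono[of n]; simp add: fse UR Ein Vin F_def fsP)+
  hence fx: "fsize (2 * n) x" using T(2) by (simp add: x_def)
  have "entries_in ?S x" unfolding x_def F_def
    by (intro entries_in_ops[OF S] entries_in_fadj[OF S] ein Tin Ein Vin UR sp[OF q])
  moreover have "2 * n \<ge> 1" using UR(3) by simp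
  ultimately show thesis using that[OF _ fx] x unfolding e2 by blast
qed

end

section \<open>Matrix norms\<close>

context cstar_algebra
begin

lemma star_hom_emb: "star_hom A (emb A)"
  by unfold_locales (auto simp: emb_add emb_mult emb_star)

abbreviation tE :: "'a mat \<Rightarrow> ('a, 'b) amb fmat" where "tE \<equiv> place (emb A) 0"

lemma fsize_tE: "M \<in> mats A m l \<Longrightarrow> m \<le> k \<Longrightarrow> l \<le> k \<Longrightarrow> fsize k (tE M)"
  by (auto simp: fsize_def ent_place mats_def)

lemma ent_tE: "M \<in> mats A m l \<Longrightarrow> i < m \<Longrightarrow> j < l \<Longrightarrow> ent (tE M) i j = emb A (M $$ (i, j))"
  by (auto simp: ent_place mats_def)

lemma norm_ent_tE: "M \<in> mats A m l \<Longrightarrow> i < m \<Longrightarrow> j < l \<Longrightarrow> norm (ent (tE M) i j) = cnorm A (M $$ (i, j))"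
  by (simp add: ent_tE norm_emb mats_def)

lemma inj_emb: "inj_on (emb A) (carrier A)"
  by (auto intro: inj_onI emb_inj)

lemma column_norm_sq:
  assumes X: "X \<in> mats A n 1" and n: "n \<ge> 1"
  shows "(column_norm A X)\<^sup>2 = norm (\<Sum>k<n. adj (ent (tE X) k 0) * ent (tE X) k 0)"
proof -
  interpret h: star_hom A "emb A" by (rule star_hom_emb)
  let ?Y = "mmult A (mstar A X) X"
  have Y: "?Y \<in> mats A 1 1" by (rule h.mmult_mats[OF h.mstar_mats[OF X] X])
  have "emb A (?Y $$ (0, 0)) = ent (tE ?Y) 0 0" using ent_tE[OF Y] by simp
  also have "\<dots> = ent (fadj (tE X) * tE X) 0 0"
    by (simp only: h.place_mult[OF h.mstar_mats[OF X] X] h.place_mstar[OF X])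
  also have "\<dots> = (\<Sum>k<n. adj (ent (tE X) k 0) * ent (tE X) k 0)"
    using fsize_tE[OF X, of n] n by (simp add: ent_mult[of n])
  finally have "norm (\<Sum>k<n. adj (ent (tE X) k 0) * ent (tE X) k 0) = cnorm A (?Y $$ (0, 0))"
    using norm_emb[of "?Y $$ (0, 0)"] Y by (simp add: mats_def)
  moreover have "0 \<le> cnorm A (?Y $$ (0, 0))" using Y by (intro norm_nonneg) (simp add: mats_def)
  ultimately show ?thesis by (simp add: column_norm_def)
qed

lemma column_norm_nonneg:
  assumes "X \<in> mats A n 1" shows "0 \<le> column_norm A X"
proof -
  interpret h: star_hom A "emb A" by (rule star_hom_emb)
  have "mmult A (mstar A X) X \<in> mats A 1 1" by (rule h.mmult_mats[OF h.mstar_mats[OF assms] assms])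
  thus ?thesis unfolding column_norm_def by (intro real_sqrt_ge_zero norm_nonneg) (simp add: mats_def)
qed

lemma entry_le_column_norm:
  assumes X: "X \<in> mats A n 1" and k: "k < n"
  shows "cnorm A (X $$ (k, 0)) \<le> column_norm A X"
proof -
  have "(norm (ent (tE X) k 0))\<^sup>2 \<le> (column_norm A X)\<^sup>2"
    using column_norm_sq[OF X] norm_le_sum_adj_mult[of "{..<n}" k "\<lambda>k. ent (tE X) k 0"] k by simp
  hence "norm (ent (tE X) k 0) \<le> column_norm A X"
    by (rule power2_le_imp_le) (rule column_norm_nonneg[OF X])
  thus ?thesis using norm_ent_tE[OF X k] by simp
qed

lemma column_norm_le:
  assumes X: "X \<in> mats A n 1" and n: "n \<ge> 1"
  shows "column_norm A X \<le> (\<Sum>k<n. cnorm A (X $$ (k, 0)))"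
proof (rule power2_le_imp_le)
  let ?x = "\<lambda>k. norm (ent (tE X) k 0)"
  have s: "(\<Sum>k<n. cnorm A (X $$ (k, 0))) = (\<Sum>k<n. ?x k)"
    by (intro sum.cong) (simp_all add: norm_ent_tE[OF X])
  have "(column_norm A X)\<^sup>2 \<le> (\<Sum>k<n. norm (adj (ent (tE X) k 0) * ent (tE X) k 0))"
    unfolding column_norm_sq[OF X n] by (rule norm_sum)
  also have "\<dots> = (\<Sum>k<n. ?x k * ?x k)" by (simp add: norm_adj_mult power2_eq_square)
  also have "\<dots> \<le> (\<Sum>k<n. ?x k * (\<Sum>k<n. ?x k))"
    by (intro sum_mono mult_left_mono member_le_sum) auto
  also have "\<dots> = (\<Sum>k<n. ?x k)\<^sup>2" by (simp add: power2_eq_square sum_distrib_right)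
  finally show "(column_norm A X)\<^sup>2 \<le> (\<Sum>k<n. cnorm A (X $$ (k, 0)))\<^sup>2" by (simp only: s)
  show "0 \<le> (\<Sum>k<n. cnorm A (X $$ (k, 0)))" unfolding s by (simp add: sum_nonneg)
qed

lemma mmult_entry:
  assumes M: "M \<in> mats A m n" and N: "N \<in> mats A n l" and ij: "i < m" "j < l"
  shows "emb A (mmult A M N $$ (i, j)) = (\<Sum>k<n. emb A (M $$ (i, k)) * emb A (N $$ (k, j)))"
proof -
  interpret h: star_hom A "emb A" by (rule star_hom_emb)
  have "emb A (mmult A M N $$ (i, j)) = ent (tE M * tE N) i j"
    using ent_tE[OF h.mmult_mats[OF M N] ij] h.place_mult[OF M N, of 0] by simp
  also have "\<dots> = (\<Sum>k<m + n + l. ent (tE M) i k * ent (tE N) k j)"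
    using fsize_tE[OF M] by (simp add: ent_mult)
  also have "\<dots> = (\<Sum>k<n. ent (tE M) i k * ent (tE N) k j)"
    using M by (intro sum.mono_neutral_right) (auto simp: ent_place mats_def)
  also have "\<dots> = (\<Sum>k<n. emb A (M $$ (i, k)) * emb A (N $$ (k, j)))"
    by (intro sum.cong refl) (simp add: ent_tE[OF M] ent_tE[OF N] ij)
  finally show ?thesis .
qed

lemma mmult_unit_column:
  assumes M: "M \<in> mats A m n" and N: "N \<in> mats A n l" and ij: "i < m" "j < l" and k: "k < n"
    and a: "a \<in> carrier A" and col: "\<And>r. r < n \<Longrightarrow> N $$ (r, j) = (if r = k then a else \<zero>)"
  shows "mmult A M N $$ (i, j) = M $$ (i, k) \<otimes> a"
proof -
  interpret h: star_hom A "emb A" by (rule star_hom_emb)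
  have m: "M $$ (i, k) \<in> carrier A" "mmult A M N $$ (i, j) \<in> carrier A"
    using M h.mmult_mats[OF M N] ij k by (auto simp: mats_def)
  have "emb A (mmult A M N $$ (i, j)) = (\<Sum>r<n. if r = k then emb A (M $$ (i, k)) * emb A a else 0)"
    unfolding mmult_entry[OF M N ij] by (intro sum.cong) (auto simp: col)
  also have "\<dots> = emb A (M $$ (i, k) \<otimes> a)" using k a m by (simp add: emb_mult)
  finally show ?thesis using m a by (intro emb_inj) auto
qed

lemma norm_mmult_entry_le:
  assumes M: "M \<in> mats A m n" and N: "N \<in> mats A n l" and ij: "i < m" "j < l"
    and N1: "\<And>k. k < n \<Longrightarrow> cnorm A (N $$ (k, j)) \<le> 1"
  shows "cnorm A (mmult A M N $$ (i, j)) \<le> (\<Sum>k<n. cnorm A (M $$ (i, k)))"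
proof -
  interpret h: star_hom A "emb A" by (rule star_hom_emb)
  have c: "M $$ (i, k) \<in> carrier A" "N $$ (k, j) \<in> carrier A" if "k < n" for k
    using M N ij that by (auto simp: mats_def)
  have "cnorm A (mmult A M N $$ (i, j)) = norm (\<Sum>k<n. emb A (M $$ (i, k)) * emb A (N $$ (k, j)))"
    using h.mmult_mats[OF M N] ij by (simp add: mmult_entry[OF M N ij, symmetric] norm_emb mats_def)
  also have "\<dots> \<le> (\<Sum>k<n. norm (emb A (M $$ (i, k)) * emb A (N $$ (k, j))))" by (rule norm_sum)
  also have "\<dots> \<le> (\<Sum>k<n. cnorm A (M $$ (i, k)) * 1)"
  proof (rule sum_mono)
    fix k assume "k \<in> {..<n}"
    hence k: "k < n" by simp
    show "norm (emb A (M $$ (i, k)) * emb A (N $$ (k, j))) \<le> cnorm A (M $$ (i, k)) * 1"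
      using c[OF k] N1[OF k] by (intro order.trans[OF norm_mult_ineq] mult_mono) (auto simp: norm_emb norm_nonneg)
  qed
  finally show ?thesis by simp
qed

lemma matrix_alg_simps [simp]:
  "carrier (matrix_alg A n) = mats A n n" "M \<otimes>\<^bsub>matrix_alg A n\<^esub> N = mmult A M N"
  "\<one>\<^bsub>matrix_alg A n\<^esub> = mat n n (\<lambda>(i, j). if i = j then \<one> else \<zero>)" "\<zero>\<^bsub>matrix_alg A n\<^esub> = mzero A n n"
  "M \<oplus>\<^bsub>matrix_alg A n\<^esub> N = mat n n (\<lambda>(i, j). M $$ (i, j) \<oplus> N $$ (i, j))"
  "cscale (matrix_alg A n) c M = mat n n (\<lambda>(i, j). cscale A c (M $$ (i, j)))"
  "star (matrix_alg A n) M = mstar A M"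
  by (simp_all add: matrix_alg_def)

lemma cnorm_matrix_alg:
  "cnorm (matrix_alg A n) M = Sup {column_norm A (mmult A M X) | X. X \<in> mats A n 1 \<and> column_norm A X \<le> 1}"
  by (simp add: matrix_alg_def)

text \<open>A crude bound by all entries suffices. It makes the supremum in the matrix norm finite,
  and together with the bound of entries by that norm it makes norm and entrywise estimates
  interchangeable for fixed \<open>n\<close>.\<close>

lemma column_norm_mmult_le:
  assumes M: "M \<in> mats A n n" and n: "n \<ge> 1" and X: "X \<in> mats A n 1" "column_norm A X \<le> 1"
  shows "column_norm A (mmult A M X) \<le> (\<Sum>i<n. \<Sum>j<n. cnorm A (M $$ (i, j)))"
proof -
  interpret h: star_hom A "emb A" by (rule star_hom_emb)
  have "column_norm A (mmult A M X) \<le> (\<Sum>i<n. cnorm A (mmult A M X $$ (i, 0)))"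
    by (rule column_norm_le[OF h.mmult_mats[OF M X(1)] n])
  also have "\<dots> \<le> (\<Sum>i<n. \<Sum>j<n. cnorm A (M $$ (i, j)))"
    using entry_le_column_norm[OF X(1)] X(2)
    by (intro sum_mono norm_mmult_entry_le[OF M X(1)]) (auto intro: order.trans)
  finally show ?thesis .
qed

lemma zero_column: "n \<ge> 1 \<Longrightarrow> column_norm A (mzero A n 1) \<le> 1" "mzero A n 1 \<in> mats A n 1"
  using column_norm_le[of "mzero A n 1" n] by (simp_all add: mats_def mzero_def)

abbreviation mnorm :: "nat \<Rightarrow> 'a mat \<Rightarrow> real" where "mnorm n \<equiv> cnorm (matrix_alg A n)"

lemma matrix_norm_le:
  assumes M: "M \<in> mats A n n" and n: "n \<ge> 1"
  shows "mnorm n M \<le> (\<Sum>i<n. \<Sum>j<n. cnorm A (M $$ (i, j)))"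
  unfolding cnorm_matrix_alg using column_norm_mmult_le[OF M n] zero_column(1)[OF n] zero_column(2)[of n]
  by (intro cSup_least) auto

lemma matrix_norm_ge:
  assumes M: "M \<in> mats A n n" and n: "n \<ge> 1" and X: "X \<in> mats A n 1" "column_norm A X \<le> 1"
  shows "column_norm A (mmult A M X) \<le> mnorm n M"
  unfolding cnorm_matrix_alg
proof (rule cSup_upper)
  show "bdd_above {column_norm A (mmult A M X) | X. X \<in> mats A n 1 \<and> column_norm A X \<le> 1}"
    using column_norm_mmult_le[OF M n] by (auto intro!: bdd_aboveI)
qed (use X in blast)

text \<open>The column with \<open>a\<close> in row \<open>j\<close> and zeros elsewhere isolates
  one entry of the matrix.\<close>

lemma matrix_entry_act_le:
  assumes M: "M \<in> mats A n n" and n: "n \<ge> 1" and ij: "i < n" "j < n"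
    and a: "a \<in> carrier A" "cnorm A a \<le> 1"
  shows "cnorm A (M $$ (i, j) \<otimes> a) \<le> mnorm n M"
proof -
  interpret h: star_hom A "emb A" by (rule star_hom_emb)
  define X where "X = mat n 1 (\<lambda>(k, _). if k = j then a else \<zero>)"
  have X: "X \<in> mats A n 1" using a by (auto simp: X_def mats_def)
  have "column_norm A X \<le> (\<Sum>k<n. cnorm A (X $$ (k, 0)))" by (rule column_norm_le[OF X n])
  also have "\<dots> = (\<Sum>k<n. if k = j then cnorm A a else 0)" by (intro sum.cong) (auto simp: X_def)
  also have "\<dots> \<le> 1" using ij a by simp
  finally have X1: "column_norm A X \<le> 1" .
  have "mmult A M X $$ (i, 0) = M $$ (i, j) \<otimes> a"
    by (rule mmult_unit_column[OF M X ij(1) _ ij(2) a(1)]) (auto simp: X_def)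
  hence "cnorm A (M $$ (i, j) \<otimes> a) \<le> column_norm A (mmult A M X)"
    using entry_le_column_norm[OF h.mmult_mats[OF M X] ij(1)] by simp
  also have "\<dots> \<le> mnorm n M" by (rule matrix_norm_ge[OF M n X X1])
  finally show ?thesis .
qed

lemma matrix_norm_nonneg: "M \<in> mats A n n \<Longrightarrow> n \<ge> 1 \<Longrightarrow> 0 \<le> mnorm n M"
  using matrix_norm_ge[OF _ _ zero_column(2,1)] column_norm_nonneg zero_column
    star_hom.mmult_mats[OF star_hom_emb] by (meson order.trans)

lemma matrix_entry_norm_le:
  assumes M: "M \<in> mats A n n" and n: "n \<ge> 1" and ij: "i < n" "j < n"
  shows "cnorm A (M $$ (i, j)) \<le> mnorm n M"
proof -
  have m: "M $$ (i, j) \<in> carrier A" using M ij by (simp add: mats_def)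
  have "norm (emb A (M $$ (i, j)) + cc 0) \<le> mnorm n M"
    using matrix_entry_act_le[OF M n ij] matrix_norm_nonneg[OF M n] m
    by (intro norm_emb_add_cc_le) (auto simp: act_def)
  thus ?thesis by (simp add: norm_emb m)
qed

section \<open>Closedness of the embedded algebra and bounds for scalar parts\<close>

abbreviation IA :: "('a, 'b) amb set" where "IA \<equiv> emb A ` carrier A"

text \<open>An isometric image of a complete space is closed. This brings sums of series formed in
  the ambient algebra back to \<open>A\<close>.\<close>

lemma emb_closed:
  assumes X: "\<And>n. X n \<in> carrier A" and lim: "(\<lambda>n. emb A (X n)) \<longlonglongrightarrow> L"
  shows "L \<in> IA"
proof -
  have d: "cnorm A (X m \<ominus> x) = norm (emb A (X m) - emb A x)" if "x \<in> carrier A" for m x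
  proof -
    have "emb A (X m \<ominus> x) + emb A x = emb A (X m)"
      using X that by (simp flip: emb_add add: minus_eq a_assoc l_neg)
    hence "emb A (X m) - emb A x = emb A (X m \<ominus> x)" by (simp add: algebra_simps)
    thus ?thesis using X that by (simp add: norm_emb)
  qed
  have "Cauchy (\<lambda>n. emb A (X n))" using lim by (rule LIMSEQ_imp_Cauchy)
  hence "\<exists>N. \<forall>m\<ge>N. \<forall>n\<ge>N. cnorm A (X m \<ominus> X n) < e" if "e > 0" for e
    using that X by (simp add: Cauchy_def dist_norm d)
  then obtain x where x: "x \<in> carrier A" "(\<lambda>n. cnorm A (X n \<ominus> x)) \<longlonglongrightarrow> 0"
    using complete[of X] X by blast
  hence "(\<lambda>n. emb A (X n)) \<longlonglongrightarrow> emb A x"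
    using tendsto_norm_zero_iff[of "\<lambda>n. emb A (X n) - emb A x"] LIM_zero_iff by (fastforce simp: d)
  thus ?thesis using x lim LIMSEQ_unique by blast
qed

text \<open>If a non-unital \<open>A\<close> had \<open>m\<close>, \<open>c\<close> with \<open>m + c\<close> of norm less than \<open>\<bar>c\<bar>\<close> on \<open>A\<close>, then
  \<open>1 - e\<close> with \<open>e = - m / c\<close> would be a strict contraction of \<open>A\<close>, and the geometric series
  \<open>\<Sum>k. (1 - e)\<^sup>k e\<close> would be an identity of \<open>A\<close>.\<close>

lemma scalar_le_of_act:
  assumes nu: "\<not> unital A" and m: "m \<in> carrier A" and M: "M \<ge> 0"
    and act: "\<And>x. x \<in> carrier A \<Longrightarrow> cnorm A x \<le> 1 \<Longrightarrow> cnorm A (act m c x) \<le> M"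
  shows "cmod c \<le> M"
proof (rule ccontr)
  assume "\<not> cmod c \<le> M"
  hence c: "cmod c > M" "c \<noteq> 0" using M by auto
  have act': "cnorm A (act m c x) \<le> M * cnorm A x" if x: "x \<in> carrier A" for x
  proof (cases "cnorm A x = 0")
    case True
    thus ?thesis using norm_act_le[OF m x, of c] by simp
  next
    case False
    hence n: "cnorm A x > 0" using norm_nonneg[OF x] by simp
    have "cnorm A (act m c (cscale A (of_real (inverse (cnorm A x))) x)) \<le> M"
      using x n by (intro act) (auto simp: norm_scale norm_inverse)
    hence "inverse (cnorm A x) * cnorm A (act m c x) \<le> M"
      using x n m by (simp add: act_scale_right norm_scale norm_inverse)
    thus ?thesis using n by (simp add: field_simps)
  qed
  define e where "e = cscale A (- 1 / c) m"
  have e: "e \<in> carrier A" using m by (simp add: e_def)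
  define r where "r = M / cmod c"
  have r: "0 \<le> r" "r < 1" using c M by (auto simp: r_def)
  define u where "u = 1 - emb A e"
  have u: "u = cc (1 / c) * (emb A m + cc c)"
  proof -
    have "cc (1 / c) * cc c = (cc (1 / c * c) :: ('a, 'b) amb)" by (simp only: cc_mult)
    moreover have "cc (- 1 / c) + cc (1 / c) = (cc (- 1 / c + 1 / c) :: ('a, 'b) amb)" by (simp only: cc_add)
    hence "cc (- 1 / c) = - (cc (1 / c) :: ('a, 'b) amb)" by (simp add: eq_neg_iff_add_eq_0)
    ultimately show ?thesis using c m by (simp add: u_def e_def emb_scale distrib_left)
  qed
  have contr: "\<exists>y\<in>carrier A. u * emb A x = emb A y \<and> norm (u * emb A x) \<le> r * norm (emb A x)"
    if x: "x \<in> carrier A" for x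
  proof -
    have "(emb A m + cc c) * emb A x = emb A (act m c x)"
      using x m by (simp add: act_def distrib_right emb_add emb_mult emb_scale)
    hence 1: "u * emb A x = emb A (cscale A (1 / c) (act m c x))"
      using x m by (simp add: u mult.assoc emb_scale)
    moreover have "norm (u * emb A x) = cnorm A (act m c x) / cmod c"
      unfolding 1 using x m by (simp add: norm_emb norm_scale norm_divide)
    moreover have "\<dots> \<le> r * cnorm A x"
      using act'[OF x] c M by (simp add: r_def divide_right_mono)
    ultimately show ?thesis using x m by (auto simp: norm_emb)
  qed
  have pw: "\<exists>y\<in>carrier A. u ^ k * emb A e = emb A y \<and> norm (u ^ k * emb A e) \<le> r ^ k * norm (emb A e)" for k
  proof (induction k)
    case (Suc k)
    then obtain y where y: "y \<in> carrier A" "u ^ k * emb A e = emb A y" "norm (u ^ k * emb A e) \<le> r ^ k * norm (emb A e)"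
      by blast
    obtain z where z: "z \<in> carrier A" "u * emb A y = emb A z" "norm (u * emb A y) \<le> r * norm (emb A y)"
      using contr[OF y(1)] by blast
    have "u ^ Suc k * emb A e = u * emb A y" using y(2) by (simp add: mult.assoc)
    moreover have "r * norm (emb A y) \<le> r * (r ^ k * norm (emb A e))"
      using y r by (intro mult_left_mono) auto
    ultimately show ?case using z by (intro bexI[of _ z]) auto
  qed (use e in auto)
  have sm: "summable (\<lambda>k. u ^ k * emb A e)"
    by (rule summable_comparison_test'[where N = 0 and g = "\<lambda>k. r ^ k * norm (emb A e)"])
      (use r pw in \<open>auto intro!: summable_mult2 summable_geometric\<close>)
  define F where "F = (\<Sum>k. u ^ k * emb A e)"
  have "\<exists>y\<in>carrier A. (\<Sum>k<n. u ^ k * emb A e) = emb A y" for n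
  proof (induction n)
    case (Suc n)
    thus ?case using pw[of n] by (auto simp flip: emb_add)
  qed (use emb_zero in \<open>auto intro!: bexI[of _ \<zero>]\<close>)
  then obtain X where X: "\<And>n. X n \<in> carrier A" "\<And>n. (\<Sum>k<n. u ^ k * emb A e) = emb A (X n)" by metis
  have "(\<lambda>n. emb A (X n)) \<longlonglongrightarrow> F"
    using summable_LIMSEQ[OF sm] by (simp add: F_def X(2))
  then obtain f where f: "f \<in> carrier A" "F = emb A f" using emb_closed[of X F] X(1) by blast
  have "F = emb A e + (\<Sum>k. u ^ Suc k * emb A e)"
    unfolding F_def using suminf_split_head[OF sm] by simp
  also have "(\<Sum>k. u ^ Suc k * emb A e) = u * F"
    unfolding F_def suminf_mult[OF sm, symmetric] by (simp add: mult.assoc)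
  \<comment> \<open>\<open>F = e + (1 - e) F\<close> collapses to \<open>e F = e\<close>.\<close>
  finally have eF: "emb A e * F = emb A e" by (simp add: u_def left_diff_distrib)
  have left: "f \<otimes> x = x" if x: "x \<in> carrier A" for x
  proof -
    \<comment> \<open>\<open>e\<close> annihilates \<open>f \<otimes> x \<ominus> x\<close>, so this
      element is fixed by \<open>u\<close>. Since \<open>u\<close> is a strict contraction on
      \<open>A\<close>, it is 0.\<close>
    define y where "y = f \<otimes> x \<ominus> x"
    have y: "y \<in> carrier A" using x f by (simp add: y_def)
    have "emb A y + emb A x = F * emb A x"
      using x f by (simp flip: emb_add emb_mult add: y_def minus_eq a_assoc l_neg)
    hence ey: "emb A y = F * emb A x - emb A x" by (simp add: algebra_simps)
    have "emb A e * emb A y = 0" by (simp add: ey right_diff_distrib eF flip: mult.assoc)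
    hence "u * emb A y = emb A y" by (simp add: u_def left_diff_distrib)
    hence "norm (emb A y) \<le> r * norm (emb A y)" using contr[OF y] by auto
    hence "norm (emb A y) * (1 - r) \<le> 0" by (simp add: algebra_simps)
    hence "emb A y = 0" using r by (simp add: mult_le_0_iff)
    thus ?thesis using ey x f by (metis emb_inj emb_mult eq_iff_diff_eq_0 mult_closed)
  qed
  have right: "x \<otimes> star A f = x" if x: "x \<in> carrier A" for x
  proof -
    have "star A (f \<otimes> star A x) = x" using left[of "star A x"] x by (simp add: star_star)
    thus ?thesis using x f by (simp add: star_mult star_star)
  qed
  have "f = star A f" using left[of "star A f"] right[of f] f by simp
  hence "unital A" unfolding unital_def using left right f by (intro bexI[of _ f]) auto
  thus False using nu by contradiction
qed

end

section \<open>The unitization of a matrix algebra\<close>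

lemma cnorm_tilde: "cnorm (tilde R) (M, c) = (if unital R then cnorm R M else
    Sup {cnorm R (M \<otimes>\<^bsub>R\<^esub> X \<oplus>\<^bsub>R\<^esub> cscale R c X) | X. X \<in> carrier R \<and> cnorm R X \<le> 1})"
  by (simp add: tilde_def unitization_def)

lemma diag_ops:
  fixes a b :: "'z::ring"
  shows "diag n (a + b) = diag n a + diag n b" "diag n (a * b) = diag n a * diag n b" "diag n (0 :: 'z) = 0"
proof -
  show "diag n (a + b) = diag n a + diag n b" "diag n (0 :: 'z) = 0" by (auto intro!: fmat_eqI)
  have "ent (diag n a * diag n b) i j = (\<Sum>k<n. (if i = k then (if i = j \<and> i < n then a * b else 0) else 0))" for i j
    unfolding ent_mult[OF disjI1[OF fsize_diag[OF order.refl]]] ent_diag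
    by (intro sum.cong refl) auto
  thus "diag n (a * b) = diag n a * diag n b" by (intro fmat_eqI) auto
qed

context cstar_algebra
begin

abbreviation madd :: "nat \<Rightarrow> 'a mat \<Rightarrow> 'a mat \<Rightarrow> 'a mat" where
  "madd n M N \<equiv> mat n n (\<lambda>(i, j). M $$ (i, j) \<oplus> N $$ (i, j))"
abbreviation mscale :: "nat \<Rightarrow> complex \<Rightarrow> 'a mat \<Rightarrow> 'a mat" where
  "mscale n c M \<equiv> mat n n (\<lambda>(i, j). cscale A c (M $$ (i, j)))"
abbreviation msingle :: "nat \<Rightarrow> 'a \<Rightarrow> 'a mat" where
  "msingle n a \<equiv> mat n n (\<lambda>(i, j). if i = 0 \<and> j = 0 then a else \<zero>)"

lemma mats_ops:
  assumes "M \<in> mats A n n" "N \<in> mats A n n"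
  shows "madd n M N \<in> mats A n n" "mscale n c M \<in> mats A n n" "mmult A M N \<in> mats A n n"
proof -
  interpret h: star_hom A "emb A" by (rule star_hom_emb)
  show "madd n M N \<in> mats A n n" "mscale n c M \<in> mats A n n" using assms by (auto simp: mats_def)
  show "mmult A M N \<in> mats A n n" by (rule h.mmult_mats[OF assms])
qed

lemma tE_ops:
  assumes "M \<in> mats A n n" "N \<in> mats A n n"
  shows "tE (madd n M N) = tE M + tE N" "tE (mscale n c M) = diag n (cc c) * tE M"
    "tE (mscale n c M) = tE M * diag n (cc c)" "tE (mmult A M N) = tE M * tE N"
proof -
  interpret h: star_hom A "emb A" by (rule star_hom_emb)
  have fM: "fsize n (tE M)" using fsize_tE[OF assms(1)] by simp
  have if_mult: "(if P then a else 0) * b = (if P then a * b else 0)" "b * (if P then a else 0) = (if P then b * a else 0)"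
    "(if P \<and> Q then b else 0) = (if P then if Q then b else 0 else 0)"
    for P Q and a b :: "('a, 'b) amb" by auto
  show "tE (madd n M N) = tE M + tE N"
    by (rule fmat_eqI) (use assms in \<open>auto simp: ent_place mats_def emb_add\<close>)
  have "ent (diag n (cc c) * tE M) i j = cc c * ent (tE M) i j" for i j
    unfolding ent_mult[OF disjI2[OF fM]] ent_diag if_mult using fM by (auto simp: sum.delta fsizeD)
  moreover have "ent (tE (mscale n c M)) i j = cc c * ent (tE M) i j" for i j
    using assms by (auto simp: ent_place mats_def emb_scale)
  ultimately show *: "tE (mscale n c M) = diag n (cc c) * tE M" by (intro fmat_eqI) simp
  have "ent (tE M * diag n (cc c)) i j = ent (tE M) i j * cc c" for i j
    unfolding ent_mult[OF disjI1[OF fM]] ent_diag if_mult using fM by (auto simp: sum.delta sum.delta' fsizeD)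
  hence "diag n (cc c) * tE M = tE M * diag n (cc c)"
    using \<open>\<And>i j. ent (diag n (cc c) * tE M) i j = cc c * ent (tE M) i j\<close>
    by (intro fmat_eqI) (simp only: cc_commute)
  thus "tE (mscale n c M) = tE M * diag n (cc c)" by (simp only: *)
  show "tE (mmult A M N) = tE M * tE N" by (rule h.place_mult[OF assms])
qed

lemma msingle:
  assumes "a \<in> carrier A" "n \<ge> 1"
  shows "msingle n a \<in> mats A n n" "tE (msingle n a) = esingle a"
proof -
  show "msingle n a \<in> mats A n n" using assms by (auto simp: mats_def)
  show "tE (msingle n a) = esingle a" by (rule fmat_eqI) (use assms in \<open>auto simp: ent_place\<close>)
qed

lemma tE_one: "tE (mat n n (\<lambda>(i, j). if i = j then \<one> else \<zero>)) = diag n (emb A \<one>)"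
  by (rule fmat_eqI) (auto simp: ent_place)

text \<open>\<open>BB n\<close> branches on unitality of the matrix algebra, \<open>tilde A\<close>
  on that of \<open>A\<close>; the two case distinctions have to agree. The corner entry of an
  identity matrix serves as the identity of \<open>A\<close>.\<close>

lemma unital_matrix_alg:
  assumes n: "n \<ge> 1" shows "unital (matrix_alg A n) \<longleftrightarrow> unital A"
proof
  assume u: "unital A"
  let ?I = "mat n n (\<lambda>(i, j). if i = j then \<one> else \<zero>)"
  have one: "\<one> \<in> carrier A" "\<And>x. x \<in> carrier A \<Longrightarrow> \<one> \<otimes> x = x \<and> x \<otimes> \<one> = x"
    using one_is_identity[OF u] by auto
  have I: "?I \<in> mats A n n" using one by (auto simp: mats_def)
  have "mmult A ?I M = M \<and> mmult A M ?I = M" if M: "M \<in> mats A n n" for M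
  proof -
    have e: "emb A \<one> * ent (tE M) i j = ent (tE M) i j" "ent (tE M) i j * emb A \<one> = ent (tE M) i j" for i j
      using M one by (auto simp: ent_place mats_def simp flip: emb_mult)
    have "tE (mmult A ?I M) = tE M" "tE (mmult A M ?I) = tE M"
      using fsize_tE[OF M, of n] e
      by (simp_all add: tE_ops(4)[OF I M] tE_ops(4)[OF M I] tE_one diag_mult)
    thus ?thesis using place_inj[OF inj_emb] mats_ops(3)[OF I M] mats_ops(3)[OF M I] M by blast
  qed
  thus "unital (matrix_alg A n)" using I unfolding unital_def by auto
next
  assume "unital (matrix_alg A n)"
  then obtain I where I: "I \<in> mats A n n" "\<And>M. M \<in> mats A n n \<Longrightarrow> mmult A I M = M \<and> mmult A M I = M"
    by (auto simp: unital_def)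
  let ?e = "I $$ (0, 0)"
  have e: "?e \<in> carrier A" using I(1) n by (auto simp: mats_def)
  have e': "ent (tE I) 0 0 = emb A ?e" using ent_tE[OF I(1)] n by simp
  have "?e \<otimes> a = a \<and> a \<otimes> ?e = a" if a: "a \<in> carrier A" for a
  proof -
    note s = msingle[OF a n]
    have "tE I * esingle a = esingle a" "esingle a * tE I = esingle a"
      using I(2)[OF s(1)] tE_ops(4)[OF I(1) s(1)] tE_ops(4)[OF s(1) I(1)] by (auto simp: s(2))
    hence "ent (tE I * esingle a) 0 0 = emb A a" "ent (esingle a * tE I) 0 0 = emb A a" by simp_all
    hence "emb A (?e \<otimes> a) = emb A a" "emb A (a \<otimes> ?e) = emb A a"
      using e a by (simp_all add: ent_mult[of 1] fsize_single e' emb_mult)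
    thus ?thesis using emb_inj e a by auto
  qed
  thus "unital A" using e unfolding unital_def by auto
qed

text \<open>The unitization of the \<open>n \<times> n\<close> matrix algebra, as matrices over the ambient algebra.\<close>

definition iota :: "nat \<Rightarrow> 'a mat \<times> complex \<Rightarrow> ('a, 'b) amb fmat" where
  "iota n = (\<lambda>(M, c). tE M + diag n (cc c))"

abbreviation BB :: "nat \<Rightarrow> ('a mat \<times> complex) cstar" where "BB n \<equiv> tilde (matrix_alg A n)"

lemma carrier_BB: "n \<ge> 1 \<Longrightarrow> carrier (BB n) = mats A n n \<times> (if unital A then {0} else UNIV)"
  by (simp add: carrier_tilde unital_matrix_alg)

lemma iota_add:
  assumes "M \<in> mats A n n" "N \<in> mats A n n"
  shows "iota n (madd n M N, c + d) = iota n (M, c) + iota n (N, d)"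
  using assms by (simp add: iota_def tE_ops cc_add diag_ops)

lemma iota_mult:
  assumes M: "M \<in> mats A n n" and N: "N \<in> mats A n n"
  shows "iota n (madd n (madd n (mmult A M N) (mscale n d M)) (mscale n c N), c * d) = iota n (M, c) * iota n (N, d)"
proof -
  have m: "mmult A M N \<in> mats A n n" "mscale n d M \<in> mats A n n" "mscale n c N \<in> mats A n n"
    by (rule mats_ops[OF M N], rule mats_ops(2)[OF M N], rule mats_ops(2)[OF N M])
  have "tE (madd n (madd n (mmult A M N) (mscale n d M)) (mscale n c N)) =
      tE M * tE N + tE M * diag n (cc d) + diag n (cc c) * tE N"
    unfolding tE_ops(1)[OF mats_ops(1)[OF m(1,2)] m(3)] tE_ops(1)[OF m(1,2)] tE_ops(4)[OF M N]
      tE_ops(3)[OF M M] tE_ops(2)[OF N N] ..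
  thus ?thesis by (simp add: iota_def cc_mult diag_ops algebra_simps)
qed

lemma iota_inj:
  assumes n: "n \<ge> 1" shows "inj_on (iota n) (mats A n n \<times> UNIV)"
proof (rule inj_onI, clarify)
  fix M N c d assume MN: "M \<in> mats A n n" "N \<in> mats A n n" and eq: "iota n (M, c) = iota n (N, d)"
  have spt: "spt (ent (iota n (M, c)) 0 0) = c" if "M \<in> mats A n n" for M c
    using that n by (auto simp: iota_def ent_place)
  have "c = d" using spt[OF MN(1), of c] spt[OF MN(2), of d] eq by simp
  moreover from this have "M = N" using eq place_inj[OF inj_emb MN(1) MN(2)] by (simp add: iota_def)
  ultimately show "M = N \<and> c = d" by simp
qed

abbreviation eB :: "nat \<Rightarrow> ('a, 'b) amb fmat" where "eB n \<equiv> iota n \<one>\<^bsub>BB n\<^esub>"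

text \<open>In both cases of the unitization the identity becomes the diagonal matrix of
  \<open>eA\<close>, the same one that occurs in the relations of the partial isometry obtained from
  \<open>K0\<close>.\<close>

lemma iota_one: assumes "n \<ge> 1" shows "eB n = diag n (eA)"
proof -
  interpret h: star_hom A "emb A" by (rule star_hom_emb)
  show ?thesis using assms
    by (simp add: one_tilde iota_def phi_def tE_one unital_matrix_alg diag_ops)
qed

lemma one_BB: assumes "n \<ge> 1" shows "\<one>\<^bsub>BB n\<^esub> \<in> carrier (BB n)"
  using assms one_is_identity
  by (auto simp: carrier_BB one_tilde unital_matrix_alg mats_def mzero_def)

lemma fsize_iota: "b \<in> mats A n n \<times> UNIV \<Longrightarrow> fsize n (iota n b)"
  by (cases b) (simp add: iota_def fsize_tE fsize_diag)

lemma iota_one_mult: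
  assumes n: "n \<ge> 1" and b: "b \<in> carrier (BB n)"
  shows "eB n * iota n b = iota n b" "iota n b * eB n = iota n b"
proof -
  have fs: "fsize n (iota n b)" using b n by (intro fsize_iota) (auto simp: carrier_BB)
  obtain M c where bM: "b = (M, c)" "M \<in> mats A n n" "unital A \<Longrightarrow> c = 0"
    using b n by (auto simp: carrier_BB split: if_splits)
  have "eA * ent (iota n b) i j = ent (iota n b) i j \<and>
      ent (iota n b) i j * eA = ent (iota n b) i j" for i j
  proof (cases "i < n \<and> j < n")
    case True
    hence "ent (iota n b) i j = phi (M $$ (i, j), if i = j then c else 0)"
      using bM ent_tE[OF bM(2), of i j] by (simp add: iota_def phi_def)
    moreover have "(M $$ (i, j), if i = j then c else 0) \<in> carrier (tilde A)"
      using bM True by (auto simp: carrier_tilde mats_def)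
    ultimately show ?thesis using phi_one by simp
  next
    case False
    thus ?thesis using fsizeD[OF fs, of i j] by auto
  qed
  thus "eB n * iota n b = iota n b" "iota n b * eB n = iota n b"
    unfolding iota_one[OF n] using diag_mult[OF fs] by blast+
qed

lemma iota_hom:
  assumes n: "n \<ge> 1" and x: "x \<in> carrier (BB n)" and y: "y \<in> carrier (BB n)"
  shows "x \<oplus>\<^bsub>BB n\<^esub> y \<in> carrier (BB n)" "x \<otimes>\<^bsub>BB n\<^esub> y \<in> carrier (BB n)"
    "iota n (x \<oplus>\<^bsub>BB n\<^esub> y) = iota n x + iota n y" "iota n (x \<otimes>\<^bsub>BB n\<^esub> y) = iota n x * iota n y"
proof -
  obtain M c N d where xy: "x = (M, c)" "y = (N, d)" by fastforce
  have M: "M \<in> mats A n n" and N: "N \<in> mats A n n" using x y xy n by (auto simp: carrier_BB)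
  have m: "mmult A M N \<in> mats A n n" "mscale n d M \<in> mats A n n" "mscale n c N \<in> mats A n n"
    by (rule mats_ops[OF M N], rule mats_ops(2)[OF M N], rule mats_ops(2)[OF N M])
  note mm = mats_ops(1)[OF mats_ops(1)[OF m(1,2)] m(3)]
  show "x \<oplus>\<^bsub>BB n\<^esub> y \<in> carrier (BB n)" "x \<otimes>\<^bsub>BB n\<^esub> y \<in> carrier (BB n)"
    using x y n mats_ops(1)[OF M N] mm by (auto simp: xy carrier_BB simp del: index_mat)
  show "iota n (x \<oplus>\<^bsub>BB n\<^esub> y) = iota n x + iota n y"
    using iota_add[OF M N] by (simp add: xy)
  show "iota n (x \<otimes>\<^bsub>BB n\<^esub> y) = iota n x * iota n y"
    using iota_mult[OF M N] by (simp only: xy tilde_simps matrix_alg_simps)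
qed

lemma ring_BB: assumes n: "n \<ge> 1" shows "ring (BB n)"
proof (rule ring_of_embedding[of _ "iota n"])
  have "mzero A n n \<in> mats A n n" by (simp add: mats_def mzero_def)
  thus "\<zero>\<^bsub>BB n\<^esub> \<in> carrier (BB n)" using n by (simp add: carrier_BB)
  show "\<one>\<^bsub>BB n\<^esub> \<in> carrier (BB n)" by (rule one_BB[OF n])
  show "inj_on (iota n) (carrier (BB n))"
    by (rule inj_on_subset[OF iota_inj[OF n]]) (use n in \<open>auto simp: carrier_BB\<close>)
  interpret h: star_hom A "emb A" by (rule star_hom_emb)
  show "iota n \<zero>\<^bsub>BB n\<^esub> = 0" by (simp add: iota_def diag_ops)
  fix x assume x: "x \<in> carrier (BB n)"
  obtain M c where xM: "x = (M, c)" "M \<in> mats A n n" using x n by (auto simp: carrier_BB)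
  have "tE (mscale n (- 1) M) = - tE M"
  proof (rule fmat_eqI)
    have neg: "emb A (\<ominus> a) = - emb A a" if "a \<in> carrier A" for a
      using emb_add[of "\<ominus> a" a] that by (simp add: l_neg eq_neg_iff_add_eq_0)
    fix i j show "ent (tE (mscale n (- 1) M)) i j = ent (- tE M) i j"
      using xM(2) by (auto simp: ent_place mats_def neg)
  qed
  moreover have "diag n (cc (- c)) = - diag n (cc c :: ('a, 'b) amb)"
    using diag_ops(1)[of n "cc (- c) :: ('a, 'b) amb" "cc c"] by (simp add: diag_ops eq_neg_iff_add_eq_0 flip: cc_add)
  ultimately have "iota n (mscale n (- 1) M, - c) = - iota n x" by (simp add: iota_def xM)
  moreover have "(mscale n (- 1) M, - c) \<in> carrier (BB n)"
    using x xM n mats_ops(2)[OF xM(2) xM(2), of "- 1"] by (auto simp: carrier_BB split: if_splits)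
  ultimately show "\<exists>y\<in>carrier (BB n). iota n y = - iota n x" by blast
qed (use iota_hom[OF n] iota_one_mult[OF n] in auto)

text \<open>A test matrix with \<open>a\<close> in row \<open>j\<close> of its first column isolates
  the action of the entry at \<open>(i, j)\<close>, including the scalar on the diagonal. The
  ambient norm also sees the scalar by itself, and \<open>cmod c\<close> is bounded through
  \<open>scalar_le_of_act\<close>.\<close>

lemma norm_ent_iota_le:
  assumes n: "n \<ge> 1" and b: "b \<in> carrier (BB n)"
  shows "norm (ent (iota n b) i j) \<le> cnorm (BB n) b"
proof -
  obtain M c where bM: "b = (M, c)" "M \<in> mats A n n" "unital A \<Longrightarrow> c = 0"
    using b n by (auto simp: carrier_BB split: if_splits)
  let ?N = "cnorm (BB n) b"
  let ?Y = "\<lambda>X. madd n (mmult A M X) (mscale n c X)"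
  have Y: "?Y X \<in> mats A n n" if "X \<in> mats A n n" for X
    by (rule mats_ops(1)[OF mats_ops(3)[OF bM(2) that] mats_ops(2)[OF that that]])
  \<comment> \<open>Finiteness of the supremum defining the norm on the unitization, on which the
    comparison of single test matrices with it rests.\<close>
  have bound: "mnorm n (?Y X) \<le> (\<Sum>i<n. \<Sum>j<n. (\<Sum>k<n. cnorm A (M $$ (i, k))) + cmod c)"
    if X: "X \<in> mats A n n" "mnorm n X \<le> 1" for X
  proof -
    have "mnorm n (?Y X) \<le> (\<Sum>i<n. \<Sum>j<n. cnorm A (?Y X $$ (i, j)))"
      by (rule matrix_norm_le[OF Y[OF X(1)] n])
    also have "\<dots> \<le> (\<Sum>i<n. \<Sum>j<n. (\<Sum>k<n. cnorm A (M $$ (i, k))) + cmod c)"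
    proof (intro sum_mono)
      fix i j assume "i \<in> {..<n}" "j \<in> {..<n}"
      hence ij: "i < n" "j < n" by auto
      have e: "cnorm A (X $$ (i, j)) \<le> 1" if "i < n" "j < n" for i j
        using matrix_entry_norm_le[OF X(1) n that] X(2) by simp
      have c: "mmult A M X $$ (i, j) \<in> carrier A" "X $$ (i, j) \<in> carrier A"
        using mats_ops(3)[OF bM(2) X(1)] X(1) ij by (auto simp: mats_def)
      have "cnorm A (?Y X $$ (i, j)) \<le> cnorm A (mmult A M X $$ (i, j)) + cnorm A (cscale A c (X $$ (i, j)))"
        using ij c by (simp add: norm_triangle)
      also have "\<dots> \<le> (\<Sum>k<n. cnorm A (M $$ (i, k))) + cmod c * 1"
      proof (rule add_mono[OF norm_mmult_entry_le[OF bM(2) X(1) ij]])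
        show "cnorm A (X $$ (k, j)) \<le> 1" if "k < n" for k using e[OF that ij(2)] .
        show "cnorm A (cscale A c (X $$ (i, j))) \<le> cmod c * 1"
          unfolding norm_scale[OF c(2)] by (rule mult_left_mono[OF e[OF ij]]) simp
      qed
      finally show "cnorm A (?Y X $$ (i, j)) \<le> (\<Sum>k<n. cnorm A (M $$ (i, k))) + cmod c" by simp
    qed
    finally show ?thesis .
  qed
  have key: "cnorm A (act (M $$ (i, j)) (if i = j then c else 0) a) \<le> ?N"
    if ij: "i < n" "j < n" and a: "a \<in> carrier A" "cnorm A a \<le> 1" for i j a
  proof (cases "unital A")
    case True
    hence N: "?N = mnorm n M" using bM n by (simp add: cnorm_tilde unital_matrix_alg)
    have "M $$ (i, j) \<in> carrier A" using bM(2) ij by (simp add: mats_def)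
    hence "act (M $$ (i, j)) (if i = j then c else 0) a = M $$ (i, j) \<otimes> a"
      using bM(3)[OF True] a by (simp only: act_def if_cancel) simp
    thus ?thesis using matrix_entry_act_le[OF bM(2) n ij a] by (simp only: N)
  next
    case False
    define X where "X = mat n n (\<lambda>(k, l). if k = j \<and> l = 0 then a else \<zero>)"
    have X: "X \<in> mats A n n" using a by (auto simp: X_def mats_def)
    have "mnorm n X \<le> (\<Sum>k<n. \<Sum>l<n. cnorm A (X $$ (k, l)))" by (rule matrix_norm_le[OF X n])
    also have "\<dots> = (\<Sum>k<n. \<Sum>l<n. if l = 0 then (if k = j then cnorm A a else 0) else 0)"
      by (intro sum.cong) (auto simp: X_def)
    also have "\<dots> \<le> 1" using ij a n by simp
    finally have X1: "mnorm n X \<le> 1" .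
    have "mmult A M X $$ (i, 0) = M $$ (i, j) \<otimes> a"
      by (rule mmult_unit_column[OF bM(2) X ij(1) _ ij(2) a(1)]) (use n in \<open>auto simp: X_def\<close>)
    moreover have "M $$ (i, j) \<in> carrier A" using bM(2) ij by (simp add: mats_def)
    ultimately have eq: "?Y X $$ (i, 0) = act (M $$ (i, j)) (if i = j then c else 0) a"
      using ij n a by (simp add: act_def X_def)
    have "cnorm A (?Y X $$ (i, 0)) \<le> mnorm n (?Y X)"
      by (rule matrix_entry_norm_le[OF Y[OF X] n]) (use ij n in auto)
    also have "\<dots> \<le> Sup {mnorm n (?Y X) | X. X \<in> mats A n n \<and> mnorm n X \<le> 1}"
    proof (rule cSup_upper)
      show "bdd_above {mnorm n (?Y X) | X. X \<in> mats A n n \<and> mnorm n X \<le> 1}"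
        using bound by (auto intro!: bdd_aboveI)
    qed (use X X1 in blast)
    also have "\<dots> = ?N" using False n by (simp add: bM cnorm_tilde unital_matrix_alg)
    finally show ?thesis by (simp only: eq)
  qed
  have N0: "0 \<le> ?N"
    using key[of 0 0 \<zero>] n bM(2) by (auto simp: act_def mats_def)
  have c_le: "cmod c \<le> ?N"
  proof (cases "unital A")
    case False
    show ?thesis by (rule scalar_le_of_act[OF False _ N0, of "M $$ (0, 0)"])
      (use key[of 0 0] n bM(2) in \<open>auto simp: mats_def\<close>)
  qed (use bM N0 in simp)
  show ?thesis
  proof (cases "i < n \<and> j < n")
    case True
    hence "ent (iota n b) i j = emb A (M $$ (i, j)) + cc (if i = j then c else 0)"
      using bM ent_tE[OF bM(2), of i j] by (simp add: iota_def)
    moreover have "norm (emb A (M $$ (i, j)) + cc (if i = j then c else 0)) \<le> ?N"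
      using True bM(2) c_le N0 key by (intro norm_emb_add_cc_le) (auto simp: mats_def)
    ultimately show ?thesis by simp
  next
    case False
    have "fsize n (iota n b)" using b n by (intro fsize_iota) (auto simp: carrier_BB)
    thus ?thesis using False N0 fsizeD[of n "iota n b" i j] by auto
  qed
qed

text \<open>The factor \<open>n\<close> stems from adding up the \<open>n\<close> entries in the
  first row of a product. Any bound linear in the norm of \<open>a\<close> makes preimages of closed
  ideals closed.\<close>

lemma norm_msingle_le:
  assumes n: "n \<ge> 1" and a: "a \<in> carrier A"
  shows "cnorm (BB n) (msingle n a, 0) \<le> real n * cnorm A a"
proof -
  let ?S = "msingle n a"
  have S: "?S \<in> mats A n n" by (rule msingle(1)[OF a n])
  show ?thesis
  proof (cases "unital A")
    case True
    have "mnorm n ?S \<le> (\<Sum>i<n. \<Sum>j<n. cnorm A (?S $$ (i, j)))" by (rule matrix_norm_le[OF S n])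
    also have "\<dots> = (\<Sum>i<n. \<Sum>j<n. if j = 0 then (if i = 0 then cnorm A a else 0) else 0)"
      by (intro sum.cong) auto
    also have "\<dots> = cnorm A a" using n by simp
    also have "\<dots> \<le> real n * cnorm A a" using n mult_right_mono[of 1 "real n" "cnorm A a"] norm_nonneg[OF a] by simp
    finally show ?thesis using True n by (simp add: cnorm_tilde unital_matrix_alg)
  next
    case False
    have "mnorm n (madd n (mmult A ?S X) (mscale n 0 X)) \<le> real n * cnorm A a"
      if X: "X \<in> mats A n n" "mnorm n X \<le> 1" for X
    proof -
      have SX: "mmult A ?S X \<in> mats A n n" by (rule mats_ops(3)[OF S X(1)])
      have "madd n (mmult A ?S X) (mscale n 0 X) = mmult A ?S X"
        using SX X(1) by (intro eq_matI) (auto simp: mats_def)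
      moreover have "mnorm n (mmult A ?S X) \<le> (\<Sum>i<n. \<Sum>j<n. cnorm A (mmult A ?S X $$ (i, j)))"
        by (rule matrix_norm_le[OF SX n])
      moreover have "(\<Sum>i<n. \<Sum>j<n. cnorm A (mmult A ?S X $$ (i, j))) \<le>
          (\<Sum>i<n. \<Sum>j<n. \<Sum>k<n. cnorm A (?S $$ (i, k)))"
        using matrix_entry_norm_le[OF X(1) n] X(2)
        by (intro sum_mono norm_mmult_entry_le[OF S X(1)]) (auto intro: order.trans)
      moreover have "(\<Sum>i<n. \<Sum>j<n. \<Sum>k<n. cnorm A (?S $$ (i, k))) =
          (\<Sum>i<n. \<Sum>j<n. \<Sum>k<n. if k = 0 then (if i = 0 then cnorm A a else 0) else 0)"
        by (intro sum.cong) auto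
      moreover have "\<dots> = real n * cnorm A a"
        using n by (subst sum.swap) simp
      ultimately show ?thesis by simp
    qed
    moreover have "mzero A n n \<in> mats A n n" "mnorm n (mzero A n n) \<le> 1"
      using matrix_norm_le[of "mzero A n n" n] n by (simp_all add: mats_def mzero_def)
    ultimately have "Sup {mnorm n (madd n (mmult A ?S X) (mscale n 0 X)) | X.
        X \<in> mats A n n \<and> mnorm n X \<le> 1} \<le> real n * cnorm A a"
      by (intro cSup_least) auto
    thus ?thesis using False n by (simp add: cnorm_tilde unital_matrix_alg)
  qed
qed

end

section \<open>Approximation by invertible elements\<close>

lemma (in ideal) one_sided_invertible_Quot:
  assumes b: "b \<in> carrier R" and inv: "one_sided_invertible (R Quot I) (I +> b)"
  obtains y where "y \<in> carrier R" "y \<otimes> b \<ominus> \<one> \<in> I \<or> b \<otimes> y \<ominus> \<one> \<in> I"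
proof -
  obtain Y where Y: "Y \<in> carrier (R Quot I)"
      "Y \<otimes>\<^bsub>R Quot I\<^esub> (I +> b) = \<one>\<^bsub>R Quot I\<^esub> \<or> (I +> b) \<otimes>\<^bsub>R Quot I\<^esub> Y = \<one>\<^bsub>R Quot I\<^esub>"
    using inv unfolding one_sided_invertible_def by blast
  obtain y where y: "y \<in> carrier R" "Y = I +> y"
    using Y(1) unfolding FactRing_def A_RCOSETS_def' by auto
  have "I +> (y \<otimes> b) = I +> \<one> \<or> I +> (b \<otimes> y) = I +> \<one>"
    using Y(2) y b by (simp add: FactRing_def rcoset_mult_add)
  hence "y \<otimes> b \<ominus> \<one> \<in> I \<or> b \<otimes> y \<ominus> \<one> \<in> I"
    using quotient_eq_iff_same_a_r_cos[OF is_ideal] y b by simp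
  thus thesis using that y by blast
qed

lemma (in ideal) Units_Quot:
  assumes "b \<in> carrier R" "y \<in> carrier R" "y \<otimes> b \<ominus> \<one> \<in> I" "b \<otimes> y \<ominus> \<one> \<in> I"
  shows "I +> b \<in> Units (R Quot I)"
proof -
  have "I +> (y \<otimes> b) = I +> \<one>" "I +> (b \<otimes> y) = I +> \<one>"
    using quotient_eq_iff_same_a_r_cos[OF is_ideal] assms by simp_all
  moreover have "I +> b \<in> carrier (R Quot I)" "I +> y \<in> carrier (R Quot I)"
    using assms unfolding FactRing_def A_RCOSETS_def' by auto
  ultimately show ?thesis using assms
    unfolding Units_def by (auto simp: FactRing_def rcoset_mult_add intro!: bexI[of _ "I +> y"])
qed

lemma closed_ideal_ideal:
  assumes "ring B" "closed_ideal K B" shows "ideal K B"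
proof (rule idealI[OF assms(1)])
  show "subgroup K (add_monoid B)"
    using assms(2) by (simp add: closed_ideal_def additive_subgroup_def)
qed (use assms(2) in \<open>auto simp: closed_ideal_def\<close>)

lemma single_corner: "single a * M * single b = single (a * ent M 0 0 * b)"
proof (rule fmat_eqI)
  fix i j
  have s: "fsize 1 (single a)" "fsize 1 (single b)" by (simp_all add: fsize_single)
  show "ent (single a * M * single b) i j = ent (single (a * ent M 0 0 * b)) i j"
    unfolding ent_mult[OF disjI2[OF s(2)]] ent_mult[OF disjI1[OF s(1)]] by simp
qed

section \<open>Ideals of matrix unitizations and their corners\<close>

context cstar_algebra
begin

definition EI :: "nat \<Rightarrow> ('a, 'b) amb fmat set" where
  "EI n = {X. fsize n X \<and> entries_in IA X}"

lemma star_subring_emb: "star_subring IA"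
  unfolding star_subring_def
proof (intro conjI ballI)
  show "0 \<in> IA" by (metis emb_zero imageI zero_closed)
  fix x assume "x \<in> IA"
  then obtain a where a: "a \<in> carrier A" "x = emb A a" by auto
  have "emb A (\<ominus> a) = - emb A a"
    using emb_add[of "\<ominus> a" a] a by (simp add: l_neg eq_neg_iff_add_eq_0)
  thus "- x \<in> IA" using a by (metis imageI a_inv_closed)
  show "adj x \<in> IA" using a by (simp flip: emb_star)
  fix y assume "y \<in> IA"
  then obtain b where b: "b \<in> carrier A" "y = emb A b" by auto
  show "x + y \<in> IA" "x * y \<in> IA"
    using a b by (simp_all flip: emb_add emb_mult)
qed

text \<open>The other factor may be any matrix of size \<open>n\<close> over the ambient algebra.
  This matters for a scalar unitary, which in general lies outside the matrix unitization although
  its products with matrices over \<open>A\<close> lie inside.\<close>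

lemma EI_mult:
  assumes "X \<in> EI n" "fsize n Y" shows "X * Y \<in> EI n" "Y * X \<in> EI n"
proof -
  have X: "fsize n X" "\<And>i j. ent X i j \<in> IA" using assms by (auto simp: EI_def entries_in_def)
  have m: "x * y \<in> IA" "y * x \<in> IA" if "x \<in> IA" for x y
    using that by (auto simp: emb_mult_left emb_mult_right)
  have "entries_in IA (X * Y)" "entries_in IA (Y * X)"
    unfolding entries_in_def ent_mult[OF disjI1[OF X(1)]] ent_mult[OF disjI2[OF X(1)]]
    by (intro allI star_subring_sum[OF star_subring_emb] m X)+
  thus "X * Y \<in> EI n" "Y * X \<in> EI n" using X(1) assms(2) by (simp_all add: EI_def)
qed

lemma iota_surj:
  assumes n: "n \<ge> 1" and X: "fsize n X" "X - diag n (cc c) \<in> EI n" and c: "unital A \<Longrightarrow> c = 0"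
  shows "X \<in> iota n ` carrier (BB n)"
proof -
  let ?D = "X - diag n (cc c)"
  have "\<forall>i j. \<exists>a\<in>carrier A. ent ?D i j = emb A a" using X(2) unfolding EI_def entries_in_def by blast
  then obtain m where m: "\<And>i j. m i j \<in> carrier A" "\<And>i j. ent ?D i j = emb A (m i j)" by metis
  define M where "M = mat n n (\<lambda>(i, j). m i j)"
  have M: "M \<in> mats A n n" using m by (auto simp: M_def mats_def)
  have "tE M = ?D"
  proof (rule fmat_eqI)
    fix i j show "ent (tE M) i j = ent ?D i j"
    proof (cases "i < n \<and> j < n")
      case True thus ?thesis unfolding m(2) by (simp add: ent_place M_def)
    next
      case False
      have "ent ?D i j = 0" by (rule fsizeD[of n]) (use X False in \<open>auto simp: EI_def\<close>)
      thus ?thesis using False by (auto simp: ent_place M_def)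
    qed
  qed
  hence "iota n (M, c) = X" by (simp add: iota_def)
  moreover have "(M, c) \<in> carrier (BB n)" using n M c by (simp add: carrier_BB)
  ultimately show ?thesis by blast
qed

lemma EI_subset: "n \<ge> 1 \<Longrightarrow> EI n \<subseteq> iota n ` carrier (BB n)"
  using iota_surj[of n _ 0] by (auto simp: diag_ops) (auto simp: EI_def)

lemma single_EI: "n \<ge> 1 \<Longrightarrow> a \<in> carrier A \<Longrightarrow> esingle a \<in> EI n"
  using star_subring_emb by (auto simp: EI_def entries_in_def fsize_single star_subring_def)

lemma iota_minus:
  assumes n: "n \<ge> 1" and x: "x \<in> carrier (BB n)" and y: "y \<in> carrier (BB n)"
  shows "iota n (x \<ominus>\<^bsub>BB n\<^esub> y) = iota n x - iota n y"
proof -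
  interpret B: ring "BB n" by (rule ring_BB[OF n])
  have "x \<ominus>\<^bsub>BB n\<^esub> y \<oplus>\<^bsub>BB n\<^esub> y = x" using x y by (simp add: B.minus_eq B.a_assoc B.l_neg del: tilde_simps)
  thus ?thesis using iota_hom(3)[OF n, of "x \<ominus>\<^bsub>BB n\<^esub> y" y] x y by (simp add: algebra_simps)
qed

lemma iota_eqD: "n \<ge> 1 \<Longrightarrow> x \<in> carrier (BB n) \<Longrightarrow> y \<in> carrier (BB n) \<Longrightarrow> iota n x = iota n y \<Longrightarrow> x = y"
  using iota_inj[of n] by (auto dest!: inj_onD simp: carrier_BB)

lemma iota_ideal:
  assumes n: "n \<ge> 1" and K: "closed_ideal K (BB n)"
  shows "K \<subseteq> carrier (BB n)"
    "X \<in> iota n ` K \<Longrightarrow> Y \<in> iota n ` K \<Longrightarrow> X - Y \<in> iota n ` K"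
    "X \<in> iota n ` K \<Longrightarrow> Z \<in> iota n ` carrier (BB n) \<Longrightarrow> X * Z \<in> iota n ` K"
    "X \<in> iota n ` K \<Longrightarrow> Z \<in> iota n ` carrier (BB n) \<Longrightarrow> Z * X \<in> iota n ` K"
    "0 \<in> iota n ` K"
    "b \<in> carrier (BB n) \<Longrightarrow> iota n b \<in> iota n ` K \<longleftrightarrow> b \<in> K"
proof -
  interpret I: ideal K "BB n" by (rule closed_ideal_ideal[OF ring_BB[OF n] K])
  show sub: "K \<subseteq> carrier (BB n)" by (rule I.a_subset)
  show "X \<in> iota n ` K \<Longrightarrow> Y \<in> iota n ` K \<Longrightarrow> X - Y \<in> iota n ` K"
  proof -
    assume "X \<in> iota n ` K" "Y \<in> iota n ` K"
    then obtain x y where xy: "x \<in> K" "y \<in> K" "X = iota n x" "Y = iota n y" by auto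
    hence "x \<ominus>\<^bsub>BB n\<^esub> y \<in> K" by (simp add: I.minus_eq)
    thus ?thesis using iota_minus[OF n, of x y] xy sub by (metis image_eqI subsetD)
  qed
  show "X * Z \<in> iota n ` K" "Z * X \<in> iota n ` K" if "X \<in> iota n ` K" "Z \<in> iota n ` carrier (BB n)"
  proof -
    from that obtain x z where xz: "x \<in> K" "z \<in> carrier (BB n)" "X = iota n x" "Z = iota n z" by auto
    have "x \<otimes>\<^bsub>BB n\<^esub> z \<in> K" "z \<otimes>\<^bsub>BB n\<^esub> x \<in> K" using xz I.I_r_closed I.I_l_closed by auto
    moreover have "x \<in> carrier (BB n)" using xz sub by auto
    ultimately show "X * Z \<in> iota n ` K" "Z * X \<in> iota n ` K"
      using iota_hom(4)[OF n] xz by (metis image_eqI)+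
  qed
  have "\<zero>\<^bsub>BB n\<^esub> \<in> K" by (rule additive_subgroup.zero_closed[OF I.is_additive_subgroup])
  moreover have "iota n \<zero>\<^bsub>BB n\<^esub> = 0"
    using iota_hom(3)[OF n I.zero_closed I.zero_closed]
    by (simp only: I.l_zero[OF I.zero_closed]) (metis add_cancel_right_right)
  ultimately show "0 \<in> iota n ` K" by (metis imageI)
  show "b \<in> carrier (BB n) \<Longrightarrow> iota n b \<in> iota n ` K \<longleftrightarrow> b \<in> K"
    using iota_eqD[OF n] sub by blast
qed

lemma msingle_BB: "n \<ge> 1 \<Longrightarrow> a \<in> carrier A \<Longrightarrow> (msingle n a, 0) \<in> carrier (BB n)"
  "n \<ge> 1 \<Longrightarrow> a \<in> carrier A \<Longrightarrow> iota n (msingle n a, 0) = esingle a"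
  using msingle by (simp_all add: carrier_BB iota_def diag_ops)

text \<open>This corner is the test ideal of \<open>A\<close> for the hypothesis on \<open>p\<close>
  and \<open>q\<close>. It is an ideal because the corner embedding is multiplicative, and closed
  because that embedding is bounded.\<close>

lemma closed_ideal_corner:
  assumes n: "n \<ge> 1" and K: "closed_ideal K (BB n)"
  shows "closed_ideal {a \<in> carrier A. esingle a \<in> iota n ` K} A"
proof -
  let ?J = "{a \<in> carrier A. esingle a \<in> iota n ` K}" and ?KI = "iota n ` K"
  note KI = iota_ideal[OF n K]
  have J0: "\<zero> \<in> ?J"
  proof -
    have "single (0 :: ('a, 'b) amb) = 0" by (rule fmat_eqI) simp
    thus ?thesis using KI(5) by simp
  qed
  have s_diff: "single (emb A (a \<ominus> b)) = esingle a - esingle b"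
    if "a \<in> carrier A" "b \<in> carrier A" for a b
  proof -
    have "emb A (a \<ominus> b) + emb A b = emb A a" using that by (simp flip: emb_add add: minus_eq a_assoc l_neg)
    thus ?thesis by (intro fmat_eqI) (auto simp: algebra_simps)
  qed
  have Jd: "a \<ominus> b \<in> ?J" if "a \<in> ?J" "b \<in> ?J" for a b
    using that KI(2)[of "esingle a" "esingle b"] by (auto simp: s_diff)
  have Jn: "\<ominus> b \<in> ?J" if "b \<in> ?J" for b using Jd[OF J0 that] that by (simp add: minus_eq)
  have Ja: "a \<oplus> b \<in> ?J" if "a \<in> ?J" "b \<in> ?J" for a b
    using Jd[OF that(1) Jn[OF that(2)]] that by (simp add: minus_eq)
  have "additive_subgroup ?J A"
    by (rule additive_subgroup.intro, rule subgroup.intro)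
      (use J0 Ja Jn in \<open>auto simp flip: a_inv_def\<close>)
  moreover have "x \<otimes> k \<in> ?J \<and> k \<otimes> x \<in> ?J" if k: "k \<in> ?J" and x: "x \<in> carrier A" for k x
  proof -
    have "esingle x \<in> iota n ` carrier (BB n)" using single_EI[OF n x] EI_subset[OF n] by auto
    hence "esingle k * esingle x \<in> ?KI" "esingle x * esingle k \<in> ?KI"
      using KI(3,4) k by auto
    thus ?thesis using k x by (simp add: single_mult emb_mult)
  qed
  moreover have "cscale A c k \<in> ?J" if k: "k \<in> ?J" for k c
  proof -
    obtain M where M: "M \<in> K" "iota n M = esingle k" using k by (auto intro: sym)
    have "M = (msingle n k, 0)"
      by (rule iota_eqD[OF n subsetD[OF KI(1) M(1)]]) (use M msingle_BB[OF n] k in simp_all)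
    moreover have "cscale (BB n) c M \<in> K" using K M by (auto simp: closed_ideal_def)
    ultimately have "(mscale n c (msingle n k), 0) \<in> K" by simp
    moreover have "mscale n c (msingle n k) = msingle n (cscale A c k)" by (rule eq_matI) auto
    ultimately have "(msingle n (cscale A c k), 0) \<in> K" by simp
    hence "iota n (msingle n (cscale A c k), 0) \<in> ?KI" by (rule imageI)
    thus ?thesis using msingle_BB(2)[OF n, of "cscale A c k"] k by simp
  qed
  moreover have "norm_closure A ?J \<subseteq> ?J"
  proof
    fix a assume a: "a \<in> norm_closure A ?J"
    hence aA: "a \<in> carrier A" by (simp add: norm_closure_def)
    have "(msingle n a, 0) \<in> norm_closure (BB n) K"
      unfolding norm_closure_def
    proof (intro CollectI conjI allI impI)
      show "(msingle n a, 0) \<in> carrier (BB n)" by (rule msingle_BB(1)[OF n aA])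
      fix e :: real assume e: "e > 0"
      \<comment> \<open>The corner embedding is only known to enlarge norms at most by the factor
        \<open>n\<close>; the tolerance is reduced accordingly.\<close>
      hence "e / real n > 0" using n by simp
      then obtain y where y: "y \<in> ?J" "cnorm A (a \<ominus> y) < e / real n"
        using a unfolding norm_closure_def by blast
      have yA: "y \<in> carrier A" using y by simp
      have yK: "(msingle n y, 0) \<in> K"
        using KI(6)[OF msingle_BB(1)[OF n yA]] msingle_BB(2)[OF n yA] y(1) by simp
      interpret B: ring "BB n" by (rule ring_BB[OF n])
      have "(msingle n a, 0) \<ominus>\<^bsub>BB n\<^esub> (msingle n y, 0) = (msingle n (a \<ominus> y), 0)"
      proof (rule iota_eqD[OF n])
        show "(msingle n a, 0) \<ominus>\<^bsub>BB n\<^esub> (msingle n y, 0) \<in> carrier (BB n)"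
          by (intro B.minus_closed msingle_BB(1) n aA yA)
        show "(msingle n (a \<ominus> y), 0) \<in> carrier (BB n)" by (intro msingle_BB(1) n minus_closed aA yA)
        show "iota n ((msingle n a, 0) \<ominus>\<^bsub>BB n\<^esub> (msingle n y, 0)) = iota n (msingle n (a \<ominus> y), 0)"
          unfolding iota_minus[OF n msingle_BB(1)[OF n aA] msingle_BB(1)[OF n yA]]
            msingle_BB(2)[OF n aA] msingle_BB(2)[OF n yA] msingle_BB(2)[OF n minus_closed[OF aA yA]]
          by (rule s_diff[OF aA yA, symmetric])
      qed
      hence "cnorm (BB n) ((msingle n a, 0) \<ominus>\<^bsub>BB n\<^esub> (msingle n y, 0)) \<le> real n * cnorm A (a \<ominus> y)"
        using norm_msingle_le[OF n minus_closed[OF aA yA]] by (simp only:)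
      also have "\<dots> < e" using y(2) n by (simp add: field_simps)
      finally show "\<exists>y\<in>K. cnorm (BB n) ((msingle n a, 0) \<ominus>\<^bsub>BB n\<^esub> y) < e" using yK by blast
    qed
    hence "(msingle n a, 0) \<in> K" using K by (auto simp: closed_ideal_def)
    hence "iota n (msingle n a, 0) \<in> ?KI" by (rule imageI)
    thus "a \<in> ?J" using aA msingle_BB(2)[OF n aA] by simp
  qed
  ultimately show ?thesis unfolding closed_ideal_def by blast
qed

text \<open>The corner ideal contains \<open>p\<close> exactly if it contains the closed ideal
  generated by \<open>p\<close>, which is also the one generated by \<open>q\<close>.\<close>

lemma single_mem_ideal_iff:
  assumes n: "n \<ge> 1" and K: "closed_ideal K (BB n)" and pq: "p \<in> carrier A" "q \<in> carrier A"
    and eq: "gen_closed_ideal A {p} = gen_closed_ideal A {q}"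
  shows "esingle p \<in> iota n ` K \<longleftrightarrow> esingle q \<in> iota n ` K"
proof -
  let ?J = "{a \<in> carrier A. esingle a \<in> iota n ` K}"
  have mem: "x \<in> gen_closed_ideal A {x}" and sub: "x \<in> ?J \<Longrightarrow> gen_closed_ideal A {x} \<subseteq> ?J" for x
    using closed_ideal_corner[OF n K] unfolding gen_closed_ideal_def by auto
  have "p \<in> ?J \<longleftrightarrow> q \<in> ?J" using mem[of p] mem[of q] sub[of p] sub[of q] eq by blast
  thus ?thesis using pq by simp
qed

lemma IR_set_mem:
  assumes n: "n \<ge> 1" and b: "b \<in> carrier (BB n)" and w: "w \<in> carrier (BB n)"
    and P: "P \<in> iota n ` carrier (BB n)" and Q: "Q \<in> iota n ` carrier (BB n)"
    and bw: "iota n w * iota n b = eB n - P" "iota n b * iota n w = eB n - Q"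
      "iota n b * P = 0" "Q * iota n b = 0"
    and iff: "\<And>K. closed_ideal K (BB n) \<Longrightarrow> P \<in> iota n ` K \<longleftrightarrow> Q \<in> iota n ` K"
  shows "b \<in> IR_set (BB n)"
proof -
  have one: "\<one>\<^bsub>BB n\<^esub> \<in> carrier (BB n)" by (rule one_BB[OF n])
  have "K +>\<^bsub>BB n\<^esub> b \<in> Units (BB n Quot K)"
    if K: "closed_ideal K (BB n)" and inv: "one_sided_invertible (BB n Quot K) (K +>\<^bsub>BB n\<^esub> b)" for K
  proof -
    interpret I: ideal K "BB n" by (rule closed_ideal_ideal[OF ring_BB[OF n] K])
    note KI = iota_ideal[OF n K]
    have mem: "x \<otimes>\<^bsub>BB n\<^esub> y \<ominus>\<^bsub>BB n\<^esub> \<one>\<^bsub>BB n\<^esub> \<in> K \<longleftrightarrow> iota n x * iota n y - eB n \<in> iota n ` K"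
      if "x \<in> carrier (BB n)" "y \<in> carrier (BB n)" for x y
      using that one KI(6)[of "x \<otimes>\<^bsub>BB n\<^esub> y \<ominus>\<^bsub>BB n\<^esub> \<one>\<^bsub>BB n\<^esub>"]
      by (simp add: iota_minus[OF n] iota_hom[OF n])
    have one_P: "eB n * X = X" "X * eB n = X" if "X \<in> iota n ` carrier (BB n)" for X
      using that iota_one_mult[OF n] by auto
    have neg: "- X \<in> iota n ` K \<longleftrightarrow> X \<in> iota n ` K" for X
      using KI(2)[OF KI(5), of X] KI(2)[OF KI(5), of "- X"] by auto
    obtain y where y: "y \<in> carrier (BB n)"
        "y \<otimes>\<^bsub>BB n\<^esub> b \<ominus>\<^bsub>BB n\<^esub> \<one>\<^bsub>BB n\<^esub> \<in> K \<or> b \<otimes>\<^bsub>BB n\<^esub> y \<ominus>\<^bsub>BB n\<^esub> \<one>\<^bsub>BB n\<^esub> \<in> K"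
      using I.one_sided_invertible_Quot[OF b inv] by blast
    have "P \<in> iota n ` K \<or> Q \<in> iota n ` K"
      using y(2)
    proof
      assume "y \<otimes>\<^bsub>BB n\<^esub> b \<ominus>\<^bsub>BB n\<^esub> \<one>\<^bsub>BB n\<^esub> \<in> K"
      \<comment> \<open>\<open>b\<close> vanishes on \<open>P\<close>, so the product is
        \<open>- P\<close>: a left inverse modulo \<open>K\<close> forces \<open>P\<close> into
        \<open>K\<close>. In the same way a right inverse forces \<open>Q\<close> into
        \<open>K\<close>.\<close>
      hence "(iota n y * iota n b - eB n) * P \<in> iota n ` K"
        using KI(3) P mem[OF y(1) b] by simp
      hence "- P \<in> iota n ` K" by (simp add: left_diff_distrib one_P[OF P] mult.assoc bw)
      thus ?thesis by (simp add: neg)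
    next
      assume "b \<otimes>\<^bsub>BB n\<^esub> y \<ominus>\<^bsub>BB n\<^esub> \<one>\<^bsub>BB n\<^esub> \<in> K"
      hence "Q * (iota n b * iota n y - eB n) \<in> iota n ` K"
        using KI(4) Q mem[OF b y(1)] by simp
      hence "- Q \<in> iota n ` K" by (simp add: right_diff_distrib one_P[OF Q] bw flip: mult.assoc)
      thus ?thesis by (simp add: neg)
    qed
    hence "P \<in> iota n ` K" "Q \<in> iota n ` K" using iff[OF K] by auto
    \<comment> \<open>Modulo an ideal that contains both defects, \<open>w\<close> is a two-sided
      inverse of \<open>b\<close>.\<close>
    hence "w \<otimes>\<^bsub>BB n\<^esub> b \<ominus>\<^bsub>BB n\<^esub> \<one>\<^bsub>BB n\<^esub> \<in> K" "b \<otimes>\<^bsub>BB n\<^esub> w \<ominus>\<^bsub>BB n\<^esub> \<one>\<^bsub>BB n\<^esub> \<in> K"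
      using neg by (simp_all add: mem b w bw)
    thus ?thesis by (rule I.Units_Quot[OF b w])
  qed
  thus ?thesis using b unfolding IR_set_def by blast
qed

lemma invertible_approximation:
  assumes n: "n \<ge> 1" and IR: "has_IR (matrix_alg A n)" and b: "b \<in> IR_set (BB n)" and e: "e > 0"
  obtains y z where "y \<in> carrier (BB n)" "z \<in> carrier (BB n)"
    "iota n y * iota n z = eB n" "iota n z * iota n y = eB n"
    "\<And>i j. norm (ent (iota n y - iota n b) i j) < e"
proof -
  interpret B: ring "BB n" by (rule ring_BB[OF n])
  have bc: "b \<in> carrier (BB n)" using b by (simp add: IR_set_def)
  have "b \<in> norm_closure (BB n) (Units (BB n))" using IR b by (auto simp: has_IR_def)
  then obtain y where y: "y \<in> Units (BB n)" "cnorm (BB n) (b \<ominus>\<^bsub>BB n\<^esub> y) < e"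
    using e by (auto simp: norm_closure_def)
  then obtain z where z: "y \<in> carrier (BB n)" "z \<in> carrier (BB n)" "y \<otimes>\<^bsub>BB n\<^esub> z = \<one>\<^bsub>BB n\<^esub>" "z \<otimes>\<^bsub>BB n\<^esub> y = \<one>\<^bsub>BB n\<^esub>"
    by (auto simp: Units_def)
  have "norm (ent (iota n y - iota n b) i j) < e" for i j
  proof -
    have "norm (ent (iota n (b \<ominus>\<^bsub>BB n\<^esub> y)) i j) < e"
      by (rule order.strict_trans1[OF norm_ent_iota_le[OF n] y(2)]) (intro B.minus_closed bc z(1))
    thus ?thesis by (simp add: iota_minus[OF n bc z(1)] Real_Vector_Spaces.norm_minus_commute)
  qed
  moreover have "iota n y * iota n z = eB n" "iota n z * iota n y = eB n"
    using iota_hom(4)[OF n z(1,2)] iota_hom(4)[OF n z(2,1)] z by simp_all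
  ultimately show thesis using that z by blast
qed

end

section \<open>Rotation of the scalar part and equivalence of the projections\<close>

lemma spt_sum: "spt (\<Sum>i\<in>I. f i) = (\<Sum>i\<in>I. spt (f i))"
  by (induction I rule: infinite_finite_induct) auto

lemma cc_sum: "cc (\<Sum>i\<in>I. f i) = (\<Sum>i\<in>I. cc (f i) :: 'a::cstar1)"
  by (induction I rule: infinite_finite_induct) (auto simp: cc_add)

context cstar_algebra
begin

text \<open>For non-unital \<open>A\<close>, both \<open>p\<close> and \<open>q\<close> have scalar
  part 0, so the matrix \<open>u\<close> of the scalar parts of \<open>x\<close> is unitary and
  \<open>fadj u * x\<close> differs from the identity by a matrix over \<open>A\<close>. For unital
  \<open>A\<close> the entries of \<open>x\<close> already lie in \<open>A\<close>; then
  \<open>u\<close> is the identity and \<open>c = 0\<close>.\<close>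

lemma scalar_rotation:
  assumes p: "p \<in> projections A" and q: "q \<in> projections A" and n: "n \<ge> 1" "fsize n x"
    and x: "entries_in CA x"
    "fadj x * x = diag n (eA) - esingle p"
    "x * fadj x = diag n (eA) - esingle q"
    "diag n (eA) * x = x"
  obtains u c where "fsize n u" "fadj u * u = diag n (eA)"
    "u * fadj u = diag n (eA)" "fadj u * x - diag n (cc c) \<in> EI n" "unital A \<Longrightarrow> c = 0"
proof (cases "unital A")
  case True
  let ?E = "diag n (eA)"
  have one: "\<one> \<in> carrier A" "\<one> \<otimes> \<one> = \<one>" using one_is_identity[OF True] by auto
  have phi1: "eA = emb A \<one>" using True by (simp add: one_tilde)
  have "star A \<one> = \<one>"
    using one_is_identity[OF True] star_mult[of "star A \<one>" "\<one>"] star_star[of \<one>] by auto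
  hence "fadj ?E = ?E" using one by (simp add: phi1 flip: emb_star)
  moreover have "?E * ?E = ?E" using one by (simp add: phi1 flip: diag_ops emb_mult)
  moreover have "CA = IA" using True by (auto simp: carrier_tilde image_iff)
  hence "x \<in> EI n" using n x by (simp add: EI_def)
  ultimately show thesis using x(4)
    by (intro that[of ?E 0]) (simp_all add: fsize_diag diag_ops)
next
  case False
  have phi1: "eA = 1" using False by (simp add: one_tilde phi_def)
  let ?S = "CA"
  obtain u :: "('a, 'b) amb fmat" where u: "ent u = (\<lambda>i j. cc (spt (ent x i j)))" "fsize n u"
    by (rule ex_fmat[of n "\<lambda>i j. cc (spt (ent x i j))"]) (use fsizeD[OF n(2)] in auto)
  have fu: "ent (fadj u) i j = cc (spt (ent (fadj x) i j))" for i j by (simp add: u adj_cc)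
  have pq: "spt (ent (esingle a) i j) = 0" for a i j by simp
  have uu: "fadj u * u = diag n 1"
  proof (rule fmat_eqI)
    fix i j
    have "ent (fadj u * u) i j = cc (spt (ent (fadj x * x) i j))"
      unfolding ent_mult[OF disjI2[OF u(2)]] ent_mult[OF disjI2[OF n(2)]] spt_sum cc_sum fu
      by (simp add: u cc_mult)
    thus "ent (fadj u * u) i j = ent (diag n 1) i j"
      unfolding x(2) phi1 by (simp add: pq del: ent_single)
  qed
  have uu': "u * fadj u = diag n 1"
  proof (rule fmat_eqI)
    fix i j
    have "ent (u * fadj u) i j = cc (spt (ent (x * fadj x) i j))"
      unfolding ent_mult[OF disjI1[OF u(2)]] ent_mult[OF disjI1[OF n(2)]] spt_sum cc_sum fu
      by (simp add: u cc_mult)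
    thus "ent (u * fadj u) i j = ent (diag n 1) i j"
      unfolding x(3) phi1 by (simp add: pq del: ent_single)
  qed
  have sx: "spt (ent (fadj u * x) i j) = spt (ent (diag n 1 :: ('a, 'b) amb fmat) i j)" for i j
  proof -
    have "spt (ent (fadj u * x) i j) = spt (ent (fadj x * x) i j)"
      unfolding ent_mult[OF disjI2[OF n(2)]] spt_sum by (simp add: u)
    thus ?thesis unfolding x(2) phi1 by (simp add: pq del: ent_single)
  qed
  have "cc c \<in> ?S" for c
    using False by (intro image_eqI[of _ _ "(\<zero>, c)"]) (simp_all add: phi_def carrier_tilde)
  hence "entries_in ?S u" "entries_in ?S (diag n 1)"
    using star_subring_phi cc_1 by (auto simp: entries_in_def u star_subring_def) (metis cc_1)+
  hence S: "entries_in ?S (fadj u * x - diag n 1)"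
    by (intro entries_in_ops[OF star_subring_phi] entries_in_fadj[OF star_subring_phi] x(1))
  have "ent (fadj u * x - diag n 1) i j \<in> IA" for i j
  proof -
    have "ent (fadj u * x - diag n 1) i j \<in> ?S" using S unfolding entries_in_def by blast
    then obtain z where z: "ent (fadj u * x - diag n 1) i j = phi z" "z \<in> carrier (tilde A)" by (rule imageE)
    obtain a c where ac': "z = (a, c)" by (cases z)
    have ac: "a \<in> carrier A" "ent (fadj u * x - diag n 1) i j = phi (a, c)"
      using z unfolding ac' carrier_tilde by blast+
    have "c = spt (ent (fadj u * x - diag n 1) i j)" unfolding ac(2) by (simp add: phi_def)
    also have "\<dots> = 0" using sx[of i j] by simp
    finally show ?thesis unfolding ac(2) using ac(1) by simp
  qed
  hence "fadj u * x - diag n (cc 1) \<in> EI n"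
    using n u by (simp add: EI_def entries_in_def fsize_diag del: ent_simps ent_diag)
  thus thesis using False uu uu' u(2) by (intro that[of u 1]) (simp_all add: phi1)
qed

text \<open>The relations confine \<open>S\<close> and \<open>T\<close> to the entry at
  \<open>(0, 0)\<close>, which leaves a question about elements of the ambient algebra. The partial
  isometry found there uses a root formed with the ambient identity, but it contains the factor
  \<open>emb A q\<close> and so lies in the ideal \<open>A\<close>.\<close>

lemma mvn_equiv_of_corner:
  assumes p: "p \<in> projections A" and q: "q \<in> projections A"
    and ST: "S * T = esingle p" "T * S = esingle q"
    and S: "esingle p * S = S" "S * esingle q = S"
    and T: "esingle q * T = T" "T * esingle p = T"
  shows "mvn_equiv A p q"
proof -
  have pc: "p \<in> carrier A" "star A p = p" "p \<otimes> p = p" and qc: "q \<in> carrier A" "star A q = q" "q \<otimes> q = q"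
    using p q by (auto simp: projections_def)
  let ?p = "emb A p" and ?q = "emb A q"
  define s where "s = ?p * ent S 0 0 * ?q"
  define t where "t = ?q * ent T 0 0 * ?p"
  have Ss: "S = single s" using single_corner[of ?p S ?q] S by (simp add: s_def)
  have Tt: "T = single t" using single_corner[of ?q T ?p] T by (simp add: t_def)
  have sinj: "a = b" if "single a = single b" for a b :: "('a, 'b) amb"
    using arg_cong[OF that, of "\<lambda>M. ent M 0 0"] by simp
  have pp: "adj ?p = ?p" "?p * ?p = ?p" "adj ?q = ?q" "?q * ?q = ?q"
    using pc qc by (simp_all flip: emb_star emb_mult)
  have "s * t = ?p" "t * s = ?q" using ST by (auto simp: Ss Tt single_mult intro: sinj)
  moreover have "?p * s = s" "s * ?q = s" "?q * t = t" "t * ?p = t"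
    by (simp_all add: s_def t_def mult.assoc pp) (simp_all add: pp flip: mult.assoc)
  ultimately obtain w where w: "adj (t * w) * (t * w) = ?p" "(t * w) * adj (t * w) = ?q"
    using mvn_of_algebraic[of ?p ?q s t] pp by metis
  have "t * w \<in> IA"
    unfolding t_def using qc(1) by (simp add: mult.assoc emb_mult_left)
  then obtain v where v: "v \<in> carrier A" "t * w = emb A v" by auto
  have "star A v \<otimes> v = p" "v \<otimes> star A v = q"
    using w v pc qc by (auto intro!: emb_inj simp: emb_mult emb_star)
  thus ?thesis using v unfolding mvn_equiv_def by blast
qed

lemma mvn_equiv_of_K0_class_eq:
  assumes IR: "stable_IR A" and p: "p \<in> projections A" and q: "q \<in> projections A"
    and gen: "gen_closed_ideal A {p} = gen_closed_ideal A {q}" and eq: "K0_class A p = K0_class A q"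
  shows "mvn_equiv A p q"
proof -
  have pc: "p \<in> carrier A" "star A p = p" "p \<otimes> p = p" and qc: "q \<in> carrier A" "star A q = q" "q \<otimes> q = q"
    using p q by (auto simp: projections_def)
  obtain n x where n: "n \<ge> 1" and fx: "fsize n x" and xin: "entries_in CA x"
    and x: "fadj x * x = diag n (eA) - esingle p"
    "x * fadj x = diag n (eA) - esingle q"
    "x * esingle p = 0" "esingle q * x = 0"
    "diag n (eA) * x = x" "x * diag n (eA) = x"
    by (rule K0_partial_isometry[OF p q eq])
  define E where "E = diag n (eA)"
  define P where "P = esingle p"
  define Q where "Q = esingle q"
  obtain u c where u: "fsize n u" "fadj u * u = E" "u * fadj u = E" "fadj u * x - diag n (cc c) \<in> EI n"
    "unital A \<Longrightarrow> c = 0"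
    unfolding E_def by (rule scalar_rotation[OF p q n fx xin x(1,2,5)]) blast
  note x = x[folded E_def P_def Q_def]
  have E: "eB n = E" by (simp add: iota_one[OF n] E_def)
  have Eu: "E * X = X" "X * E = X" if "X \<in> iota n ` carrier (BB n)" for X
    using that iota_one_mult[OF n] by (auto simp: E)
  have EE: "E * E = E" using iota_one_mult(1)[OF n one_BB[OF n]] by (simp only: E)
  have PQ: "P * P = P" "fadj P = P" "Q * Q = Q" "fadj Q = Q"
    using pc qc by (simp_all add: P_def Q_def single_mult flip: emb_mult emb_star)
  have PEI: "P \<in> EI n" and QEI: "Q \<in> EI n" using single_EI[OF n] pc qc by (simp_all add: P_def Q_def)
  note EIB = subsetD[OF EI_subset[OF n]]
  note PB = EIB[OF PEI] and QB = EIB[OF QEI]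
  define X where "X = fadj u * x"
  define W where "W = fadj X"
  \<comment> \<open>The rotation leaves the defect \<open>P\<close> of \<open>fadj X * X\<close>
    unchanged and conjugates that of \<open>X * fadj X\<close> by \<open>u\<close>.\<close>
  define Q' where "Q' = fadj u * Q * u"
  have fX: "fsize n X" by (simp add: X_def u fx)
  have XB: "X \<in> iota n ` carrier (BB n)" unfolding X_def
    by (rule iota_surj[OF n _ u(4,5)]) (simp_all add: u fx)
  have WB: "W \<in> iota n ` carrier (BB n)"
  proof (rule iota_surj[OF n, of _ "cnj c"])
    have "fadj (X - diag n (cc c)) \<in> EI n"
      using u(4) entries_in_fadj[OF star_subring_emb, of "X - diag n (cc c)"] by (simp add: EI_def X_def del: fadj_simps)
    thus "W - diag n (cc (cnj c)) \<in> EI n" by (simp add: W_def adj_cc)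
  qed (use fX u(5) in \<open>auto simp: W_def\<close>)
  have Z: "fadj u * Q \<in> EI n" "Q * u \<in> EI n" using EI_mult[OF QEI] u(1) by simp_all
  have Q'EI: "Q' \<in> EI n" unfolding Q'_def using EI_mult(1)[OF Z(1) u(1)] .
  have uEu: "fadj u * E * u = E"
  proof -
    have "fadj u * (u * fadj u) * u = (fadj u * u) * (fadj u * u)" by (simp only: mult.assoc)
    thus ?thesis by (simp only: u EE)
  qed
  have QE: "Q * (u * (fadj u * Y)) = Q * Y" for Y
  proof -
    have "Q * (u * (fadj u * Y)) = Q * (u * fadj u) * Y" by (simp only: mult.assoc)
    thus ?thesis by (simp only: u Eu(2)[OF QB])
  qed
  have WX: "W * X = E - P"
  proof -
    have "W * X = fadj x * ((u * fadj u) * x)" by (simp add: W_def X_def mult.assoc)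
    thus ?thesis by (simp add: u x)
  qed
  have XW: "X * W = E - Q'"
  proof -
    have "X * W = fadj u * (x * fadj x) * u" by (simp add: W_def X_def mult.assoc)
    also have "\<dots> = fadj u * E * u - Q'" unfolding x(2) by (simp add: Q'_def algebra_simps)
    finally show ?thesis by (simp only: uEu)
  qed
  have XP: "X * P = 0" by (simp add: X_def mult.assoc x)
  have QX: "Q' * X = 0" by (simp add: Q'_def X_def mult.assoc QE x)
  have Q'Q': "Q' * Q' = Q'" "fadj Q' = Q'"
  proof -
    have "Q' * Q' = fadj u * ((Q * Q) * u)" by (simp add: Q'_def mult.assoc QE)
    thus "Q' * Q' = Q'" by (simp add: PQ Q'_def mult.assoc)
    show "fadj Q' = Q'" by (simp add: Q'_def PQ mult.assoc)
  qed
  have PW: "P * W = 0" using arg_cong[OF XP, of fadj] PQ by (simp add: W_def)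
  have WQ: "W * Q' = 0" using arg_cong[OF QX, of fadj] Q'Q' by (simp add: W_def)
  have Q_iff: "P \<in> iota n ` K \<longleftrightarrow> Q' \<in> iota n ` K" if K: "closed_ideal K (BB n)" for K
  proof -
    note KI = iota_ideal[OF n K]
    \<comment> \<open>\<open>u\<close> itself need not belong to the matrix unitization. With
      additional factors \<open>Q\<close> the multipliers become matrices over \<open>A\<close>, so
      \<open>Q\<close> and \<open>Q'\<close> lie in the same ideals.\<close>
    have "Q' = (fadj u * Q) * Q * (Q * u)" using PQ by (simp add: Q'_def mult.assoc) (simp flip: mult.assoc)
    moreover have "Q = (Q * u) * Q' * (fadj u * Q)"
      using PQ by (simp add: Q'_def mult.assoc QE)
    ultimately have "Q \<in> iota n ` K \<longleftrightarrow> Q' \<in> iota n ` K"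
      using KI(3,4) EIB[OF Z(1)] EIB[OF Z(2)] by metis
    moreover have "P \<in> iota n ` K \<longleftrightarrow> Q \<in> iota n ` K"
      unfolding P_def Q_def by (rule single_mem_ideal_iff[OF n K pc(1) qc(1) gen])
    ultimately show ?thesis by simp
  qed
  obtain b w where b: "b \<in> carrier (BB n)" "X = iota n b" and w: "w \<in> carrier (BB n)" "W = iota n w"
    using XB WB by auto
  have bIR: "b \<in> IR_set (BB n)"
    by (rule IR_set_mem[OF n b(1) w(1) PB EIB[OF Q'EI]])
      (simp_all add: E WX XW XP QX Q_iff flip: b(2) w(2))
  obtain a where a: "\<And>i j. norm (ent W i j) \<le> a" "a \<ge> 0" by (rule bounded_entries[of W]) blast
  \<comment> \<open>The entries of \<open>g\<close> are bounded by \<open>n * a * d\<close>, and the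
    Neumann series asks that \<open>n\<close> times this bound be at most 1/2. Using
    \<open>a + 1\<close> avoids a division by 0.\<close>
  define d where "d = 1 / (2 * real n * real n * (a + 1))"
  have d0: "d > 0" using n a(2) by (simp add: d_def)
  have "has_IR (matrix_alg A n)" using IR n by (simp add: stable_IR_def)
  from invertible_approximation[OF n this bIR d0]
  obtain y z where y: "y \<in> carrier (BB n)" and z: "z \<in> carrier (BB n)"
    and yz: "iota n y * iota n z = E" "iota n z * iota n y = E" "\<And>i j. norm (ent (iota n y - X) i j) < d"
    unfolding E b(2) by blast
  define g where "g = W * (iota n y - X)"
  have fW: "fsize n W" using fX by (simp add: W_def)
  have fy: "fsize n (iota n y)" using y n by (intro fsize_iota) (auto simp: carrier_BB)
  have fg: "fsize n g" by (simp add: g_def fW fy fX)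
  have ng: "norm (ent g i j) \<le> real n * (a * d)" for i j
    unfolding g_def by (rule ent_mult_norm_le[OF fW a(1) _ a(2)]) (rule less_imp_le[OF yz(3)])
  have "real n * (real n * (a * d)) = a / (2 * (a + 1))"
    using n by (simp add: d_def)
  also have "\<dots> \<le> 1 / 2" using a(2) by (simp add: field_simps)
  finally obtain k where k: "g + k + g * k = 0" "g + k + k * g = 0"
    using neumann[OF fg ng] by metis
  obtain s t where st: "s * t = P" "t * s = Q'" "P * s = s" "s * Q' = s" "Q' * t = t" "t * P = t"
  proof (rule schur_complement_equivalence[of E X W "iota n y" "iota n z" P Q' k])
    show "W * (iota n y - X) + k + W * (iota n y - X) * k = 0" "W * (iota n y - X) + k + k * (W * (iota n y - X)) = 0"
      using k by (simp_all only: g_def)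
  qed (use Eu XB WB y z PB EIB[OF Q'EI] WX XW XP QX PW WQ yz PQ Q'Q' in auto)
  have uQ': "u * Q' = Q * u"
  proof -
    have "u * Q' = (u * fadj u) * Q * u" by (simp only: Q'_def mult.assoc)
    thus ?thesis by (simp only: u Eu(1)[OF QB])
  qed
  have Q'u: "Q' * fadj u = fadj u * Q" using arg_cong[OF uQ', of fadj] Q'Q' PQ by simp
  show ?thesis
  \<comment> \<open>The isomorphism found so far connects \<open>P\<close> with the rotated
    \<open>Q'\<close>; the factors \<open>u\<close> and \<open>fadj u\<close> carry it back to
    \<open>Q\<close>.\<close>
  proof (rule mvn_equiv_of_corner[OF p q, of "s * fadj u" "u * t", folded P_def Q_def])
    have "s * fadj u * (u * t) = s * (fadj u * u) * t" by (simp only: mult.assoc)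
    also have "s * (fadj u * u) = s"
      unfolding u by (subst (1 2) st(4)[symmetric]) (simp only: mult.assoc Eu(2)[OF EIB[OF Q'EI]])
    finally show "s * fadj u * (u * t) = P" by (simp only: st)
    have "u * t * (s * fadj u) = u * (t * s) * fadj u" by (simp only: mult.assoc)
    also have "\<dots> = Q * (u * fadj u)" by (simp only: st uQ' mult.assoc)
    finally show "u * t * (s * fadj u) = Q" by (simp only: u Eu(2)[OF QB])
    show "P * (s * fadj u) = s * fadj u" by (simp only: st mult.assoc[symmetric])
    show "s * fadj u * Q = s * fadj u" by (simp only: mult.assoc Q'u[symmetric]) (simp only: st mult.assoc[symmetric])
    show "Q * (u * t) = u * t" by (simp only: mult.assoc[symmetric] uQ'[symmetric]) (simp only: st mult.assoc)
    show "u * t * P = u * t" by (simp only: mult.assoc st)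
  qed
qed

end

theorem theorem3p3:
  fixes A :: "('a, 'b) cstar_scheme" and p q :: 'a
  assumes "cstar_algebra A"
    and "stable_IR A"
    and "p \<in> projections A" and "q \<in> projections A"
    and "gen_closed_ideal A {p} = gen_closed_ideal A {q}"
    and "K0_class A p = K0_class A q"
  shows "mvn_equiv A p q"
  using cstar_algebra.mvn_equiv_of_K0_class_eq[OF assms] .

end
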